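(* Let $n\ge1$ and let $T,S\in(\mathbf{T}_n^2)^\dagger$ be standard Young tableaux with at most two rows. (i) $T<_C S$ if and only if $w_T<_D w_S$. (ii) $T<_D S$ if and only if $w_T<_D w_S$. (iii) $\mathcal{V}_S\subseteq\overline{\mathcal{V}}_T$ if and only if $\mathfrak{n}\cap^{w_S}\mathfrak{n}\subseteq\mathfrak{n}\cap^{w_T}\mathfrak{n}$. (iv) The orders $\le_D$ and $\le_C$ coincide on $(\mathbf{T}_n^2)^\dagger$.
   Context: A (Young) tableau with entry set $E=\{m_1<\dots<m_n\}\subset\mathbb{Z}_{>0}$ is a filling of a Young diagram with $n$ boxes by the elements of $E$, each used once, increasing along rows and down columns. It is standard if $E=\{1,\dots,n\}$. $\mathbf{T}_n$ is the set of standard tableaux with $n$ boxes, $\mathbf{T}_n^2$ the subset of those with at most two columns, and $(\mathbf{T}_n^2)^\dagger$ the subset of those with at most two rows; $T^\dagger$ denotes the transpose of $T$. Shapes: $\mathrm{sh}(T)=(\lambda_1\ge\lambda_2\ge\dots)$ is the list of column lengths. Dominance order: $\lambda\ge\mu$ iff $\sum_{m\le i}\lambda_m\ge\sum_{m\le i}\mu_m$ for all $i$ not exceeding the number of parts of either. Projections: for $1\le i<j\le n$, $\pi_{i,j}(T)$ is obtained from $T$ by removing the entries $m_1,\dots,m_{i-1},m_{j+1},\dots,m_n$ by jeu de taquin (to remove an entry, delete it, repeatedly slide into the hole the smaller of the entries immediately to its right and immediately below it, until the hole is at an outer corner, then discard the hole; the final result does not depend on the order of removals). Chain order: $T\le_C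 S$ iff $\mathrm{sh}(\pi_{i,j}(T))\le\mathrm{sh}(\pi_{i,j}(S))$ for all $1\le i<j\le n$; $<_C$ is its strict version. Right weak order: for permutations in word form $w=[a_1,\dots,a_n]$, $a_i=w(i)$, let $p_w(i)$ be the position of $i$ in $w$. Put $w\le_D y$ iff for all $i<j$, $p_w(j)<p_w(i)$ implies $p_y(j)<p_y(i)$; $w<_D y$ means moreover $w\ne y$. Insertion: for a column $C$ and $j\notin C$, if some entry of $C$ is greater than $j$, then $j$ replaces the smallest such entry, which is bumped and inserted in the same way in the next column; otherwise $j$ is placed at the bottom of $C$ (an empty column receives $j$). $j\Rightarrow T$ is the tableau obtained by inserting $j$ into $T$ starting with the first column. For $w=[a_1,\dots,a_n]$, $T(w):=a_1\Rightarrow(a_2\Rightarrow(\cdots\Rightarrow(a_n)))$, and $\mathcal{C}_T:=\{w: T(w)=T\}$. Induced Duflo order on $\mathbf{T}_n$: $T\le_D S$ iff there is a sequence $T=P_1,\dots,P_k=S$ in $\mathbf{T}_n$ such that for each $1\le j<k$ there are $w\in\mathcal{C}_{P_j}$, $y\in\mathcal{C}_{P_{j+1}}$ with $w\le_D y$; $<_D$ is its strict version. Orbital varieties: let $G=SL_n(\mathbb{C})$ act on $\mathfrak{sl}_n(\mathbb{C})$ by conjugation, $B\subset G$ the subgroup of upper triangular matrices, $\mathfrak{n}$ the strictly upper triangular matrices; closures are Zariski closures. For $w\in\mathbf{S}_n$ let $\mathfrak{n}\cap^w\mathfrak{n}$ be the linear span of the matrix units $E_{i,j}$ with $i<j$ and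 $p_w(i)<p_w(j)$. There is a unique nilpotent orbit $\mathcal{O}_w$ with $\overline{G(\mathfrak{n}\cap^w\mathfrak{n})}=\overline{\mathcal{O}}_w$, and $\mathcal{V}_w:=\overline{B(\mathfrak{n}\cap^w\mathfrak{n})}\cap\mathcal{O}_w$ is an orbital variety, i.e. an irreducible component of $\mathcal{O}_w\cap\mathfrak{n}$. It is known that $\mathcal{V}_w=\mathcal{V}_y$ iff $T(w)=T(y)$; for a standard tableau $T$ put $\mathcal{V}_T:=\mathcal{V}_w$ for any $w\in\mathcal{C}_T$. Deletion: let $P$ be a tableau with at most two columns and let $a$ be an entry of $P$ at a corner box (no neighbours to the right or below). If $a$ is in the first column, $P\Leftarrow a$ is $P$ with that box removed, and $a^P:=a$. If $a$ is in the second column, $P\Leftarrow a$ is obtained by deleting $a$ from the second column and replacing by $a$ the greatest entry $b$ of the first column with $b<a$; then $a^P:=b$. The words: for $P\in\mathbf{T}_n^2$ put $P_{(n)}=P$ and, for $i=n,n-1,\dots,1$, let $z_i$ be the maximal entry of $P_{(i)}$, $a_i:=z_i^{P_{(i)}}$ and $P_{(i-1)}:=P_{(i)}\Leftarrow z_i$; then $w_P:=[a_n,a_{n-1},\dots,a_1]$. For $S\in(\mathbf{T}_n^2)^\dagger$, in this theorem $w_S$ denotes the reversed word $w_S:=\overline{w_{S^\dagger}}$, where $\overline{[b_1,\dots,b_n]}=[b_n,\dots,b_1]$ and $w_{S^\dagger}$ is the word just defined for $S^\dagger\in\mathbf{T}_n^2$. *)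

theory Defs
  imports
    "HOL-Combinatorics.Multiset_Permutations"
    "Jordan_Normal_Form.Determinant"
    "Jordan_Normal_Form.VS_Connect"
begin

section \<open>Young tableaux\<close>

text \<open>A tableau is the list of its nonempty columns, each read from top to bottom.\<close>

type_synonym tableau = "nat list list"

definition entries :: "tableau \<Rightarrow> nat set" where
  "entries T = set (concat T)"

definition is_tableau :: "tableau \<Rightarrow> bool" where
  "is_tableau T \<longleftrightarrow>
     [] \<notin> set T \<and> sorted_wrt (\<ge>) (map length T) \<and>
     (\<forall>C\<in>set T. sorted_wrt (<) C) \<and>
     (\<forall>R\<in>set (List.transpose T). sorted_wrt (<) R) \<and>
     distinct (concat T) \<and> 0 \<notin> entries T"

definition std_tableaux :: "nat \<Rightarrow> tableau set" where
  "std_tableaux n = {T. is_tableau T \<and> entries T = {1..n}}"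

definition two_row_tableaux :: "nat \<Rightarrow> tableau set" where
  "two_row_tableaux n = {T \<in> std_tableaux n. \<forall>C\<in>set T. length C \<le> 2}"

definition shape :: "tableau \<Rightarrow> nat list" where
  "shape T = map length T"

definition dominance_le :: "nat list \<Rightarrow> nat list \<Rightarrow> bool" where
  "dominance_le \<mu> \<nu> \<longleftrightarrow>
     (\<forall>i\<in>{1..min (length \<mu>) (length \<nu>)}. sum_list (take i \<mu>) \<le> sum_list (take i \<nu>))"

text \<open>The position of \<open>a\<close> in the list \<open>w\<close>, counted from \<open>0\<close>.\<close>

definition list_pos :: "'a list \<Rightarrow> 'a \<Rightarrow> nat" where
  "list_pos w a = length (takeWhile (\<lambda>x. x \<noteq> a) w)"


section \<open>Jeu de taquin and the chain order\<close>

text \<open>\<open>jdt_slide i T\<close> has the hole in row \<open>i\<close> (counted from \<open>0\<close>) of the first column of \<open>T\<close>.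
  The first case is a slide from below, the second one a slide from the right, and in the last
  case the hole is at an outer corner.\<close>

function jdt_slide :: "nat \<Rightarrow> tableau \<Rightarrow> tableau" where
  "jdt_slide i [] = []"
| "jdt_slide i (C # D) =
     (if i + 1 < length C \<and> (D = [] \<or> length (hd D) \<le> i \<or> C ! (i + 1) < hd D ! i)
      then jdt_slide (i + 1) (C[i := C ! (i + 1)] # D)
      else if D \<noteq> [] \<and> i < length (hd D)
      then C[i := hd D ! i] # jdt_slide i D
      else filter (\<lambda>K. K \<noteq> []) (butlast C # D))"
  by pat_completeness auto
termination
  by (relation "measures [\<lambda>(i, T). length T, \<lambda>(i, T). length (hd T) - i]") auto

fun jdt_remove :: "nat \<Rightarrow> tableau \<Rightarrow> tableau" where
  "jdt_remove a [] = []"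
| "jdt_remove a (C # D) =
     (if a \<in> set C then jdt_slide (list_pos C a) (C # D) else C # jdt_remove a D)"

text \<open>The entries above \<open>m\<^sub>j\<close> are removed in decreasing order and those below \<open>m\<^sub>i\<close> in
  increasing order; the result does not depend on the order of removals.\<close>

definition tab_proj :: "nat \<Rightarrow> nat \<Rightarrow> tableau \<Rightarrow> tableau" where
  "tab_proj i j T =
     (let m = sorted_list_of_set (entries T)
      in fold jdt_remove (take (i - 1) m @ rev (drop j m)) T)"

definition chain_le :: "nat \<Rightarrow> tableau \<Rightarrow> tableau \<Rightarrow> bool" where
  "chain_le n T S \<longleftrightarrow>
     (\<forall>i j. 1 \<le> i \<and> i < j \<and> j \<le> n \<longrightarrow>
        dominance_le (shape (tab_proj i j T)) (shape (tab_proj i j S)))"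

definition chain_less :: "nat \<Rightarrow> tableau \<Rightarrow> tableau \<Rightarrow> bool" where
  "chain_less n T S \<longleftrightarrow> chain_le n T S \<and> T \<noteq> S"


section \<open>The right weak order and the induced Duflo order\<close>

text \<open>Permutations of \<open>{1..n}\<close> are given in word form, as the elements of
  \<^term>\<open>permutations_of_set {1..n}\<close>.\<close>

definition weak_le :: "nat \<Rightarrow> nat list \<Rightarrow> nat list \<Rightarrow> bool" where
  "weak_le n w y \<longleftrightarrow>
     (\<forall>i j. 1 \<le> i \<and> i < j \<and> j \<le> n \<longrightarrow>
        list_pos w j < list_pos w i \<longrightarrow> list_pos y j < list_pos y i)"

definition weak_less :: "nat \<Rightarrow> nat list \<Rightarrow> nat list \<Rightarrow> bool" where
  "weak_less n w y \<longleftrightarrow> weak_le n w y \<and> w \<noteq> y"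

fun column_insert :: "nat \<Rightarrow> tableau \<Rightarrow> tableau" where
  "column_insert a [] = [[a]]"
| "column_insert a (C # D) =
     (if \<exists>c\<in>set C. a < c
      then let b = Min {c \<in> set C. a < c}
           in C[list_pos C b := a] # column_insert b D
      else (C @ [a]) # D)"

definition insertion_tableau :: "nat list \<Rightarrow> tableau" where
  "insertion_tableau w = foldr column_insert w []"

definition cell :: "nat \<Rightarrow> tableau \<Rightarrow> nat list set" where
  "cell n T = {w \<in> permutations_of_set {1..n}. insertion_tableau w = T}"

definition duflo_step :: "nat \<Rightarrow> (tableau \<times> tableau) set" where
  "duflo_step n = {(P, Q). P \<in> std_tableaux n \<and> Q \<in> std_tableaux n \<and>
     (\<exists>w\<in>cell n P. \<exists>y\<in>cell n Q. weak_le n w y)}"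

definition duflo_le :: "nat \<Rightarrow> tableau \<Rightarrow> tableau \<Rightarrow> bool" where
  "duflo_le n T S \<longleftrightarrow> (T, S) \<in> (duflo_step n)\<^sup>*"

definition duflo_less :: "nat \<Rightarrow> tableau \<Rightarrow> tableau \<Rightarrow> bool" where
  "duflo_less n T S \<longleftrightarrow> duflo_le n T S \<and> T \<noteq> S"


section \<open>The words of two-column and two-row tableaux\<close>

text \<open>For a tableau \<open>P\<close> with at most two columns and a corner entry \<open>a\<close>, \<open>deletion P a\<close> is
  \<open>P \<Leftarrow> a\<close> and \<open>deletion_out P a\<close> is \<open>a\<^sup>P\<close>.\<close>

definition deletion_out :: "tableau \<Rightarrow> nat \<Rightarrow> nat" where
  "deletion_out P a = (if a \<in> set (hd P) then a else Max {b \<in> set (hd P). b < a})"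

definition deletion :: "tableau \<Rightarrow> nat \<Rightarrow> tableau" where
  "deletion P a =
     filter (\<lambda>C. C \<noteq> [])
       (if a \<in> set (hd P) then removeAll a (hd P) # tl P
        else (hd P)[list_pos (hd P) (deletion_out P a) := a] # map (removeAll a) (tl P))"

fun two_column_word :: "nat \<Rightarrow> tableau \<Rightarrow> nat list" where
  "two_column_word 0 P = []"
| "two_column_word (Suc i) P =
     (let z = Max (entries P) in deletion_out P z # two_column_word i (deletion P z))"

definition two_row_word :: "nat \<Rightarrow> tableau \<Rightarrow> nat list" where
  "two_row_word n S = rev (two_column_word n (List.transpose S))"


section \<open>Orbital varieties\<close>

definition SL_mat :: "nat \<Rightarrow> complex mat set" where
  "SL_mat n = {g \<in> carrier_mat n n. det g = 1}"

definition borel_mat :: "nat \<Rightarrow> complex mat set" where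
  "borel_mat n = {g \<in> SL_mat n. upper_triangular g}"

definition sl_mat :: "nat \<Rightarrow> complex mat set" where
  "sl_mat n = {X \<in> carrier_mat n n. (\<Sum>i<n. X $$ (i, i)) = 0}"

inductive_set poly_funs :: "nat \<Rightarrow> (complex mat \<Rightarrow> complex) set" for n where
  const: "(\<lambda>X. c) \<in> poly_funs n"
| coord: "i < n \<Longrightarrow> j < n \<Longrightarrow> (\<lambda>X. X $$ (i, j)) \<in> poly_funs n"
| add: "f \<in> poly_funs n \<Longrightarrow> g \<in> poly_funs n \<Longrightarrow> (\<lambda>X. f X + g X) \<in> poly_funs n"
| mult: "f \<in> poly_funs n \<Longrightarrow> g \<in> poly_funs n \<Longrightarrow> (\<lambda>X. f X * g X) \<in> poly_funs n"

definition zariski_closure :: "nat \<Rightarrow> complex mat set \<Rightarrow> complex mat set" where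
  "zariski_closure n M =
     {A \<in> sl_mat n. \<forall>f\<in>poly_funs n. (\<forall>X\<in>M. f X = 0) \<longrightarrow> f A = 0}"

text \<open>The union of the \<open>H\<close>-conjugates of \<open>M\<close>: \<open>similar_mat_wit Y X g h\<close> says that \<open>g\<close> and \<open>h\<close>
  are mutually inverse and \<open>Y = g * X * h\<close>.\<close>

definition conj_set :: "complex mat set \<Rightarrow> complex mat set \<Rightarrow> complex mat set" where
  "conj_set H M = {Y. \<exists>g\<in>H. \<exists>X\<in>M. \<exists>h. similar_mat_wit Y X g h}"

definition nilpotent_orbit :: "nat \<Rightarrow> complex mat set \<Rightarrow> bool" where
  "nilpotent_orbit n \<O> \<longleftrightarrow>
     (\<exists>X\<in>sl_mat n. (\<exists>k. X ^\<^sub>m k = 0\<^sub>m n n) \<and> \<O> = conj_set (SL_mat n) {X})"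

text \<open>Rows and columns of \<open>E\<^sub>i\<^sub>j\<close> are counted from \<open>1\<close>, indices of \<^typ>\<open>complex mat\<close> from \<open>0\<close>.\<close>

definition matrix_unit :: "nat \<Rightarrow> nat \<Rightarrow> nat \<Rightarrow> complex mat" where
  "matrix_unit n i j = mat n n (\<lambda>(k, l). if k + 1 = i \<and> l + 1 = j then 1 else 0)"

definition n_cap :: "nat \<Rightarrow> nat list \<Rightarrow> complex mat set" where
  "n_cap n w =
     LinearCombinations.module.span class_ring (module_mat TYPE(complex) n n)
       {matrix_unit n i j | i j. 1 \<le> i \<and> i < j \<and> j \<le> n \<and> list_pos w i < list_pos w j}"

definition dense_orbit :: "nat \<Rightarrow> nat list \<Rightarrow> complex mat set" where
  "dense_orbit n w =
     (THE \<O>. nilpotent_orbit n \<O> \<and>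
        zariski_closure n (conj_set (SL_mat n) (n_cap n w)) = zariski_closure n \<O>)"

definition orbital_variety :: "nat \<Rightarrow> nat list \<Rightarrow> complex mat set" where
  "orbital_variety n w =
     zariski_closure n (conj_set (borel_mat n) (n_cap n w)) \<inter> dense_orbit n w"

text \<open>\<^term>\<open>orbital_variety n w\<close> is the same for all \<open>w \<in> cell n T\<close>.\<close>

definition tableau_variety :: "nat \<Rightarrow> tableau \<Rightarrow> complex mat set" where
  "tableau_variety n T = orbital_variety n (SOME w. w \<in> cell n T)"

end

theory Submission
  imports Defs "Jordan_Normal_Form.Jordan_Normal_Form_Uniqueness"
    "Jordan_Normal_Form.Jordan_Normal_Form_Existence"
begin

text \<open>Read the two rows of \<open>T\<close> as the up and down steps of a ballot path. Matching every down step with an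
  up step gives a noncrossing matching, and \<open>T \<le>\<^sub>C S\<close> means that the longest increasing subsequences on
  all intervals of values are at most as long for \<open>S\<close> as for \<open>T\<close>. An interval is a Dyck path iff such a
  subsequence covers at most half of it; therefore all matched pairs of \<open>T\<close> keep their rows in \<open>S\<close>,
  and the description of the inversions of \<open>w\<^sub>T\<close> by the rows gives \<open>w\<^sub>T \<le>\<^sub>D w\<^sub>S\<close>. Insertion and jeu de taquin
  are compared through Knuth equivalence of reading words.

  On the geometric side, Knuth moves do not change the closure of \<open>B(n \<inter> \<^sup>wn)\<close>, this closure is that of
  \<open>V\<^sub>w\<close> (there are finitely many nilpotent orbits, and \<open>n \<inter> \<^sup>wn\<close> is irreducible), and the vanishing of the
  \<open>m\<close>-th power on the block of rows and columns \<open>i..j\<close> detects the longest increasing subsequence there.\<close>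

section \<open>Increasing subsequences and Knuth equivalence\<close>

text \<open>All relations are compared through \<open>lis w {a..b}\<close> on intervals of values. A
  Knuth move changes this number not at all, since a lost subsequence is repaired by a letter of
  intermediate value, and adding inversions can only lower it. So inclusion of inversions yields
  every other relation, each of these yields inequalities of \<open>lis\<close>, and only the way
  back from \<open>lis\<close> to inversions is special to two rows. An inversion of the word with
  rows \<open>U\<close> and \<open>D\<close> is certified by some \<open>y\<close> with
  \<open>card (U \<inter> {i..y}) \<le> card (D \<inter> {j..y})\<close>. When matched pairs keep
  their rows, the upper row can only shrink and the lower one only grow, so the same
  \<open>y\<close> serves for S. Dyck intervals are detected because the lower entries before a cut
  and the upper entries after it always form an increasing subsequence. A Duflo sequence may a
  priori visit arbitrary standard tableaux; it stays among those with two rows because avoidance of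
  the pattern 321 is inherited downwards in the weak order. The dense orbit is unique because ranks
  of powers cannot increase in a closure.\<close>

definition before :: "'a list \<Rightarrow> 'a \<Rightarrow> 'a \<Rightarrow> bool" where
  "before w p q \<longleftrightarrow> list_pos w p < list_pos w q"

lemma list_pos_Nil: "list_pos [] a = 0"
  by (simp add: list_pos_def)

lemma list_pos_Cons: "list_pos (x # w) a = (if x = a then 0 else Suc (list_pos w a))"
  by (simp add: list_pos_def)

lemma list_pos_append:
  "list_pos (u @ v) a = (if a \<in> set u then list_pos u a else length u + list_pos v a)"
  by (induction u) (auto simp: list_pos_Cons)

lemma list_pos_less_length: "a \<in> set w \<Longrightarrow> list_pos w a < length w"
  by (induction w) (auto simp: list_pos_Cons)

lemma nth_list_pos: "a \<in> set w \<Longrightarrow> w ! list_pos w a = a"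
  by (induction w) (auto simp: list_pos_Cons)

lemma list_pos_inj: "a \<in> set w \<Longrightarrow> b \<in> set w \<Longrightarrow> list_pos w a = list_pos w b \<Longrightarrow> a = b"
  by (metis nth_list_pos)

lemma before_asym: "before w p q \<Longrightarrow> \<not> before w q p"
  by (simp add: before_def)

lemma before_total: "p \<in> set w \<Longrightarrow> q \<in> set w \<Longrightarrow> p \<noteq> q \<Longrightarrow> before w p q \<or> before w q p"
  using list_pos_inj[of p w q] unfolding before_def by linarith

lemma before_trans: "before w p q \<Longrightarrow> before w q s \<Longrightarrow> before w p s"
  by (simp add: before_def)

text \<open>A letter missing from a word has the length of the word as its position, so it counts as
  coming after every letter of the word. This explains the asymmetry of the two branches.\<close>

lemma before_append:
  "before (u @ v) p q \<longleftrightarrow>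
    (if p \<in> set u then q \<in> set u \<longrightarrow> before u p q else q \<notin> set u \<and> before v p q)"
  using list_pos_less_length[of p u] list_pos_less_length[of q u]
  by (auto simp: before_def list_pos_append)

lemma before_Cons: "before (x # w) p q \<longleftrightarrow> q \<noteq> x \<and> (p = x \<or> before w p q)"
  by (auto simp: before_def list_pos_Cons)

lemma before_Nil: "\<not> before [] p q"
  by (simp add: before_def list_pos_Nil)

lemma before_filter: "P p \<Longrightarrow> P q \<Longrightarrow> before (filter P w) p q \<longleftrightarrow> before w p q"
  by (induction w) (auto simp: before_Cons before_Nil)

text \<open>An increasing subsequence is encoded by its set of values, which determines it in a word
  with distinct letters.\<close>

definition chain :: "nat list \<Rightarrow> nat set \<Rightarrow> bool" where
  "chain w K \<longleftrightarrow> K \<subseteq> set w \<and> (\<forall>p\<in>K. \<forall>q\<in>K. p < q \<longrightarrow> before w p q)"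

lemma chain_empty: "chain w {}"
  by (simp add: chain_def)

lemma chain_finite: "chain w K \<Longrightarrow> finite K"
  unfolding chain_def using finite_subset by blast

definition lis :: "nat list \<Rightarrow> nat set \<Rightarrow> nat" where
  "lis w A = Max (card ` {K. chain w K \<and> K \<subseteq> A})"

lemma finite_chains: "finite {K. chain w K \<and> K \<subseteq> A}"
  by (rule finite_subset[of _ "Pow (set w)"]) (auto simp: chain_def)

lemma card_le_lis: "chain w K \<Longrightarrow> K \<subseteq> A \<Longrightarrow> card K \<le> lis w A"
  unfolding lis_def by (rule Max_ge) (auto simp: finite_chains)

lemma lis_le:
  assumes "\<And>K. chain w K \<Longrightarrow> K \<subseteq> A \<Longrightarrow> card K \<le> m"
  shows "lis w A \<le> m"
  unfolding lis_def using assms chain_empty[of w] by (subst Max_le_iff) (auto simp: finite_chains)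

lemma lis_obtain:
  obtains K where "chain w K" "K \<subseteq> A" "card K = lis w A"
proof -
  have "lis w A \<in> card ` {K. chain w K \<and> K \<subseteq> A}"
    unfolding lis_def using chain_empty[of w] by (intro Max_in) (auto simp: finite_chains)
  then show ?thesis using that by force
qed

lemma lis_mono:
  assumes "\<And>K. chain w K \<Longrightarrow> K \<subseteq> A \<Longrightarrow> \<exists>K'. chain w' K' \<and> K' \<subseteq> A' \<and> card K' = card K"
  shows "lis w A \<le> lis w' A'"
  by (rule lis_le) (metis assms card_le_lis)

lemma chain_filter: "(\<And>x. x \<in> K \<Longrightarrow> P x) \<Longrightarrow> chain (filter P w) K \<longleftrightarrow> chain w K"
  unfolding chain_def by (auto simp: before_filter)

lemma lis_filter:
  assumes "\<And>x. x \<in> A \<Longrightarrow> P x"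
  shows "lis (filter P w) A = lis w A"
proof -
  have "chain (filter P w) K \<longleftrightarrow> chain w K" if "K \<subseteq> A" for K
    using that assms by (intro chain_filter) auto
  then have "{K. chain (filter P w) K \<and> K \<subseteq> A} = {K. chain w K \<and> K \<subseteq> A}" by blast
  then show ?thesis by (simp add: lis_def)
qed

definition avoids321 :: "nat list \<Rightarrow> bool" where
  "avoids321 w \<longleftrightarrow>
     \<not> (\<exists>p\<in>set w. \<exists>q\<in>set w. \<exists>s\<in>set w. p < q \<and> q < s \<and> before w s q \<and> before w q p)"

lemma avoids321_append:
  assumes "distinct (u @ v)" "avoids321 (u @ v)"
  shows "avoids321 v"
proof -
  have b: "before (u @ v) p q = before v p q" if "p \<in> set v" "q \<in> set v" for p q
  proof -
    have "p \<notin> set u" "q \<notin> set u" using assms(1) that by auto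
    then show ?thesis by (simp add: before_append)
  qed
  show ?thesis using assms(2) unfolding avoids321_def by (metis b UnI2 set_append)
qed

section \<open>Knuth equivalence and its invariants\<close>

inductive knuth :: "nat list \<Rightarrow> nat list \<Rightarrow> bool" where
  knuth_refl: "knuth w w"
| knuth_sym: "knuth w w' \<Longrightarrow> knuth w' w"
| knuth_trans: "knuth w w' \<Longrightarrow> knuth w' w'' \<Longrightarrow> knuth w w''"
| knuth_xzy: "x < y \<Longrightarrow> y < z \<Longrightarrow> knuth (u @ [x, z, y] @ v) (u @ [z, x, y] @ v)"
| knuth_yxz: "x < y \<Longrightarrow> y < z \<Longrightarrow> knuth (u @ [y, x, z] @ v) (u @ [y, z, x] @ v)"

lemma knuth_append: "knuth w w' \<Longrightarrow> knuth (a @ w @ b) (a @ w' @ b)"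
proof (induction rule: knuth.induct)
  case (knuth_xzy x y z u v)
  then show ?case using knuth.knuth_xzy[of x y z "a @ u" "v @ b"] by simp
next
  case (knuth_yxz x y z u v)
  then show ?case using knuth.knuth_yxz[of x y z "a @ u" "v @ b"] by simp
qed (blast intro: knuth.intros)+

lemma knuth_mset: "knuth w w' \<Longrightarrow> mset w = mset w'"
  by (induction rule: knuth.induct) auto

lemma knuth_set: "knuth w w' \<Longrightarrow> set w = set w'"
  by (metis knuth_mset set_mset_mset)

lemma knuth_distinct: "knuth w w' \<Longrightarrow> distinct w = distinct w'"
  by (metis knuth_mset mset_eq_imp_distinct_iff)

text \<open>The two kinds of Knuth moves \<open>xzy \<rightarrow> zxy\<close> and \<open>yxz \<rightarrow> yzx\<close> (\<open>x < y < z\<close>) share this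
  description: only the pair \<open>x, z\<close> changes its order, and \<open>y\<close> is next to this pair.\<close>

definition knuth_swap :: "nat list \<Rightarrow> nat list \<Rightarrow> nat \<Rightarrow> nat \<Rightarrow> nat \<Rightarrow> bool" where
  "knuth_swap w w' x y z \<longleftrightarrow> x < y \<and> y < z \<and> x \<in> set w \<and> y \<in> set w \<and> z \<in> set w \<and>
     set w' = set w \<and> before w x z \<and> before w' z x \<and>
     (\<forall>p q. {p, q} \<noteq> {x, z} \<longrightarrow> before w' p q = before w p q) \<and>
     (\<forall>s. s \<noteq> x \<longrightarrow> s \<noteq> y \<longrightarrow> s \<noteq> z \<longrightarrow>
        before w s x = before w s y \<and> before w s z = before w s y \<and>
        before w x s = before w y s \<and> before w z s = before w y s) \<and>
     (before w y x \<and> before w y z \<or> before w x y \<and> before w z y)"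

lemma knuth_swap_xzy:
  assumes "distinct (u @ [x, z, y] @ v)" "x < y" "y < z"
  shows "knuth_swap (u @ [x, z, y] @ v) (u @ [z, x, y] @ v) x y z"
  using assms unfolding knuth_swap_def
  by (auto simp: before_append before_Cons doubleton_eq_iff)

lemma knuth_swap_yxz:
  assumes "distinct (u @ [y, x, z] @ v)" "x < y" "y < z"
  shows "knuth_swap (u @ [y, x, z] @ v) (u @ [y, z, x] @ v) x y z"
  using assms unfolding knuth_swap_def
  by (auto simp: before_append before_Cons doubleton_eq_iff)

text \<open>Distinctness is carried along the derivation, because a move is described by
  \<open>knuth_swap\<close> only for distinct letters. Invariance under single moves then extends to
  the equivalence generated by them.\<close>

lemma knuth_invariant:
  assumes "knuth w w'" "distinct w"
    and swap: "\<And>w w' x y z. distinct w \<Longrightarrow> distinct w' \<Longrightarrow> knuth_swap w w' x y z \<Longrightarrow> f w = f w'"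
  shows "f w = f w'"
  using assms(1,2)
proof (induction rule: knuth.induct)
  case (knuth_sym w w')
  then show ?case using knuth_distinct by metis
next
  case (knuth_trans w w' w'')
  then show ?case using knuth_distinct by metis
next
  case (knuth_xzy x y z u v)
  then show ?case by (intro swap[of _ _ x y z] knuth_swap_xzy) auto
next
  case (knuth_yxz x y z u v)
  then show ?case by (intro swap[of _ _ x y z] knuth_swap_yxz) auto
qed auto

text \<open>Only a subsequence through both \<open>x\<close> and \<open>z\<close> is destroyed by
  the move. Exchanging one of the two for the neighbour \<open>y\<close> repairs it; as
  \<open>y\<close> lies between them in value, the values stay in the interval.\<close>

lemma knuth_swap_lis:
  assumes sw: "knuth_swap w w' x y z"
  shows "lis w {a..b} = lis w' {a..b}"
proof (rule antisym)
  show "lis w' {a..b} \<le> lis w {a..b}"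
  proof (rule lis_mono)
    fix K assume K: "chain w' K" "K \<subseteq> {a..b}"
    have "\<not> (x \<in> K \<and> z \<in> K)"
      using K sw before_asym unfolding chain_def knuth_swap_def by (meson less_trans)
    then have "chain w K"
      using K sw unfolding chain_def knuth_swap_def by (metis doubleton_eq_iff)
    then show "\<exists>K'. chain w K' \<and> K' \<subseteq> {a..b} \<and> card K' = card K" using K by blast
  qed
  show "lis w {a..b} \<le> lis w' {a..b}"
  proof (rule lis_mono)
    fix K assume K: "chain w K" "K \<subseteq> {a..b}"
    show "\<exists>K'. chain w' K' \<and> K' \<subseteq> {a..b} \<and> card K' = card K"
    proof (cases "x \<in> K \<and> z \<in> K")
      case False
      then have "chain w' K"
        using K sw unfolding chain_def knuth_swap_def by (metis doubleton_eq_iff)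
      then show ?thesis using K by blast
    next
      case True
      have xyz: "x < y" "y < z" and same: "\<And>p q. {p, q} \<noteq> {x, z} \<Longrightarrow> before w' p q = before w p q"
        and adj: "\<And>s. s \<noteq> x \<Longrightarrow> s \<noteq> y \<Longrightarrow> s \<noteq> z \<Longrightarrow>
          before w s x = before w s y \<and> before w s z = before w s y \<and>
          before w x s = before w y s \<and> before w z s = before w y s"
        and side: "before w y x \<and> before w y z \<or> before w x y \<and> before w z y"
        and sets: "set w' = set w" "y \<in> set w"
        using sw unfolding knuth_swap_def by blast+
      \<comment> \<open>In value \<open>y\<close> lies between \<open>x\<close> and
        \<open>z\<close>, in the word it lies on one side of both.\<close>
      have y: "y \<notin> K"
        using K True xyz side before_asym[of w] unfolding chain_def by blast
      \<comment> \<open>The letter given up for \<open>y\<close>: it is \<open>z\<close> if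
        \<open>y\<close> follows the pair and \<open>x\<close> if \<open>y\<close> precedes
        it.\<close>
      obtain t where t: "t = x \<or> t = z" and
        tb: "(t = z \<and> before w x y) \<or> (t = x \<and> before w y z)" using side by blast
      define K' where "K' = insert y (K - {t})"
      have cK': "card K' = card K"
        unfolding K'_def using y t True chain_finite[OF K(1)]
        by (metis DiffE card.remove card_insert_disjoint finite_Diff)
      have "before w' p q" if pq: "p \<in> K'" "q \<in> K'" "p < q" for p q
      proof -
        have ne: "{p, q} \<noteq> {x, z}" using pq t y xyz unfolding K'_def by (auto simp: doubleton_eq_iff)
        have inK: "before w p q" if "p \<in> K" "q \<in> K" using K that pq(3) unfolding chain_def by blast
        have "before w p q"
        proof (cases "p = y")
          case py: True
          then have q: "q \<in> K" "q \<noteq> y" "q \<noteq> t" using pq unfolding K'_def by auto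
          show ?thesis
          proof (cases "q = z")
            case True
            then show ?thesis using py q t tb by auto
          next
            case False
            have "before w x q" using K True q py pq(3) xyz unfolding chain_def by (meson less_trans)
            then show ?thesis using adj[of q] False q py pq(3) xyz by auto
          qed
        next
          case npy: False
          then have p: "p \<in> K" "p \<noteq> t" using pq unfolding K'_def by auto
          show ?thesis
          proof (cases "q = y")
            case qy: True
            show ?thesis
            proof (cases "p = x")
              case True
              then show ?thesis using qy p t tb by auto
            next
              case False
              have "before w p z" using K True p qy pq(3) xyz unfolding chain_def by (meson less_trans)
              then show ?thesis using adj[of p] False npy p qy pq(3) xyz by auto
            qed
          next
            case False
            then show ?thesis using inK p pq unfolding K'_def by auto
          qed
        qed
        then show ?thesis using same[OF ne] by simp
      qed
      moreover have "K' \<subseteq> set w'" using K sets unfolding K'_def chain_def by auto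
      ultimately have "chain w' K'" unfolding chain_def by blast
      moreover have "K' \<subseteq> {a..b}"
      proof -
        have "a \<le> x" "z \<le> b" using K True by auto
        then show ?thesis using K xyz unfolding K'_def by auto
      qed
      ultimately show ?thesis using cK' by blast
    qed
  qed
qed

lemma knuth_lis: "knuth w w' \<Longrightarrow> distinct w \<Longrightarrow> lis w {a..b} = lis w' {a..b}"
  by (rule knuth_invariant) (auto intro: knuth_swap_lis)

text \<open>A pattern created by the move uses the new inversion of \<open>z\<close> and
  \<open>x\<close>. Since \<open>y\<close> is next to the pair, one of these two letters can be
  replaced by \<open>y\<close> to give a pattern that was present before.\<close>

lemma knuth_swap_avoids321:
  assumes sw: "knuth_swap w w' x y z"
  shows "avoids321 w = avoids321 w'"
proof -
  have xyz: "x < y" "y < z" and same: "\<And>p q. {p, q} \<noteq> {x, z} \<Longrightarrow> before w' p q = before w p q"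
    and adj: "\<And>s. s \<noteq> x \<Longrightarrow> s \<noteq> y \<Longrightarrow> s \<noteq> z \<Longrightarrow>
      before w s x = before w s y \<and> before w s z = before w s y \<and>
      before w x s = before w y s \<and> before w z s = before w y s"
    and side: "before w y x \<and> before w y z \<or> before w x y \<and> before w z y"
    and sets: "set w' = set w" "y \<in> set w" "x \<in> set w" "z \<in> set w"
    and xz: "before w x z" "before w' z x"
    using sw unfolding knuth_swap_def by blast+
  have dec: "before w' s q" if "before w s q" "q < s" for s q
    using same[of s q] that xyz xz before_asym[of w] by (auto simp: doubleton_eq_iff)
  have dec': "before w s q" if "before w' s q" "q < s" "\<not> (s = z \<and> q = x)" for s q
    using same[of s q] that xyz by (auto simp: doubleton_eq_iff)
  show ?thesis
  proof
    assume av: "avoids321 w'"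
    show "avoids321 w"
      unfolding avoids321_def
    proof (intro notI, elim bexE conjE)
      fix p q s assume "p \<in> set w" "q \<in> set w" "s \<in> set w" "p < q" "q < s" "before w s q" "before w q p"
      then show False using av dec sets unfolding avoids321_def by blast
    qed
  next
    assume av: "avoids321 w"
    show "avoids321 w'"
      unfolding avoids321_def
    proof (intro notI, elim bexE conjE)
      fix p q s assume in': "p \<in> set w'" "q \<in> set w'" "s \<in> set w'"
        and pqs: "p < q" "q < s" and b: "before w' s q" "before w' q p"
      have in_w: "p \<in> set w" "q \<in> set w" "s \<in> set w" using in' sets by auto
      consider "s = z" "q = x" | "q = z" "p = x" | "\<not> (s = z \<and> q = x)" "\<not> (q = z \<and> p = x)" by blast
      then show False
      proof cases
        case 1
        have bp: "before w x p" using dec'[OF b(2)] 1 pqs by auto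
        have p: "before w y p" using adj[of p] bp 1 pqs xyz by auto
        have zp: "before w z p" using adj[of p] bp 1 pqs xyz by auto
        show False using side
        proof
          assume "before w y x \<and> before w y z"
          then show False using av bp in_w sets 1 pqs xyz unfolding avoids321_def by blast
        next
          assume "before w x y \<and> before w z y"
          then show False using av p in_w sets 1 pqs xyz unfolding avoids321_def
            by (metis order.strict_trans)
        qed
      next
        case 2
        have bs: "before w s z" using dec'[OF b(1)] 2 pqs by auto
        have s: "before w s y" using adj[of s] bs 2 pqs xyz by auto
        show False using side
        proof
          assume "before w y x \<and> before w y z"
          then show False using av s in_w sets 2 pqs xyz unfolding avoids321_def
            by (metis order.strict_trans)
        next
          assume "before w x y \<and> before w z y"
          then show False using av bs in_w sets 2 pqs xyz unfolding avoids321_def by blast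
        qed
      next
        case 3
        then have "before w s q" "before w q p" using dec' b pqs by auto
        then show False using av in_w pqs unfolding avoids321_def by blast
      qed
    qed
  qed
qed

lemma knuth_avoids321: "knuth w w' \<Longrightarrow> distinct w \<Longrightarrow> avoids321 w = avoids321 w'"
  by (rule knuth_invariant[where f = avoids321]) (simp_all only: knuth_swap_avoids321)

section \<open>Two-row tableaux and column insertion\<close>

definition col_adj :: "nat list \<Rightarrow> nat list \<Rightarrow> bool" where
  "col_adj C C' \<longleftrightarrow> C ! 0 < C' ! 0 \<and> (length C' = 2 \<longrightarrow> length C = 2 \<and> C ! 1 < C' ! 1)"

definition short_col :: "nat list \<Rightarrow> bool" where
  "short_col C \<longleftrightarrow> (\<exists>c. C = [c]) \<or> (\<exists>c d. C = [c, d] \<and> c < d)"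

text \<open>\<open>col_adj\<close> is imposed on all pairs of columns and not just on neighbours, so
  that an induction can compare the first column with any later one. The entry set is left free,
  because insertion and jeu de taquin pass through other entry sets.\<close>

definition tab2 :: "tableau \<Rightarrow> bool" where
  "tab2 T \<longleftrightarrow> (\<forall>C\<in>set T. short_col C) \<and> sorted_wrt col_adj T"

definition reading :: "tableau \<Rightarrow> nat list" where
  "reading T = concat (map rev T)"

definition tops :: "tableau \<Rightarrow> nat set" where
  "tops T = hd ` set T"

definition bots :: "tableau \<Rightarrow> nat set" where
  "bots T = {C ! 1 | C. C \<in> set T \<and> length C = 2}"

lemma reading_simps: "reading [] = []" "reading (C # D) = rev C @ reading D"
  by (simp_all add: reading_def)

lemma mset_reading: "mset (reading T) = mset (concat T)"
  by (induction T) (auto simp: reading_simps)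

lemma set_reading: "set (reading T) = set (concat T)"
  by (metis mset_reading set_mset_mset)

lemma distinct_reading: "distinct (reading T) = distinct (concat T)"
  by (metis mset_reading mset_eq_imp_distinct_iff)

lemma tops_simps: "tops [] = {}" "tops (C # D) = insert (hd C) (tops D)"
  by (auto simp: tops_def)

lemma bots_simps: "bots [] = {}" "bots (C # D) = (if length C = 2 then {C ! 1} else {}) \<union> bots D"
  by (auto simp: bots_def)

lemma tab2_Nil: "tab2 []"
  by (simp add: tab2_def)

lemma tab2_Cons: "tab2 (C # D) \<longleftrightarrow> short_col C \<and> (\<forall>K\<in>set D. col_adj C K) \<and> tab2 D"
  by (auto simp: tab2_def)

lemma short_col_cases:
  assumes "short_col C"
  obtains c where "C = [c]" | c d where "C = [c, d]" "c < d"
  using assms unfolding short_col_def by blast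

lemma set_reading_tops_bots: "tab2 T \<Longrightarrow> set (reading T) = tops T \<union> bots T"
proof (induction T)
  case (Cons C D)
  then show ?case
    by (auto simp: tab2_Cons reading_simps tops_simps bots_simps elim!: short_col_cases)
qed (simp add: reading_simps tops_simps bots_simps)

lemma short_col_hd: "short_col C \<Longrightarrow> hd C = C ! 0"
  by (auto simp: short_col_def)

lemma tab2_tops_gt:
  assumes "tab2 (C # D)" "p \<in> tops D"
  shows "hd C < p"
proof -
  obtain K where K: "K \<in> set D" "p = hd K" using assms(2) by (auto simp: tops_def)
  then have "short_col C" "short_col K" "col_adj C K" using assms(1) by (auto simp: tab2_def)
  then show ?thesis using K by (simp add: short_col_hd col_adj_def)
qed

lemma tab2_bots_gt: "tab2 (C # D) \<Longrightarrow> p \<in> bots D \<Longrightarrow> length C = 2 \<and> C ! 1 < p"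
  unfolding tab2_Cons bots_def col_adj_def by blast

lemma tab2_bots_empty: "tab2 ([c] # D) \<Longrightarrow> bots D = {}"
  using tab2_bots_gt[of "[c]" D] by auto

lemma tops_below_bots: "tab2 T \<Longrightarrow> p \<in> bots T \<Longrightarrow> \<exists>c\<in>tops T. c < p"
  unfolding tab2_def bots_def tops_def by (force elim!: short_col_cases)


section \<open>Column insertion with at most two rows\<close>

lemma column_insert_1: "column_insert a ([c] # D) = (if a < c then [a] # column_insert c D else [c, a] # D)"
  by (auto simp: list_pos_Cons Let_def cong: conj_cong)

lemma column_insert_2:
  assumes "c < d"
  shows "column_insert a ([c, d] # D) =
    (if a < c then [a, d] # column_insert c D
     else if a < d then [c, a] # column_insert d D else [c, d, a] # D)"
proof (cases "a < c")
  case True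
  then have "{x \<in> set [c, d]. a < x} = {c, d}" using assms by auto
  then have "Min {x \<in> set [c, d]. a < x} = c" using assms by simp
  moreover have "\<exists>x\<in>set [c, d]. a < x" using True by simp
  ultimately show ?thesis using True unfolding column_insert.simps Let_def by (simp add: list_pos_Cons)
next
  case False
  then have "{x \<in> set [c, d]. a < x} = (if a < d then {d} else {})" by auto
  then show ?thesis using False assms unfolding column_insert.simps Let_def by (simp add: list_pos_Cons)
qed

declare column_insert.simps(2) [simp del]

lemma mset_column_insert: "\<forall>C\<in>set T. short_col C \<Longrightarrow> mset (concat (column_insert a T)) = add_mset a (mset (concat T))"
proof (induction T arbitrary: a)
  case (Cons C D)
  then show ?case
    by (auto simp: column_insert_1 column_insert_2 elim!: short_col_cases)
qed simp

text \<open>An entry below the whole first row only pushes this row one column to the right, each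
  top bumping the next one.\<close>

lemma bots_column_insert_less:
  "tab2 T \<Longrightarrow> \<forall>p\<in>tops T. a < p \<Longrightarrow> bots (column_insert a T) = bots T"
proof (induction T arbitrary: a)
  case (Cons C D)
  have "bots (column_insert (hd C) D) = bots D"
    using Cons.prems tab2_tops_gt[OF Cons.prems(1)] by (intro Cons.IH) (auto simp: tab2_Cons)
  with Cons.prems show ?case
    by (auto simp: column_insert_1 column_insert_2 tab2_Cons tops_simps bots_simps
        elim!: short_col_cases)
qed (simp add: bots_simps)

text \<open>When \<open>a\<close> bumps a second-row entry \<open>d\<close>, this bound, applied to
  the insertion of \<open>d\<close> into the remaining columns, keeps the second row
  increasing.\<close>

lemma bots_column_insert:
  "tab2 T \<Longrightarrow> bots (column_insert a T) \<subseteq> insert a (bots T)"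
proof (induction T arbitrary: a)
  case (Cons C D)
  have *: "bots (column_insert (hd C) D) = bots D"
    using Cons.prems tab2_tops_gt[OF Cons.prems] by (intro bots_column_insert_less) (auto simp: tab2_Cons)
  have **: "bots (column_insert b D) \<subseteq> insert b (bots D)" for b
    using Cons.prems by (intro Cons.IH) (auto simp: tab2_Cons)
  show ?case
    using Cons.prems * **[of "C ! 1"]
    by (auto simp: column_insert_1 column_insert_2 tab2_Cons tops_simps bots_simps
        elim!: short_col_cases split: if_splits)
qed (simp add: bots_simps)

text \<open>Insertion never shortens a column, so two rows at the end force two rows at every
  earlier stage.\<close>

lemma column_insert_short_before:
  "\<forall>C\<in>set (column_insert a T). length C \<le> 2 \<Longrightarrow> \<forall>C\<in>set T. length C \<le> 2"
proof (induction T arbitrary: a)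
  case (Cons C D)
  then show ?case by (auto simp: column_insert.simps(2) Let_def split: if_splits)
qed simp

lemma col_adj_allI:
  assumes "\<And>K. K \<in> set R \<Longrightarrow> short_col K" "\<And>x. x \<in> set (concat R) \<Longrightarrow> C ! 0 < x"
    and "\<And>x. x \<in> bots R \<Longrightarrow> length C = 2 \<and> C ! 1 < x"
  shows "\<forall>K\<in>set R. col_adj C K"
proof
  fix K assume K: "K \<in> set R"
  then have "K ! 0 \<in> set (concat R)" using assms(1)[OF K] by (force simp: short_col_def)
  moreover have "length K = 2 \<Longrightarrow> K ! 1 \<in> bots R" using K by (auto simp: bots_def)
  ultimately show "col_adj C K" using assms(2,3) unfolding col_adj_def by blast
qed

text \<open>For a first column \<open>c < d\<close>, one Knuth move on the letters \<open>a\<close>,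
  \<open>d\<close>, \<open>c\<close> puts the bumped letter last: \<open>adc\<close> becomes
  \<open>dac\<close> if \<open>a < c\<close>, and \<open>acd\<close> if \<open>c < a < d\<close>.
  The remaining case \<open>d < a\<close> would open a third row.\<close>

lemma tab2_column_insert:
  "tab2 T \<Longrightarrow> distinct (a # reading T) \<Longrightarrow> \<forall>C\<in>set (column_insert a T). length C \<le> 2 \<Longrightarrow>
     tab2 (column_insert a T) \<and> knuth (a # reading T) (reading (column_insert a T))"
proof (induction T arbitrary: a)
  case Nil
  then show ?case by (simp add: tab2_def reading_def short_col_def knuth_refl)
next
  case (Cons C D)
  have D: "tab2 D" and CD: "\<forall>K\<in>set D. col_adj C K" and C: "short_col C"
    using Cons.prems by (auto simp: tab2_Cons)
  have ent: "set (concat (column_insert b D)) = insert b (set (reading D))" for b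
    using mset_column_insert[of D b] D unfolding tab2_def
    by (metis set_mset_mset set_mset_add_mset_insert set_reading)
  have bots_hd: "bots (column_insert (hd C) D) = bots D"
    using tab2_tops_gt[OF Cons.prems(1)] D by (intro bots_column_insert_less) auto
  have gt0: "\<forall>x\<in>set (reading D). C ! 0 < x"
  proof
    fix x assume "x \<in> set (reading D)"
    then obtain y where "y \<in> tops D" "y \<le> x"
      using set_reading_tops_bots[OF D] tops_below_bots[OF D] by (force)
    then show "C ! 0 < x" using tab2_tops_gt[OF Cons.prems(1)] C
      by (metis hd_conv_nth list.distinct(1) order.strict_trans2 short_col_def)
  qed
  from C show ?case
  proof (cases rule: short_col_cases)
    case (1 c)
    show ?thesis
    proof (cases "a < c")
      case True
      have ins: "column_insert a (C # D) = [a] # column_insert c D" using True 1 column_insert_1 by simp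
      have IH: "tab2 (column_insert c D)" "knuth (c # reading D) (reading (column_insert c D))"
        using Cons.IH[of c] Cons.prems D ins 1 by (auto simp: reading_simps)
      have bD: "bots D = {}" using Cons.prems 1 tab2_bots_empty by blast
      have "\<forall>K\<in>set (column_insert c D). col_adj [a] K"
      proof (rule col_adj_allI)
        show "[a] ! 0 < x" if "x \<in> set (concat (column_insert c D))" for x
          using that gt0 True 1 unfolding ent by force
      qed (use IH bots_hd bD 1 in \<open>auto simp: tab2_def\<close>)
      moreover have "knuth (a # reading (C # D)) (reading (column_insert a (C # D)))"
        using knuth_append[OF IH(2), of "[a]" "[]"] 1 ins by (simp add: reading_simps)
      ultimately show ?thesis using IH ins by (simp add: tab2_Cons short_col_def)
    next
      case False
      then have "column_insert a (C # D) = [c, a] # D" using 1 column_insert_1 by simp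
      moreover have "c < a" using False Cons.prems 1 by (auto simp: reading_simps)
      moreover have "\<forall>K\<in>set D. col_adj [c, a] K" using CD 1 by (auto simp: col_adj_def)
      ultimately show ?thesis using 1 D by (simp add: tab2_Cons short_col_def reading_simps knuth_refl)
    qed
  next
    case (2 c d)
    consider "a < c" | "c < a" "a < d" | "d < a"
      using Cons.prems(2) 2 by (force simp: reading_simps)
    then show ?thesis
    proof cases
      case l: 1
      have ins: "column_insert a (C # D) = [a, d] # column_insert c D" using l 2 column_insert_2 by simp
      have IH: "tab2 (column_insert c D)" "knuth (c # reading D) (reading (column_insert c D))"
        using Cons.IH[of c] Cons.prems D ins 2 by (auto simp: reading_simps)
      have "\<forall>K\<in>set (column_insert c D). col_adj [a, d] K"
      proof (rule col_adj_allI)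
        show "[a, d] ! 0 < x" if "x \<in> set (concat (column_insert c D))" for x
          using that gt0 l 2 unfolding ent by force
        show "length [a, d] = 2 \<and> [a, d] ! 1 < x" if "x \<in> bots (column_insert c D)" for x
          using that bots_hd 2 tab2_bots_gt[OF Cons.prems(1)] by auto
      qed (use IH in \<open>auto simp: tab2_def\<close>)
      moreover have "knuth (a # reading (C # D)) (reading (column_insert a (C # D)))"
        using knuth_append[OF IH(2), of "[d, a]" "[]"] 2 ins
          knuth_xzy[of a c d "[]" "reading D"] l by (auto simp: reading_simps intro: knuth_trans)
      ultimately show ?thesis using IH ins l 2 by (simp add: tab2_Cons short_col_def)
    next
      case l: 2
      have ins: "column_insert a (C # D) = [c, a] # column_insert d D" using l 2 column_insert_2 by simp
      have IH: "tab2 (column_insert d D)" "knuth (d # reading D) (reading (column_insert d D))"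
        using Cons.IH[of d] Cons.prems D ins 2 by (auto simp: reading_simps)
      have "\<forall>K\<in>set (column_insert d D). col_adj [c, a] K"
      proof (rule col_adj_allI)
        show "[c, a] ! 0 < x" if "x \<in> set (concat (column_insert d D))" for x
          using that gt0 l 2 unfolding ent by force
        show "length [c, a] = 2 \<and> [c, a] ! 1 < x" if "x \<in> bots (column_insert d D)" for x
          using that bots_column_insert[OF D, of d] 2 l tab2_bots_gt[OF Cons.prems(1)] by force
      qed (use IH in \<open>auto simp: tab2_def\<close>)
      moreover have "knuth (a # reading (C # D)) (reading (column_insert a (C # D)))"
        using knuth_append[OF IH(2), of "[a, c]" "[]"] 2 ins
          knuth_sym[OF knuth_yxz[of c a d "[]" "reading D"]] l by (auto simp: reading_simps intro: knuth_trans)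
      ultimately show ?thesis using IH ins l 2 by (simp add: tab2_Cons short_col_def)
    next
      case 3
      then have "column_insert a (C # D) = [c, d, a] # D" using 2 column_insert_2 by auto
      then show ?thesis using Cons.prems by simp
    qed
  qed
qed

text \<open>A third row can only arise from \<open>c < d < a\<close>, and then \<open>a\<close>,
  \<open>d\<close>, \<open>c\<close> form the pattern 321. The Knuth moves of the insertion preserve
  avoidance, so the bumped letter is covered by induction.\<close>

lemma column_insert_short:
  "tab2 T \<Longrightarrow> distinct (a # reading T) \<Longrightarrow> avoids321 (a # reading T) \<Longrightarrow>
    \<forall>C\<in>set (column_insert a T). length C \<le> 2"
proof (induction T arbitrary: a)
  case (Cons C D)
  have D: "tab2 D" and C: "short_col C" using Cons.prems by (auto simp: tab2_Cons)
  from C show ?case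
  proof (cases rule: short_col_cases)
    case (1 c)
    have "avoids321 (c # reading D)"
      using Cons.prems avoids321_append[of "[a]" "c # reading D"] 1 by (simp add: reading_simps)
    then have "\<forall>C\<in>set (column_insert c D). length C \<le> 2"
      using Cons.IH[of c] Cons.prems D 1 by (auto simp: reading_simps)
    moreover have "\<forall>K\<in>set D. length K \<le> 2" using D by (force simp: tab2_def short_col_def)
    ultimately show ?thesis using 1 column_insert_1 by (auto)
  next
    case (2 c d)
    have dist: "distinct ([a, d, c] @ reading D)" and av: "avoids321 ([a, d, c] @ reading D)"
      using Cons.prems 2 by (simp_all add: reading_simps)
    consider "a < c" | "c < a" "a < d" | "d < a"
      using Cons.prems(2) 2 by (force simp: reading_simps)
    then show ?thesis
    proof cases
      case l: 1
      have "avoids321 ([d, a] @ c # reading D)"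
        using knuth_avoids321[OF knuth_xzy[of a c d "[]" "reading D"]] l 2 dist av by simp
      then have "avoids321 (c # reading D)" using dist avoids321_append[of "[d, a]" "c # reading D"] by simp
      then have "\<forall>C\<in>set (column_insert c D). length C \<le> 2"
        using Cons.IH[of c] D dist by auto
      then show ?thesis using l 2 column_insert_2 by (auto)
    next
      case l: 2
      have "avoids321 ([a, c] @ d # reading D)"
        using knuth_avoids321[OF knuth_yxz[of c a d "[]" "reading D"]] l 2 dist av by simp
      then have "avoids321 (d # reading D)" using dist avoids321_append[of "[a, c]" "d # reading D"] by auto
      then have "\<forall>C\<in>set (column_insert d D). length C \<le> 2"
        using Cons.IH[of d] D dist by auto
      then show ?thesis using l 2 column_insert_2 by (auto)
    next
      case 3
      have "before ([a, d, c] @ reading D) a d" "before ([a, d, c] @ reading D) d c"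
        using 2 3 by (auto simp: before_Cons)
      then show ?thesis using av 2 3 unfolding avoids321_def by force
    qed
  qed
qed simp

lemma insertion_tableau_knuth:
  "distinct w \<Longrightarrow> \<forall>C\<in>set (insertion_tableau w). length C \<le> 2 \<Longrightarrow>
    tab2 (insertion_tableau w) \<and> knuth w (reading (insertion_tableau w))"
proof (induction w)
  case Nil
  then show ?case by (simp add: insertion_tableau_def tab2_Nil reading_simps knuth_refl)
next
  case (Cons a w)
  let ?T = "insertion_tableau w"
  have ins: "insertion_tableau (a # w) = column_insert a ?T" by (simp add: insertion_tableau_def)
  have IH: "tab2 ?T" "knuth w (reading ?T)"
    using Cons column_insert_short_before[of a ?T] ins by auto
  have "distinct (a # reading ?T)" using Cons.prems knuth_distinct[OF IH(2)] knuth_set[OF IH(2)] by simp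
  then have "tab2 (column_insert a ?T) \<and> knuth (a # reading ?T) (reading (column_insert a ?T))"
    using tab2_column_insert[of ?T a] Cons.prems ins IH by simp
  then show ?case using knuth_append[OF IH(2), of "[a]" "[]"] ins by (auto intro: knuth_trans)
qed

lemma insertion_tableau_short:
  "distinct w \<Longrightarrow> avoids321 w \<Longrightarrow> \<forall>C\<in>set (insertion_tableau w). length C \<le> 2"
proof (induction w)
  case Nil
  then show ?case by (simp add: insertion_tableau_def)
next
  case (Cons a w)
  let ?T = "insertion_tableau w"
  have ins: "insertion_tableau (a # w) = column_insert a ?T" by (simp add: insertion_tableau_def)
  have "avoids321 w" using Cons.prems avoids321_append[of "[a]" w] by simp
  then have T: "tab2 ?T" "knuth w (reading ?T)" using Cons insertion_tableau_knuth[of w] by auto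
  have k: "knuth (a # w) (a # reading ?T)" using knuth_append[OF T(2), of "[a]" "[]"] by simp
  then have "distinct (a # reading ?T)" "avoids321 (a # reading ?T)"
    using knuth_avoids321[OF k] knuth_distinct[OF k] Cons.prems by auto
  then show ?case using column_insert_short T ins by simp
qed

section \<open>Increasing subsequences of reading words\<close>

lemma before_reading_tops: "tab2 T \<Longrightarrow> distinct (reading T) \<Longrightarrow> p \<in> tops T \<Longrightarrow> q \<in> tops T \<Longrightarrow> p < q \<Longrightarrow>
  before (reading T) p q"
proof (induction T)
  case (Cons C D)
  have D: "tab2 D" and C: "short_col C" using Cons.prems by (auto simp: tab2_Cons)
  have sub: "tops D \<subseteq> set (reading D)" using set_reading_tops_bots[OF D] by auto
  have "q \<noteq> hd C" using Cons.prems(3,5) tab2_tops_gt[OF Cons.prems(1)] by (fastforce simp: tops_simps)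
  then have q: "q \<in> tops D" using Cons.prems by (auto simp: tops_simps)
  then have nq: "q \<notin> set (rev C)" using sub Cons.prems(2) by (auto simp: reading_simps)
  show ?case
  proof (cases "p = hd C")
    case True
    then have "p \<in> set (rev C)" using C by (auto simp: short_col_def)
    then show ?thesis using nq by (simp add: reading_simps before_append)
  next
    case False
    then have "p \<in> tops D" using Cons.prems by (auto simp: tops_simps)
    then have "p \<notin> set (rev C)" using sub Cons.prems(2) by (auto simp: reading_simps)
    then show ?thesis using nq Cons q \<open>p \<in> tops D\<close> D by (simp add: reading_simps before_append)
  qed
qed (simp add: tops_simps)

lemma before_reading_bots: "tab2 T \<Longrightarrow> distinct (reading T) \<Longrightarrow> p \<in> bots T \<Longrightarrow> q \<in> bots T \<Longrightarrow> p < q \<Longrightarrow>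
  before (reading T) p q"
proof (induction T)
  case (Cons C D)
  have D: "tab2 D" and C: "short_col C" using Cons.prems by (auto simp: tab2_Cons)
  have sub: "bots D \<subseteq> set (reading D)" using set_reading_tops_bots[OF D] by auto
  have q: "q \<in> bots D" using Cons.prems(3-5) tab2_bots_gt[OF Cons.prems(1)] by (fastforce simp: bots_simps split: if_splits)
  then have nq: "q \<notin> set (rev C)" using sub Cons.prems(2) by (auto simp: reading_simps)
  show ?case
  proof (cases "p \<in> bots D")
    case False
    then have "p \<in> set (rev C)" using Cons.prems(3) by (auto simp: bots_simps split: if_splits)
    then show ?thesis using nq by (simp add: reading_simps before_append)
  next
    case True
    then have "p \<notin> set (rev C)" using sub Cons.prems(2) by (auto simp: reading_simps)
    then show ?thesis using nq Cons q True D by (simp add: reading_simps before_append)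
  qed
qed (simp add: bots_simps)

text \<open>Both rows are increasing subsequences, and two of any three letters share a row.\<close>

lemma avoids321_reading:
  assumes "tab2 T" "distinct (reading T)"
  shows "avoids321 (reading T)"
  unfolding avoids321_def
proof (intro notI, elim bexE conjE)
  fix p q s assume *: "p \<in> set (reading T)" "q \<in> set (reading T)" "s \<in> set (reading T)" "p < q" "q < s"
    "before (reading T) s q" "before (reading T) q p"
  have "before (reading T) s p" using *(6,7) before_trans by metis
  then have "\<not> before (reading T) p q" "\<not> before (reading T) q s" "\<not> before (reading T) p s"
    using * before_asym by metis+
  then show False
    using * before_reading_tops[OF assms] before_reading_bots[OF assms] set_reading_tops_bots[OF assms(1)]
    by (metis UnE order.strict_trans)
qed

text \<open>A chain meets every block of the word at most once, and blocks are represented by their smallest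
  (last) letter.\<close>

lemma card_chain_blocks:
  assumes "\<forall>b\<in>set bs. short_col (rev b)" "distinct (concat bs)" "chain (concat bs) K" "K \<subseteq> {..x}"
  shows "card K \<le> card (last ` set bs \<inter> {..x})"
  using assms
proof (induction bs arbitrary: K)
  case (Cons b bs)
  let ?K1 = "K \<inter> set b" and ?K2 = "K \<inter> set (concat bs)"
  have fin: "finite K" using Cons.prems chain_finite by blast
  have "chain (concat bs) ?K2"
    unfolding chain_def
  proof (intro conjI ballI impI)
    fix p q assume pq: "p \<in> ?K2" "q \<in> ?K2" "p < q"
    have "p \<notin> set b" "q \<notin> set b" using pq Cons.prems(2) by auto
    moreover have "before (concat (b # bs)) p q" using Cons.prems(3) pq unfolding chain_def by blast
    ultimately show "before (concat bs) p q" by (simp add: before_append)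
  qed auto
  then have 2: "card ?K2 \<le> card (last ` set bs \<inter> {..x})" using Cons by auto
  have K: "K = ?K1 \<union> ?K2" using Cons.prems(3) unfolding chain_def by auto
  have b: "short_col (rev b)" using Cons.prems by simp
  have lastin: "last c \<in> set c" if "short_col (rev c)" for c
    using that by (metis last_in_set list.distinct(1) rev.simps(1) short_col_def)
  have nl: "last b \<notin> last ` set bs"
  proof
    assume "last b \<in> last ` set bs"
    then obtain c where "c \<in> set bs" "last c = last b" by force
    then show False using lastin[OF b] lastin[of c] Cons.prems(1,2) by force
  qed
  show ?case
  proof (cases "?K1 = {}")
    case True
    then have "card K \<le> card (last ` set bs \<inter> {..x})" using 2 K by simp
    also have "\<dots> \<le> card (last ` set (b # bs) \<inter> {..x})" by (intro card_mono) auto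
    finally show ?thesis .
  next
    case False
    have "\<exists>k. ?K1 = {k} \<and> last b \<le> k"
      using b
    proof (cases rule: short_col_cases)
      case (1 c)
      then have "b = [c]" by (metis rev_rev_ident rev_singleton_conv)
      then show ?thesis using False by auto
    next
      case (2 c d)
      then have bdc: "b = [d, c]" by (metis append_Cons append_Nil rev.simps rev_rev_ident)
      have "\<not> (c \<in> K \<and> d \<in> K)"
        using Cons.prems(3) 2 unfolding chain_def bdc by (auto simp: before_Cons)
      then have "?K1 = {c} \<or> ?K1 = {d}" using False bdc by auto
      moreover have "last b = c" using bdc by simp
      ultimately show ?thesis using \<open>c < d\<close> by (metis less_imp_le order_refl)
    qed
    then obtain k where k: "?K1 = {k}" "last b \<le> k" by blast
    then have "last b \<le> x" using Cons.prems(4) by auto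
    then have "last ` set (b # bs) \<inter> {..x} = insert (last b) (last ` set bs \<inter> {..x})" by auto
    then have "card (last ` set (b # bs) \<inter> {..x}) = Suc (card (last ` set bs \<inter> {..x}))"
      using nl by (simp add: card_insert_disjoint)
    moreover have "card K \<le> card ?K1 + card ?K2" using K card_Un_le by metis
    ultimately show ?thesis using 2 k by simp
  qed
qed (simp add: chain_def)

lemma lis_blocks:
  assumes "\<forall>b\<in>set bs. short_col (rev b)" "distinct (concat bs)"
    and "chain (concat bs) (last ` set bs)"
  shows "lis (concat bs) {..x} = card (last ` set bs \<inter> {..x})"
proof (rule antisym)
  show "lis (concat bs) {..x} \<le> card (last ` set bs \<inter> {..x})"
    by (intro lis_le card_chain_blocks assms)
  show "card (last ` set bs \<inter> {..x}) \<le> lis (concat bs) {..x}"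
    using assms(3) by (intro card_le_lis) (auto simp: chain_def)
qed

text \<open>The first row is itself an increasing subsequence, and it consists of the last letters
  of the decreasing blocks given by the columns.\<close>

lemma lis_reading:
  assumes "tab2 T" "distinct (reading T)"
  shows "lis (reading T) {..x} = card (tops T \<inter> {..x})"
proof -
  have t: "tops T = last ` set (map rev T)"
    using assms(1) unfolding tops_def tab2_def
    by (auto simp: image_image short_col_def last_rev intro!: image_cong)
  have "chain (reading T) (tops T)"
    unfolding chain_def using before_reading_tops[OF assms] set_reading_tops_bots[OF assms(1)] by auto
  then show ?thesis
    using lis_blocks[of "map rev T" x] assms t by (simp add: reading_def tab2_def)
qed

section \<open>Jeu de taquin and the chain order\<close>

lemma tab2_two_row:
  assumes "T \<in> two_row_tableaux n"
  shows "tab2 T" "distinct (reading T)" "set (reading T) = {1..n}"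
proof -
  have T: "[] \<notin> set T" "sorted_wrt (\<ge>) (map length T)" "\<forall>C\<in>set T. sorted_wrt (<) C"
    "\<forall>R\<in>set (List.transpose T). sorted_wrt (<) R" "distinct (concat T)" "set (concat T) = {1..n}"
    "\<forall>C\<in>set T. length C \<le> 2"
    using assms unfolding two_row_tableaux_def std_tableaux_def is_tableau_def entries_def by auto
  show "distinct (reading T)" "set (reading T) = {1..n}"
    using T by (simp_all only: distinct_reading set_reading)
  have short: "short_col C" if "C \<in> set T" for C
  proof -
    have C: "C \<noteq> []" "length C \<le> 2" "sorted_wrt (<) C" using T that by auto
    then show ?thesis
      unfolding short_col_def by (cases C; cases "tl C") auto
  qed
  have rows: "sorted_wrt (<) (map (\<lambda>C. C ! i) (filter (\<lambda>C. i < length C) T))" for i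
  proof (cases "i < length (List.transpose T)")
    case True
    then show ?thesis using T(4) nth_transpose[OF True] by (metis nth_mem)
  next
    case False
    have "length C \<le> i" if "C \<in> set T" for C
    proof -
      have "foldr (\<lambda>xs. max (length xs)) T 0 \<le> i" using False by (simp add: length_transpose)
      moreover have "length C \<le> foldr (\<lambda>xs. max (length xs)) T 0" using that by (induction T) auto
      ultimately show ?thesis by simp
    qed
    then have "filter (\<lambda>C. i < length C) T = []" by (auto simp: filter_empty_conv not_less)
    then show ?thesis by simp
  qed
  have "sorted_wrt col_adj T"
    using T(2) rows[of 0] rows[of 1] short
  proof (induction T)
    case (Cons C D)
    have C: "short_col C" and D: "\<forall>K\<in>set D. short_col K" using Cons.prems by auto
    have ne: "0 < length K" if "K \<in> set (C # D)" for K using Cons.prems(4)[OF that] by (auto simp: short_col_def)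
    have "sorted_wrt col_adj D"
    proof (rule Cons.IH)
      show "sorted_wrt (<) (map (\<lambda>C. C ! 0) (filter (\<lambda>C. 0 < length C) D))"
        using Cons.prems(2) by (auto split: if_splits)
      show "sorted_wrt (<) (map (\<lambda>C. C ! 1) (filter (\<lambda>C. 1 < length C) D))"
        using Cons.prems(3) by (auto split: if_splits)
    qed (use Cons.prems in auto)
    moreover have "col_adj C K" if K: "K \<in> set D" for K
    proof -
      have "length K \<le> length C" using Cons.prems(1) K by auto
      moreover have "C ! 0 < K ! 0" using Cons.prems(2) K ne[of C] ne[of K] by auto
      moreover have "length C \<le> 2" using C by (auto simp: short_col_def)
      moreover have "C ! 1 < K ! 1" if "length K = 2" "length C = 2" using Cons.prems(3) K that by auto
      ultimately show ?thesis by (auto simp: col_adj_def)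
    qed
    ultimately show ?case by simp
  qed simp
  then show "tab2 T" using short by (simp add: tab2_def)
qed

section \<open>Removal of an extreme entry by jeu de taquin\<close>

lemma filter_nonempty_short: "\<forall>K\<in>set D. short_col K \<Longrightarrow> filter (\<lambda>K. K \<noteq> []) D = D"
  by (auto simp: filter_id_conv short_col_def)

text \<open>The hole is the box below \<open>c\<close>, and \<open>d\<close> is merely the stale
  value stored there. When the entry \<open>d'\<close> of the next column \<open>c' < d'\<close>
  slides left, the reading word undergoes the Knuth move from \<open>c d' c'\<close> to
  \<open>d' c c'\<close>.\<close>

lemma jdt_slide_lower:
  "tab2 D \<Longrightarrow> \<forall>K\<in>set D. c < K ! 0 \<and> (length K = 2 \<longrightarrow> d < K ! 1) \<Longrightarrow>
    R = jdt_slide 1 ([c, d] # D) \<Longrightarrow>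
    tab2 R \<and> (\<forall>K\<in>set R. c \<le> K ! 0 \<and> (length K = 2 \<longrightarrow> d < K ! 1)) \<and>
    mset (concat R) = add_mset c (mset (concat D)) \<and> knuth (c # reading D) (reading R)"
proof (induction D arbitrary: c d R)
  case Nil
  then show ?case by (simp add: tab2_def short_col_def reading_simps knuth_refl)
next
  case (Cons C' D')
  have D': "tab2 D'" "\<forall>K\<in>set D'. col_adj C' K" "short_col C'" using Cons.prems by (auto simp: tab2_Cons)
  from D'(3) show ?case
  proof (cases rule: short_col_cases)
    case (1 c')
    then have R: "R = [c] # C' # D'"
      using Cons.prems(3) filter_nonempty_short[of "C' # D'"] Cons.prems(1) by (simp add: tab2_def)
    have no2: "length K \<noteq> 2" if "K \<in> set D'" for K using D'(2) that 1 by (auto simp: col_adj_def)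
    have "\<forall>K\<in>set (C' # D'). col_adj [c] K" using Cons.prems(2) 1 no2 by (auto simp: col_adj_def)
    then have "tab2 R" using R Cons.prems(1) by (simp add: tab2_Cons[of "[c]"] short_col_def)
    then show ?thesis using R Cons.prems no2 1 by (auto simp: reading_simps knuth_refl intro: less_imp_le)
  next
    case (2 c' d')
    define R' where "R' = jdt_slide 1 ([c', d'] # D')"
    have R: "R = [c, d'] # R'" using Cons.prems(3) 2 by (simp add: R'_def)
    have "\<forall>K\<in>set D'. c' < K ! 0 \<and> (length K = 2 \<longrightarrow> d' < K ! 1)"
      using D'(2) 2 by (auto simp: col_adj_def)
    from Cons.IH[OF D'(1) this R'_def] have IH: "tab2 R'"
      "\<forall>K\<in>set R'. c' \<le> K ! 0 \<and> (length K = 2 \<longrightarrow> d' < K ! 1)"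
      "mset (concat R') = add_mset c' (mset (concat D'))" "knuth (c' # reading D') (reading R')" by auto
    have lt: "c < c'" "d < d'" using Cons.prems(2) 2 by auto
    have "tab2 R" unfolding R tab2_Cons using IH lt 2 by (auto simp: short_col_def col_adj_def)
    moreover have "knuth (c # reading (C' # D')) (reading R)"
      using knuth_xzy[of c c' d' "[]" "reading D'"] knuth_append[OF IH(4), of "[d', c]" "[]"] lt 2 R
      by (auto simp: reading_simps intro: knuth_trans)
    ultimately show ?thesis using IH lt R 2 by (auto simp: less_imp_le)
  qed
qed

text \<open>If the hole moves down, what follows is a slide in the second row. If it moves right out
  of a column with second entry \<open>d\<close>, past a column \<open>c' < d'\<close>, then
  \<open>d d' c'\<close> becomes \<open>d c' d'\<close> by one Knuth move. The bounds on
  \<open>K\<close> allow the next column on the left to be put back.\<close>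

lemma jdt_slide_upper:
  "tab2 (C # D) \<Longrightarrow> distinct (reading (C # D)) \<Longrightarrow> R = jdt_slide 0 (C # D) \<Longrightarrow>
    tab2 R \<and> (\<forall>K\<in>set R. hd C < K ! 0 \<and> (length K = 2 \<longrightarrow> length C = 2 \<and> C ! 1 \<le> K ! 1)) \<and>
    add_mset (hd C) (mset (concat R)) = mset (concat (C # D)) \<and> knuth (rev (tl C) @ reading D) (reading R)"
proof (induction D arbitrary: C R)
  case Nil
  have "short_col C" using Nil by (simp add: tab2_Cons)
  then show ?case
  proof (cases rule: short_col_cases)
    case (1 c)
    then show ?thesis using Nil by (simp add: tab2_def short_col_def reading_simps knuth_refl)
  next
    case (2 c d)
    then show ?thesis using Nil by (simp add: tab2_def short_col_def reading_simps knuth_refl)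
  qed
next
  case (Cons C' D')
  have D: "tab2 (C' # D')" "\<forall>K\<in>set (C' # D'). col_adj C K" "short_col C" and C': "short_col C'"
    using Cons.prems by (auto simp: tab2_Cons)
  define R' where "R' = jdt_slide 0 (C' # D')"
  have "distinct (reading (C' # D'))" using Cons.prems by (simp add: reading_simps)
  from Cons.IH[OF D(1) this R'_def] have IH: "tab2 R'"
    "\<And>K. K \<in> set R' \<Longrightarrow> hd C' < K ! 0 \<and> (length K = 2 \<longrightarrow> length C' = 2 \<and> C' ! 1 \<le> K ! 1)"
    "add_mset (hd C') (mset (concat R')) = mset (concat (C' # D'))"
    "knuth (rev (tl C') @ reading D') (reading R')" by auto
  have hd': "hd C' = C' ! 0" "0 < length C'" using C' by (auto simp: short_col_def)
  from D(3) show ?case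
  proof (cases rule: short_col_cases)
    case (1 c)
    have R: "R = [C' ! 0] # R'" using Cons.prems(3) 1 hd' by (simp add: R'_def)
    have l: "c < C' ! 0" "length C' \<noteq> 2" using D(2) 1 by (auto simp: col_adj_def)
    then have "tab2 R" unfolding R tab2_Cons using IH hd' by (auto simp: short_col_def col_adj_def)
    moreover have "C' = [C' ! 0]" using C' l by (auto simp: short_col_def)
    then have e: "rev (tl C) @ reading (C' # D') = C' ! 0 # rev (tl C') @ reading D'"
      using 1 by (metis append_Cons append_Nil list.sel(3) reading_simps(2) rev.simps(1) rev_singleton_conv)
    have "knuth (rev (tl C) @ reading (C' # D')) (reading R)"
      unfolding e using knuth_append[OF IH(4), of "[C' ! 0]" "[]"] R by (simp add: reading_simps)
    ultimately show ?thesis using R IH l 1 hd' by (auto dest!: IH(2))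
  next
    case (2 c d)
    have cc: "c < C' ! 0" using D(2) 2 by (auto simp: col_adj_def)
    show ?thesis
    proof (cases "d < C' ! 0")
      case True
      \<comment> \<open>The slide from below has copied \<open>d\<close> upwards, and the box of the
        hole still stores it.\<close>
      then have R: "R = jdt_slide 1 ([d, d] # C' # D')" using Cons.prems(3) 2 hd' by simp
      have "\<forall>K\<in>set (C' # D'). d < K ! 0 \<and> (length K = 2 \<longrightarrow> d < K ! 1)"
        using D True 2 by (auto simp: col_adj_def tab2_Cons)
      from jdt_slide_lower[OF D(1) this R] show ?thesis using 2 by auto
    next
      case False
      have "C' ! 0 \<in> set (reading (C' # D'))" using hd' by (simp add: reading_simps)
      then have lt: "C' ! 0 < d" using False Cons.prems(2) 2 by (auto simp: reading_simps not_less order_le_less)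
      have R: "R = [C' ! 0, d] # R'" using Cons.prems(3) 2 hd' False by (simp add: R'_def)
      have "tab2 R" unfolding R tab2_Cons
        using IH(1,2) hd' lt D(2) 2 by (fastforce simp: short_col_def col_adj_def)
      moreover have "knuth (rev (tl C) @ reading (C' # D')) (reading R)"
        using C'
      proof (cases rule: short_col_cases)
        case (1 c')
        then show ?thesis using knuth_append[OF IH(4), of "[d, c']" "[]"] R 2 by (simp add: reading_simps)
      next
        case c'd': (2 c' d')
        have "d < d'" using D(2) 2 c'd' by (auto simp: col_adj_def)
        then show ?thesis
          using knuth_append[OF IH(4), of "[d, c']" "[]"] R 2 c'd' lt
            knuth_sym[OF knuth_yxz[of c' d d' "[]" "reading D'"]]
          by (auto simp: reading_simps intro: knuth_trans)
      qed
      moreover have "\<forall>K\<in>set R. hd C < K ! 0 \<and> (length K = 2 \<longrightarrow> length C = 2 \<and> C ! 1 \<le> K ! 1)"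
      proof
        fix K assume "K \<in> set R"
        then consider "K = [C' ! 0, d]" | "K \<in> set R'" using R by auto
        then show "hd C < K ! 0 \<and> (length K = 2 \<longrightarrow> length C = 2 \<and> C ! 1 \<le> K ! 1)"
        proof cases
          case K: 2
          have "length C' = 2 \<Longrightarrow> d < C' ! 1" using D(2) 2 by (auto simp: col_adj_def)
          then show ?thesis using IH(2)[OF K] cc hd' 2 by auto
        qed (use cc 2 in auto)
      qed
      ultimately show ?thesis using R IH(3) 2 hd' by auto
    qed
  qed
qed

text \<open>The largest entry occupies an outer corner, so nothing slides and its letter just leaves
  the word. The clause on columns transports \<open>col_adj\<close> to the columns further
  left.\<close>

lemma jdt_remove_max:
  "tab2 T \<Longrightarrow> distinct (reading T) \<Longrightarrow> e \<in> set (reading T) \<Longrightarrow> \<forall>x\<in>set (reading T). x \<le> e \<Longrightarrow>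
    R = jdt_remove e T \<Longrightarrow>
    tab2 R \<and> (\<forall>K\<in>set R. \<exists>K'\<in>set T. K ! 0 = K' ! 0 \<and> (length K = 2 \<longrightarrow> length K' = 2 \<and> K ! 1 = K' ! 1)) \<and>
    reading R = filter (\<lambda>x. x \<noteq> e) (reading T)"
proof (induction T arbitrary: R)
  case (Cons C D)
  have D: "tab2 D" "\<forall>K\<in>set D. col_adj C K" "short_col C" using Cons.prems by (auto simp: tab2_Cons)
  have filt: "filter (\<lambda>K. K \<noteq> []) D = D" using D by (intro filter_nonempty_short) (auto simp: tab2_def)
  show ?case
  proof (cases "e \<in> set C")
    case True
    have nD: "e \<notin> set (reading D)" using Cons.prems(2) True by (auto simp: reading_simps)
    then have fD: "filter (\<lambda>x. x \<noteq> e) (reading D) = reading D" by (auto simp: filter_id_conv)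
    have R: "R = jdt_slide (list_pos C e) (C # D)" using Cons.prems(5) True by simp
    from D(3) show ?thesis
    proof (cases rule: short_col_cases)
      case (1 c)
      have "D = []"
      proof (rule ccontr)
        assume "D \<noteq> []"
        then obtain K where K: "K \<in> set D" by (cases D) auto
        then have "K ! 0 \<in> set (reading D)" using D(1) by (force simp: tab2_def short_col_def set_reading)
        then show False using Cons.prems(4) D(2) K True 1 by (fastforce simp: col_adj_def reading_simps)
      qed
      then show ?thesis using R True 1 by (simp add: list_pos_Cons tab2_Nil reading_simps)
    next
      case (2 c d)
      have e: "e = d" using True Cons.prems(4) 2 by (auto simp: reading_simps)
      have no2: "length K \<noteq> 2" if "K \<in> set D" for K
      proof
        assume l: "length K = 2"
        then have "K ! 1 \<in> set (reading D)" using that by (auto simp: set_reading intro!: bexI[of _ K])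
        then show False using Cons.prems(4) D(2) that l 2 e by (fastforce simp: col_adj_def reading_simps)
      qed
      have "length K \<le> 1" if "K \<in> set D" for K
        using no2[OF that] D(1) that by (auto simp: tab2_def short_col_def)
      then have "\<not> (D \<noteq> [] \<and> 1 < length (hd D))" by (metis hd_in_set not_less)
      then have "R = [c] # D" using R 2 e filt by (simp add: list_pos_Cons)
      moreover have "\<forall>K\<in>set D. col_adj [c] K" using D(2) no2 2 by (auto simp: col_adj_def)
      ultimately show ?thesis using D(1) e 2 fD Cons.prems(2)
        by (auto simp: tab2_Cons short_col_def reading_simps)
    qed
  next
    case False
    define R' where "R' = jdt_remove e D"
    have R: "R = C # R'" using Cons.prems(5) False by (simp add: R'_def)
    have IH: "tab2 R'"
      "\<And>K. K \<in> set R' \<Longrightarrow> \<exists>K'\<in>set D. K ! 0 = K' ! 0 \<and> (length K = 2 \<longrightarrow> length K' = 2 \<and> K ! 1 = K' ! 1)"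
      "reading R' = filter (\<lambda>x. x \<noteq> e) (reading D)"
      using Cons.IH[OF D(1) _ _ _ R'_def] Cons.prems False by (auto simp: reading_simps)
    have "\<forall>K\<in>set R'. col_adj C K"
    proof
      fix K assume "K \<in> set R'"
      then obtain K' where "K' \<in> set D" "K ! 0 = K' ! 0" "length K = 2 \<longrightarrow> length K' = 2 \<and> K ! 1 = K' ! 1"
        using IH(2) by blast
      then show "col_adj C K" using D(2) by (auto simp: col_adj_def)
    qed
    then have "tab2 R" using R IH(1) D(3) by (simp add: tab2_Cons)
    moreover have "filter (\<lambda>x. x \<noteq> e) (rev C) = rev C" using False by (auto simp: filter_id_conv)
    ultimately show ?thesis using R IH by (auto simp: reading_simps)
  qed
qed (simp add: reading_simps)

text \<open>In both cases the new reading word is Knuth equivalent to the old one with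
  \<open>e\<close> erased: a largest entry simply disappears, and a smallest entry heads the first
  column, where the slide amounts to Knuth moves.\<close>

lemma jdt_remove_step:
  assumes T: "tab2 T" "distinct (reading T)" "e \<in> set (reading T)"
    and ext: "(\<forall>x\<in>set (reading T). x \<le> e) \<or> (\<forall>x\<in>set (reading T). e \<le> x)"
  shows "tab2 (jdt_remove e T) \<and> distinct (reading (jdt_remove e T)) \<and>
    set (reading (jdt_remove e T)) = set (reading T) - {e} \<and>
    (\<forall>a b. e \<notin> {a..b} \<longrightarrow> lis (reading (jdt_remove e T)) {a..b} = lis (reading T) {a..b})"
proof -
  let ?R = "jdt_remove e T"
  have "tab2 ?R \<and> knuth (filter (\<lambda>x. x \<noteq> e) (reading T)) (reading ?R)"
    using ext
  proof
    assume "\<forall>x\<in>set (reading T). x \<le> e"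
    from jdt_remove_max[OF T this refl] show ?thesis by (simp add: knuth_refl)
  next
    assume min: "\<forall>x\<in>set (reading T). e \<le> x"
    obtain C D where CD: "T = C # D" using T(3) by (cases T) (auto simp: reading_simps)
    have sc: "short_col C" using T(1) CD by (simp add: tab2_Cons)
    have "e \<notin> bots T"
    proof
      assume "e \<in> bots T"
      then obtain c where "c \<in> tops T" "c < e" using tops_below_bots[OF T(1)] by blast
      then show False using min set_reading_tops_bots[OF T(1)] by (metis UnI1 not_less)
    qed
    then have "e \<in> tops T" using T(3) set_reading_tops_bots[OF T(1)] by auto
    moreover have "hd C \<in> set (reading T)" using sc CD by (auto simp: reading_simps short_col_def)
    ultimately have e: "e = hd C" using min tab2_tops_gt[of C D e] T(1) CD by (fastforce simp: tops_simps)
    then obtain t where C: "C = e # t" using sc by (auto simp: short_col_def)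
    then have "list_pos C e = 0" "e \<in> set C" by (simp_all add: list_pos_Cons)
    then have R: "?R = jdt_slide 0 (C # D)" using CD by simp
    have rC: "rev C = rev (tl C) @ [e]" using C by simp
    have "filter (\<lambda>x. x \<noteq> e) (reading T) = rev (tl C) @ reading D"
      using T(2) filter_id_conv[of "\<lambda>x. x \<noteq> e" "rev (tl C)"] filter_id_conv[of "\<lambda>x. x \<noteq> e" "reading D"]
      unfolding CD reading_simps rC by auto
    then show ?thesis using jdt_slide_upper[of C D ?R] T CD R by simp
  qed
  then have R: "tab2 ?R" "knuth (filter (\<lambda>x. x \<noteq> e) (reading T)) (reading ?R)" by auto
  have d: "distinct (filter (\<lambda>x. x \<noteq> e) (reading T))" using T(2) by simp
  have "lis (reading ?R) {a..b} = lis (reading T) {a..b}" if "e \<notin> {a..b}" for a b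
    using knuth_lis[OF R(2) d, of a b] lis_filter[of "{a..b}" "\<lambda>x. x \<noteq> e" "reading T"] that by auto
  moreover have "set (reading ?R) = set (reading T) - {e}" using knuth_set[OF R(2)] by auto
  ultimately show ?thesis using R d knuth_distinct[OF R(2)] by blast
qed

lemma jdt_remove_low:
  assumes T: "tab2 T" "distinct (reading T)" "set (reading T) = {1..n}" and "k \<le> n"
  shows "let R = fold jdt_remove [1..<Suc k] T in
    tab2 R \<and> distinct (reading R) \<and> set (reading R) = {Suc k..n} \<and>
    (\<forall>b. lis (reading R) {Suc k..b} = lis (reading T) {Suc k..b})"
proof -
  have "let R = fold jdt_remove [1..<Suc k] T in
    tab2 R \<and> distinct (reading R) \<and> set (reading R) = {Suc k..n} \<and>
    (\<forall>a b. k < a \<longrightarrow> lis (reading R) {a..b} = lis (reading T) {a..b})"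
    using \<open>k \<le> n\<close>
  proof (induction k)
    case (Suc k)
    let ?R = "fold jdt_remove [1..<Suc k] T"
    have IH: "tab2 ?R" "distinct (reading ?R)" "set (reading ?R) = {Suc k..n}"
      "\<And>a b. k < a \<Longrightarrow> lis (reading ?R) {a..b} = lis (reading T) {a..b}"
      using Suc unfolding Let_def by auto
    have eq: "fold jdt_remove [1..<Suc (Suc k)] T = jdt_remove (Suc k) ?R" by simp
    have "{Suc k..n} - {Suc k} = {Suc (Suc k)..n}" by auto
    then show ?case
      unfolding eq Let_def using jdt_remove_step[OF IH(1,2), of "Suc k"] IH(3,4) Suc.prems by simp
  qed (use T in \<open>simp add: Let_def\<close>)
  then show ?thesis unfolding Let_def by auto
qed

lemma jdt_remove_high:
  assumes T: "tab2 T" "distinct (reading T)" "set (reading T) = {i..n}" and "i \<le> j" "j \<le> n"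
  shows "let R = fold jdt_remove (rev [Suc j..<Suc n]) T in
    tab2 R \<and> distinct (reading R) \<and> set (reading R) = {i..j} \<and>
    lis (reading R) {i..j} = lis (reading T) {i..j}"
proof -
  have "let R = fold jdt_remove (rev [Suc (n - k)..<Suc n]) T in
    tab2 R \<and> distinct (reading R) \<and> set (reading R) = {i..n - k} \<and>
    (\<forall>a b. b \<le> n - k \<longrightarrow> lis (reading R) {a..b} = lis (reading T) {a..b})" if "k \<le> n - i" for k
    using that
  proof (induction k)
    case (Suc k)
    let ?R = "fold jdt_remove (rev [Suc (n - k)..<Suc n]) T"
    have IH: "tab2 ?R" "distinct (reading ?R)" "set (reading ?R) = {i..n - k}"
      "\<And>a b. b \<le> n - k \<Longrightarrow> lis (reading ?R) {a..b} = lis (reading T) {a..b}"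
      using Suc unfolding Let_def by auto
    have nk: "n - k = Suc (n - Suc k)" "n - k < Suc n" using Suc.prems by auto
    have "[Suc (n - Suc k)..<Suc n] = (n - k) # [Suc (n - k)..<Suc n]"
      using nk by (metis upt_conv_Cons)
    then have eq: "fold jdt_remove (rev [Suc (n - Suc k)..<Suc n]) T = jdt_remove (n - k) ?R"
      by (simp del: upt_Suc)
    have "{i..n - k} - {n - k} = {i..n - Suc k}" using nk by auto
    then show ?case
      unfolding eq Let_def using jdt_remove_step[OF IH(1,2), of "n - k"] IH(3,4) Suc.prems nk by auto
  qed (use T in \<open>simp add: Let_def\<close>)
  from this[of "n - j"] show ?thesis using assms(4,5) unfolding Let_def by auto
qed

lemma lis_cong_inter: "A \<inter> set w = B \<inter> set w \<Longrightarrow> lis w A = lis w B"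
proof -
  assume *: "A \<inter> set w = B \<inter> set w"
  have "{K. chain w K \<and> K \<subseteq> A} = {K. chain w K \<and> K \<subseteq> B}" using * unfolding chain_def by blast
  then show ?thesis by (simp add: lis_def)
qed

lemma card_tops: "tab2 T \<Longrightarrow> card (tops T) = length T"
proof (induction T)
  case (Cons C D)
  have "hd C \<notin> tops D" using tab2_tops_gt[OF Cons.prems] by blast
  moreover have "finite (tops D)" by (simp add: tops_def)
  ultimately show ?case using Cons by (simp add: tops_simps tab2_Cons)
qed (simp add: tops_simps)

text \<open>For a fixed size, a two-row shape depends only on its number of columns. By
  \<open>lis_reading\<close> this is the longest increasing subsequence of the projection, and no
  removal has changed it on \<open>{i..j}\<close>.\<close>

lemma tab_proj_two_row:
  assumes T: "tab2 T" "distinct (reading T)" "set (reading T) = {1..n}" and ij: "1 \<le> i" "i \<le> j" "j \<le> n"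
  defines "R \<equiv> tab_proj i j T"
  shows "tab2 R" "length (concat R) = Suc j - i" "length R = lis (reading T) {i..j}"
proof -
  have m: "sorted_list_of_set (entries T) = [1..<Suc n]"
  proof -
    have "entries T = {1..<Suc n}" using T(3) unfolding entries_def set_reading by auto
    then show ?thesis by (metis sorted_list_of_set_range)
  qed
  have tk: "take (i - 1) [1..<Suc n] = [1..<Suc (i - 1)]" using ij by (subst take_upt) auto
  have dr: "drop j [1..<Suc n] = [Suc j..<Suc n]" by (simp add: drop_upt del: upt_Suc)
  define Q where "Q = fold jdt_remove [1..<Suc (i - 1)] T"
  have R: "R = fold jdt_remove (rev [Suc j..<Suc n]) Q"
    unfolding R_def tab_proj_def m Let_def tk dr Q_def by (simp del: upt_Suc)
  have Q: "tab2 Q" "distinct (reading Q)" "set (reading Q) = {i..n}"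
    "lis (reading Q) {i..j} = lis (reading T) {i..j}"
    using jdt_remove_low[OF T, of "i - 1"] ij unfolding Let_def Q_def[symmetric] by auto
  have RR: "tab2 R" "distinct (reading R)" "set (reading R) = {i..j}"
    "lis (reading R) {i..j} = lis (reading T) {i..j}"
    using jdt_remove_high[OF Q(1-3) ij(2,3)] Q(4) unfolding Let_def R[symmetric] by auto
  show "tab2 R" by fact
  have "length (concat R) = length (reading R)" using mset_reading by (metis size_mset)
  also have "\<dots> = card {i..j}" using RR(2,3) distinct_card by metis
  finally show "length (concat R) = Suc j - i" by simp
  have "tops R \<inter> {..j} = tops R" using set_reading_tops_bots[OF RR(1)] RR(3) by auto
  then have "length R = lis (reading R) {..j}" using lis_reading[OF RR(1,2), of j] card_tops[OF RR(1)] by simp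
  also have "\<dots> = lis (reading R) {i..j}" using RR(3) by (intro lis_cong_inter) auto
  finally show "length R = lis (reading T) {i..j}" using RR(4) by simp
qed

section \<open>Dominance of two-row shapes\<close>

lemma tab2_concat_length: "tab2 T \<Longrightarrow> length T \<le> length (concat T) \<and> length (concat T) \<le> 2 * length T \<and>
   (bots T = {} \<longrightarrow> length (concat T) = length T)"
  by (induction T) (auto simp: tab2_Cons short_col_def bots_simps)

text \<open>\<open>length (concat T) - length T\<close> counts the columns of length 2, and these
  come first.\<close>

lemma tab2_shape_sum:
  "tab2 T \<Longrightarrow> i \<le> length T \<Longrightarrow> sum_list (take i (shape T)) = i + min i (length (concat T) - length T)"
proof (induction T arbitrary: i)
  case (Cons C D)
  have D: "tab2 D" "short_col C" using Cons.prems by (auto simp: tab2_Cons)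
  show ?case
  proof (cases i)
    case (Suc i')
    have IH: "sum_list (take i' (shape D)) = i' + min i' (length (concat D) - length D)"
      using Cons Suc D by simp
    from D(2) show ?thesis
    proof (cases rule: short_col_cases)
      case (1 c)
      then have "length (concat D) = length D" using tab2_bots_empty Cons.prems tab2_concat_length[OF D(1)] by blast
      then show ?thesis using IH Suc 1 by (simp add: shape_def del: length_concat)
    next
      case (2 c d)
      then show ?thesis using IH Suc tab2_concat_length[OF D(1)] by (simp add: shape_def Suc_diff_le del: length_concat)
    qed
  qed simp
qed (simp add: shape_def)

lemma dominance_two_row:
  assumes "tab2 P" "tab2 Q" "length (concat P) = length (concat Q)"
  shows "dominance_le (shape P) (shape Q) \<longleftrightarrow> length Q \<le> length P"
proof -
  define N where "N = length (concat P)"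
  have b: "length P \<le> N" "N \<le> 2 * length P" "length Q \<le> N" "N \<le> 2 * length Q"
    using tab2_concat_length[OF assms(1)] tab2_concat_length[OF assms(2)] assms(3) unfolding N_def by simp_all
  have len: "length (shape P) = length P" "length (shape Q) = length Q" by (simp_all add: shape_def)
  have sum: "sum_list (take i (shape P)) = i + min i (N - length P)"
    "sum_list (take i (shape Q)) = i + min i (N - length Q)" if "i \<le> min (length P) (length Q)" for i
    using tab2_shape_sum[of P i] tab2_shape_sum[of Q i] assms that unfolding N_def by auto
  show ?thesis
  proof
    assume d: "dominance_le (shape P) (shape Q)"
    show "length Q \<le> length P"
    proof (rule ccontr)
      assume "\<not> length Q \<le> length P"
      \<comment> \<open>The first column of length 1 in \<open>Q\<close>. With fewer columns for the
        same size, \<open>P\<close> still has a column of length 2 there.\<close>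
      then have i: "Suc (N - length Q) \<in> {1..min (length P) (length Q)}" using b by auto
      then have "sum_list (take (Suc (N - length Q)) (shape P)) \<le> sum_list (take (Suc (N - length Q)) (shape Q))"
        using d unfolding dominance_le_def len by blast
      then show False using sum[of "Suc (N - length Q)"] i \<open>\<not> length Q \<le> length P\<close> b by auto
    qed
  next
    assume "length Q \<le> length P"
    then show "dominance_le (shape P) (shape Q)"
      unfolding dominance_le_def len by (auto simp: sum)
  qed
qed

lemma chain_le_iff_lis:
  assumes P: "tab2 P" "distinct (reading P)" "set (reading P) = {1..n}"
    and Q: "tab2 Q" "distinct (reading Q)" "set (reading Q) = {1..n}"
  shows "chain_le n P Q \<longleftrightarrow>
    (\<forall>i j. 1 \<le> i \<and> i < j \<and> j \<le> n \<longrightarrow> lis (reading Q) {i..j} \<le> lis (reading P) {i..j})"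
proof -
  have "dominance_le (shape (tab_proj i j P)) (shape (tab_proj i j Q)) \<longleftrightarrow>
    lis (reading Q) {i..j} \<le> lis (reading P) {i..j}" if "1 \<le> i \<and> i < j \<and> j \<le> n" for i j
    using tab_proj_two_row[OF P, of i j] tab_proj_two_row[OF Q, of i j] that
      dominance_two_row[of "tab_proj i j P" "tab_proj i j Q"] by auto
  then show ?thesis unfolding chain_le_def by blast
qed

section \<open>The words of two-row tableaux\<close>

text \<open>\<open>canon U D w\<close>: the word \<open>w\<close> of the two-row tableau with rows \<open>U\<close> and \<open>D\<close>.\<close>

inductive canon :: "nat set \<Rightarrow> nat set \<Rightarrow> nat list \<Rightarrow> bool" where
  canon_empty: "canon {} {} []"
| canon_upper: "canon U D w \<Longrightarrow> (\<And>x. x \<in> U \<union> D \<Longrightarrow> x < z) \<Longrightarrow> canon (insert z U) D (w @ [z])"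
| canon_lower: "canon U D w \<Longrightarrow> (\<And>x. x \<in> U \<Longrightarrow> x < b) \<Longrightarrow> (\<And>x. x \<in> D \<Longrightarrow> x < z) \<Longrightarrow> b < z \<Longrightarrow> b \<notin> D \<Longrightarrow>
    canon (insert b U) (insert z D) (w @ [z, b])"

lemma canon_set: "canon U D w \<Longrightarrow> set w = U \<union> D \<and> distinct w \<and> U \<inter> D = {}"
  by (induction rule: canon.induct) (auto; fastforce)+

lemma canon_finite: "canon U D w \<Longrightarrow> finite U \<and> finite D"
  by (induction rule: canon.induct) auto

text \<open>Each rule contributes one block, \<open>[z]\<close> or \<open>[z, b]\<close>, ending in
  its upper entry; this is the form that \<open>lis_blocks\<close> requires.\<close>

lemma canon_blocks:
  "canon U D w \<Longrightarrow> \<exists>bs. concat bs = w \<and> (\<forall>b\<in>set bs. short_col (rev b)) \<and> last ` set bs = U"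
proof (induction rule: canon.induct)
  case (canon_upper U D w z)
  then obtain bs where "concat bs = w" "\<forall>b\<in>set bs. short_col (rev b)" "last ` set bs = U" by blast
  then show ?case by (intro exI[of _ "bs @ [[z]]"]) (auto simp: short_col_def)
next
  case (canon_lower U D w b z)
  then obtain bs where "concat bs = w" "\<forall>b\<in>set bs. short_col (rev b)" "last ` set bs = U" by blast
  then show ?case using canon_lower.hyps(4) by (intro exI[of _ "bs @ [[z, b]]"]) (auto simp: short_col_def)
qed (auto intro: exI[of _ "[]"])

lemma card_Int_insert_new:
  "finite A \<Longrightarrow> x \<notin> A \<Longrightarrow> card (insert x A \<inter> B) = card (A \<inter> B) + (if x \<in> B then 1 else 0)"
  by (auto simp: Int_insert_left)

text \<open>In the last case of the induction, \<open>y\<close> can be replaced by the maximal entry \<open>z\<close> as soon as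
  \<open>b \<le> y\<close>.\<close>

lemma canon_inversion:
  "canon U D w \<Longrightarrow> i \<in> U \<union> D \<Longrightarrow> j \<in> U \<union> D \<Longrightarrow> i < j \<Longrightarrow>
    before w j i \<longleftrightarrow> i \<in> U \<and> j \<in> D \<and> (\<exists>y\<ge>j. card (U \<inter> {i..y}) \<le> card (D \<inter> {j..y}))"
proof (induction arbitrary: i j rule: canon.induct)
  case (canon_upper U D w z)
  have fin: "finite U" "finite D" and z: "z \<notin> U" "z \<notin> D" and sw: "set w = U \<union> D"
    using canon_finite[OF canon_upper.hyps(1)] canon_upper.hyps(2) canon_set[OF canon_upper.hyps(1)] by auto
  have iz: "i \<noteq> z" using canon_upper.hyps(2)[of j] canon_upper.prems by auto
  show ?case
  proof (cases "j = z")
    case True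
    then show ?thesis using iz z sw canon_upper.prems by (auto simp: before_append before_Cons before_Nil)
  next
    case False
    then have ij: "i \<in> U \<union> D" "j \<in> U \<union> D" "j < z" using canon_upper iz by auto
    have "(\<exists>y\<ge>j. card (U \<inter> {i..y}) \<le> card (D \<inter> {j..y})) \<longleftrightarrow>
      (\<exists>y\<ge>j. card (insert z U \<inter> {i..y}) \<le> card (D \<inter> {j..y}))" (is "?L \<longleftrightarrow> ?R")
    proof
      assume ?L
      then obtain y where y: "y \<ge> j" "card (U \<inter> {i..y}) \<le> card (D \<inter> {j..y})" by blast
      show ?R
      proof (cases "y < z")
        case True
        then show ?thesis using y fin z by (intro exI[of _ y]) (auto simp: card_Int_insert_new)
      next
        case False
        \<comment> \<open>The new \<open>z\<close> counts as an upper entry. Stopping at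
          \<open>z - 1\<close> avoids it and loses nothing, as \<open>z\<close> exceeds all other
          entries.\<close>
        have "D \<inter> {j..y} = D \<inter> {j..z - 1}" using canon_upper.hyps(2) False by fastforce
        moreover have "insert z U \<inter> {i..z - 1} = U \<inter> {i..y}" using canon_upper.hyps(2) False ij
          by fastforce
        ultimately show ?thesis using y ij by (intro exI[of _ "z - 1"]) auto
      qed
    next
      assume ?R
      then obtain y where y: "y \<ge> j" "card (insert z U \<inter> {i..y}) \<le> card (D \<inter> {j..y})" by blast
      then show ?L using fin z by (intro exI[of _ y]) (auto simp: card_Int_insert_new split: if_splits)
    qed
    then show ?thesis
      using canon_upper.IH[OF ij(1,2) canon_upper.prems(3)] ij sw iz False
      by (simp add: before_append)
  qed
next
  case (canon_lower U D w b z)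
  have fin: "finite U" "finite D" and sw: "set w = U \<union> D" and disj: "U \<inter> D = {}"
    using canon_finite[OF canon_lower.hyps(1)] canon_set[OF canon_lower.hyps(1)] by auto
  have ne: "b \<notin> U" "z \<notin> D" "b \<notin> D" "z \<notin> U" "b < z"
    using canon_lower.hyps by (auto dest: less_trans)
  have U: "card (insert b U \<inter> B) = card (U \<inter> B) + (if b \<in> B then 1 else 0)" for B
    using card_Int_insert_new fin ne by metis
  have D: "card (insert z D \<inter> B) = card (D \<inter> B) + (if z \<in> B then 1 else 0)" for B
    using card_Int_insert_new fin ne by metis
  have iz: "i \<noteq> z"
    using canon_lower.prems canon_lower.hyps(2-4) by (auto dest: less_trans)
  show ?case
  proof (cases "i = b")
    case ib: True
    have jU: "j \<notin> insert b U" using canon_lower.prems(3) canon_lower.hyps(2)[of j] ib by auto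
    then have j: "j \<in> insert z D" using canon_lower.prems by auto
    have "before (w @ [z, b]) j i"
      using ib jU j ne sw by (auto simp: before_append before_Cons)
    \<comment> \<open>The witness is \<open>y = j\<close>: since \<open>b\<close> is the largest
      upper entry, both counts are 1.\<close>
    moreover have "card (insert b U \<inter> {i..j}) \<le> card (insert z D \<inter> {j..j})"
    proof -
      have "insert b U \<inter> {i..j} = {b}" using canon_lower.hyps(2) canon_lower.prems(3) ib by fastforce
      moreover have "insert z D \<inter> {j..j} = {j}" using j by auto
      ultimately show ?thesis by simp
    qed
    ultimately show ?thesis using ib j by auto
  next
    case ib: False
    have i: "i \<in> U \<union> D" using canon_lower.prems ib iz by auto
    show ?thesis
    proof (cases "j = z")
      case True
      have "\<not> before (w @ [z, b]) j i" using True i ne sw by (auto simp: before_append)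
      \<comment> \<open>From \<open>z\<close> on there is one lower entry, but \<open>i\<close> and
        \<open>b\<close> are two upper ones.\<close>
      moreover have "\<not> card (insert b U \<inter> {i..y}) \<le> card (insert z D \<inter> {j..y})" if "i \<in> U" "y \<ge> j" for y
      proof -
        have "D \<inter> {j..y} = {}" using canon_lower.hyps(3) True by fastforce
        moreover have "i \<in> U \<inter> {i..y}" using that canon_lower.prems by auto
        then have "card (U \<inter> {i..y}) \<noteq> 0" using fin by auto
        ultimately show ?thesis using that True ne canon_lower.hyps(2)[OF that(1)] by (simp add: U D)
      qed
      ultimately show ?thesis using i ib disj by auto
    next
      case jz: False
      show ?thesis
      proof (cases "j = b")
        case True
        then show ?thesis using i ne sw by (auto simp: before_append before_Cons)
      next
        case False
        then have j: "j \<in> U \<union> D" using canon_lower.prems jz by auto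
        have jz': "j < z" using j canon_lower.hyps(2-4) by (auto dest: less_trans)
        have "(\<exists>y\<ge>j. card (U \<inter> {i..y}) \<le> card (D \<inter> {j..y})) \<longleftrightarrow>
          (\<exists>y\<ge>j. card (insert b U \<inter> {i..y}) \<le> card (insert z D \<inter> {j..y}))" (is "?L \<longleftrightarrow> ?R") if iU: "i \<in> U"
        proof -
          have ib': "i < b" using canon_lower.hyps(2) iU by blast
          have Uz: "U \<inter> {i..y} = U \<inter> {i..z}" if "b \<le> y" for y
            using canon_lower.hyps(2,4) that by fastforce
          have Dz: "card (D \<inter> {j..y}) \<le> card (D \<inter> {j..z})" for y
            using fin by (intro card_mono) (auto dest!: canon_lower.hyps(3))
          show ?thesis
          proof
            assume ?L
            then obtain y where y: "y \<ge> j" "card (U \<inter> {i..y}) \<le> card (D \<inter> {j..y})" by blast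
            show ?R
            proof (cases "b \<le> y")
              case True
              have "card (U \<inter> {i..z}) \<le> card (D \<inter> {j..z})" using Uz[OF True] Dz[of y] y by simp
              then show ?thesis using ne ib' jz' by (intro exI[of _ z]) (simp add: U D)
            next
              case False
              then show ?thesis using y by (intro exI[of _ y]) (simp add: U D)
            qed
          next
            assume ?R
            then obtain y where y: "y \<ge> j" "card (insert b U \<inter> {i..y}) \<le> card (insert z D \<inter> {j..y})" by blast
            show ?L
            proof (cases "b \<le> y")
              case True
              then have "card (U \<inter> {i..y}) \<le> card (D \<inter> {j..y})"
                using y(2)[unfolded U D] ib' by (simp split: if_splits)
              then show ?thesis using y by blast
            next
              case False
              then show ?thesis using y(1) y(2)[unfolded U D] ne by (intro exI[of _ y]) (simp split: if_splits)
            qed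
          qed
        qed
        then show ?thesis
          using canon_lower.IH[OF i j canon_lower.prems(3)] i j sw ib False jz iz disj ne
          by (auto simp: before_append)
      qed
    qed
  qed
qed simp

lemma canon_chain_upper: "canon U D w \<Longrightarrow> chain w U"
  unfolding chain_def
proof (intro conjI ballI impI)
  fix p q assume *: "canon U D w" "p \<in> U" "q \<in> U" "p < q"
  have "q \<notin> D" "set w = U \<union> D" using canon_set[OF *(1)] * by auto
  then show "before w p q" using canon_inversion[OF *(1), of p q] before_total[of p w q] * by auto
qed (auto dest: canon_set)

text \<open>An inversion has its larger letter in the lower row and its smaller one in the upper
  row, so the middle letter of a pattern 321 would lie in both.\<close>

lemma canon_avoids321: "canon U D w \<Longrightarrow> avoids321 w"
  unfolding avoids321_def
proof (intro notI, elim bexE conjE)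
  fix p q s assume *: "canon U D w" "p \<in> set w" "q \<in> set w" "s \<in> set w" "p < q" "q < s" "before w s q" "before w q p"
  then show False
    using canon_inversion[OF *(1), of p q] canon_inversion[OF *(1), of q s] canon_set[OF *(1)] by auto
qed

lemma canon_lis: "canon U D w \<Longrightarrow> lis w {..x} = card (U \<inter> {..x})"
  using canon_blocks[of U D w] lis_blocks[of _ x] canon_set[of U D w] canon_chain_upper[of U D w] by blast

section \<open>Ballot sequences and the deletion algorithm\<close>

definition ballot :: "nat set \<Rightarrow> nat set \<Rightarrow> bool" where
  "ballot U D \<longleftrightarrow> finite U \<and> finite D \<and> U \<inter> D = {} \<and> (\<forall>x. card (D \<inter> {..x}) \<le> card (U \<inter> {..x}))"

lemma ballot_remove_upper:
  assumes "ballot (insert z U) D" "z \<notin> U" "\<And>x. x \<in> U \<union> D \<Longrightarrow> x < z"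
  shows "ballot U D"
  unfolding ballot_def
proof (intro conjI allI)
  have b: "finite U" "finite D" "insert z U \<inter> D = {}"
    "\<And>x. card (D \<inter> {..x}) \<le> card (insert z U \<inter> {..x})" using assms(1) by (auto simp: ballot_def)
  show "finite U" "finite D" "U \<inter> D = {}" using b by auto
  fix x
  show "card (D \<inter> {..x}) \<le> card (U \<inter> {..x})"
  proof (cases "x < z")
    case True
    then show ?thesis using b(4)[of x] assms(2) b(1) by (simp add: card_Int_insert_new)
  next
    case False
    show ?thesis
    proof (cases "D = {}")
      case False
      then have z: "0 < z" using assms(3) by fastforce
      \<comment> \<open>For \<open>x \<ge> z\<close> the comparison is made just before the removed
        up step, where all remaining entries have been counted.\<close>
      have "D \<inter> {..x} = D \<inter> {..z - 1}" "U \<inter> {..x} = insert z U \<inter> {..z - 1}"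
        using \<open>\<not> x < z\<close> assms(3) z by fastforce+
      then show ?thesis using b(4)[of "z - 1"] by simp
    qed simp
  qed
qed

text \<open>From \<open>b\<close> on, the count of upper entries is final, so it is enough to
  compare at \<open>z\<close>, where each row has lost exactly one entry.\<close>

lemma ballot_remove_lower:
  assumes "ballot (insert b U) (insert z D)" "b \<notin> U" "z \<notin> D" "\<And>x. x \<in> U \<Longrightarrow> x < b" "\<And>x. x \<in> D \<Longrightarrow> x < z" "b < z"
  shows "ballot U D"
  unfolding ballot_def
proof (intro conjI allI)
  have bal: "finite U" "finite D" "insert b U \<inter> insert z D = {}"
    "\<And>x. card (insert z D \<inter> {..x}) \<le> card (insert b U \<inter> {..x})" using assms(1) by (auto simp: ballot_def)
  show "finite U" "finite D" "U \<inter> D = {}" using bal by auto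
  fix x
  have U: "card (insert b U \<inter> B) = card (U \<inter> B) + (if b \<in> B then 1 else 0)" for B
    using card_Int_insert_new bal assms by metis
  have D: "card (insert z D \<inter> B) = card (D \<inter> B) + (if z \<in> B then 1 else 0)" for B
    using card_Int_insert_new bal assms by metis
  show "card (D \<inter> {..x}) \<le> card (U \<inter> {..x})"
  proof (cases "x < b")
    case True
    then show ?thesis using bal(4)[of x] assms(6) by (simp add: U D)
  next
    case False
    have "card (D \<inter> {..x}) \<le> card (D \<inter> {..z})"
      using bal(2) by (intro card_mono) (auto dest!: assms(5))
    also have "\<dots> \<le> card (U \<inter> {..z})" using bal(4)[of z] assms(6) unfolding U D by simp
    also have "U \<inter> {..z} = U \<inter> {..x}" using assms(4,6) False by fastforce
    finally show ?thesis .
  qed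
qed

lemma ballot_nonempty: "ballot U D \<Longrightarrow> D \<noteq> {} \<Longrightarrow> U \<noteq> {}"
proof
  assume *: "ballot U D" "D \<noteq> {}" "U = {}"
  then obtain x where "x \<in> D" by blast
  then have "card (D \<inter> {..x}) \<noteq> 0" using * by (auto simp: ballot_def)
  then show False using * by (auto simp: ballot_def dest: spec[of _ x])
qed

lemma set_list_update_pos:
  "distinct xs \<Longrightarrow> b \<in> set xs \<Longrightarrow> set (xs[list_pos xs b := z]) = insert z (set xs - {b})"
  by (simp add: list_pos_less_length nth_list_pos set_update_distinct)

lemma distinct_list_update_pos:
  "distinct xs \<Longrightarrow> b \<in> set xs \<Longrightarrow> z \<notin> set xs \<Longrightarrow> distinct (xs[list_pos xs b := z])"
  by (simp add: distinct_list_update)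

text \<open>The deletion algorithm runs on the transposed tableau; only the sets \<open>U\<close> and \<open>D\<close> of the entries of the
  first column and of the rest matter.\<close>

definition col_state :: "nat set \<Rightarrow> nat set \<Rightarrow> tableau \<Rightarrow> bool" where
  "col_state U D P \<longleftrightarrow> (U = {} \<and> D = {} \<and> P = []) \<or>
     (U \<noteq> {} \<and> P \<noteq> [] \<and> set (hd P) = U \<and> distinct (hd P) \<and> set (concat (tl P)) = D)"

lemma concat_filter_nonempty: "concat (filter (\<lambda>C. C \<noteq> []) P) = concat P"
  by (induction P) auto

lemma set_concat_removeAll: "set (concat (map (removeAll a) P)) = set (concat P) - {a}"
  by auto

lemma col_state_upper:
  assumes "col_state (insert z U) D P" "z \<notin> U" "z \<notin> D" "D \<noteq> {} \<Longrightarrow> U \<noteq> {}"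
  shows "deletion_out P z = z \<and> col_state U D (deletion P z)"
proof -
  have P: "P \<noteq> []" "set (hd P) = insert z U" "distinct (hd P)" "set (concat (tl P)) = D"
    using assms(1) by (auto simp: col_state_def)
  have d: "deletion P z = filter (\<lambda>C. C \<noteq> []) (removeAll z (hd P) # tl P)"
    using P by (simp add: deletion_def)
  have sr: "set (removeAll z (hd P)) = U" using P assms by auto
  have "col_state U D (deletion P z)"
  proof (cases "U = {}")
    case True
    then have "D = {}" using assms by auto
    then have "\<forall>C\<in>set (tl P). C = []" using P(4) by auto
    moreover have "removeAll z (hd P) = []" using sr True by (metis set_empty)
    ultimately show ?thesis using True \<open>D = {}\<close> unfolding d col_state_def by (auto simp: filter_empty_conv)
  next
    case False
    then have "removeAll z (hd P) \<noteq> []" using sr by (metis empty_set)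
    then have "deletion P z = removeAll z (hd P) # filter (\<lambda>C. C \<noteq> []) (tl P)" unfolding d by simp
    then show ?thesis using False sr P distinct_removeAll unfolding col_state_def
      by (simp add: concat_filter_nonempty del: set_concat)
  qed
  then show ?thesis using P by (simp add: deletion_out_def)
qed

text \<open>The deleted lower entry \<open>z\<close> takes the place of \<open>b\<close> in the
  first column. It is still the maximum and will be output next; this is how the block
  \<open>z b\<close> arises.\<close>

lemma col_state_lower:
  assumes "col_state (insert b U) (insert z D) P" "b \<notin> U" "z \<notin> D" "z \<notin> U"
    "\<And>x. x \<in> U \<Longrightarrow> x < b" "b < z"
  shows "deletion_out P z = b \<and> col_state (insert z U) D (deletion P z)"
proof -
  have P: "P \<noteq> []" "set (hd P) = insert b U" "distinct (hd P)" "set (concat (tl P)) = insert z D"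
    using assms(1) by (auto simp: col_state_def)
  have zn: "z \<notin> set (hd P)" using P assms by auto
  have "{x \<in> set (hd P). x < z} = insert b U" using P assms by (auto dest: less_trans)
  moreover have "finite (insert b U)" using P(2) by (metis List.finite_set)
  then have "Max (insert b U) = b"
    using assms(5) by (intro Max_eqI) (auto intro: less_imp_le)
  ultimately have out: "deletion_out P z = b" using zn by (simp add: deletion_out_def)
  have ne: "(hd P)[list_pos (hd P) b := z] \<noteq> []" using P by auto
  have d: "deletion P z = (hd P)[list_pos (hd P) b := z] # filter (\<lambda>C. C \<noteq> []) (map (removeAll z) (tl P))"
    using zn ne by (simp add: deletion_def out)
  have s: "set ((hd P)[list_pos (hd P) b := z]) = insert z U"
    using set_list_update_pos[of "hd P" b z] P assms(2) by auto
  have "distinct ((hd P)[list_pos (hd P) b := z])" using distinct_list_update_pos[of "hd P" b z] P zn by auto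
  moreover have "set (concat (map (removeAll z) (tl P))) = D"
    using P(4) assms(3) unfolding set_concat_removeAll by auto
  ultimately show ?thesis using out s unfolding d col_state_def
    by (simp add: concat_filter_nonempty del: set_concat)
qed

lemma entries_col_state: "col_state U D P \<Longrightarrow> entries P = U \<union> D"
  unfolding col_state_def entries_def by (cases P) auto

text \<open>The letters output first come last after the reversal, so removing the maximal entry
  inverts the last rule of \<open>canon\<close>. An upper maximum takes one deletion, a lower one
  takes two.\<close>

lemma canon_two_column_word:
  "ballot U D \<Longrightarrow> col_state U D P \<Longrightarrow> m = card (U \<union> D) \<Longrightarrow> canon U D (rev (two_column_word m P))"
proof (induction m arbitrary: U D P rule: less_induct)
  case (less m)
  have fin: "finite U" "finite D" and disj: "U \<inter> D = {}" using less.prems by (auto simp: ballot_def)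
  show ?case
  proof (cases "U \<union> D = {}")
    case True
    then show ?thesis using less.prems canon_empty by simp
  next
    case ne: False
    define z where "z = Max (U \<union> D)"
    have z: "z \<in> U \<union> D" "\<And>x. x \<in> U \<union> D \<Longrightarrow> x \<le> z" using Max_in[of "U \<union> D"] ne fin unfolding z_def by auto
    have "m \<noteq> 0" using ne less.prems(3) fin by (metis card_0_eq finite_UnI)
    then obtain m' where m: "m = Suc m'" by (cases m) auto
    have word: "two_column_word m P = deletion_out P z # two_column_word m' (deletion P z)"
      using entries_col_state[OF less.prems(2)] by (simp add: m Let_def z_def)
    show ?thesis
    proof (cases "z \<in> U")
      case True
      define U' where "U' = U - {z}"
      have U: "U = insert z U'" "z \<notin> U'" "z \<notin> D" using True disj by (auto simp: U'_def)
      have lt: "x < z" if "x \<in> U' \<union> D" for x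
        using z(2)[of x] that U by (metis UnCI UnE insertCI order_le_less)
      have b: "ballot U' D" using ballot_remove_upper[of z U' D] less.prems(1) U lt by auto
      have cs: "deletion_out P z = z" "col_state U' D (deletion P z)"
        using col_state_upper[of z U' D P] less.prems(2) U ballot_nonempty[OF b] by auto
      have "m' = card (U' \<union> D)" using less.prems(3) m U fin by simp
      then have "canon U' D (rev (two_column_word m' (deletion P z)))" using less.IH[of m' U' D] m b cs by simp
      then show ?thesis using canon_upper[of U' D _ z] lt U word cs by simp
    next
      case False
      then have zD: "z \<in> D" using z by auto
      have "U \<noteq> {}" using ballot_nonempty less.prems(1) zD by blast
      define b where "b = Max U"
      have b: "b \<in> U" "\<And>x. x \<in> U \<Longrightarrow> x \<le> b" using \<open>U \<noteq> {}\<close> Max_in[of U] fin unfolding b_def by auto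
      define U' where "U' = U - {b}"
      define D' where "D' = D - {z}"
      have U: "U = insert b U'" "b \<notin> U'" and D: "D = insert z D'" "z \<notin> D'"
        using b zD by (auto simp: U'_def D'_def)
      have ltU: "x < b" if "x \<in> U'" for x using b(2)[of x] that U by (metis insertCI order_le_less)
      have ltD: "x < z" if "x \<in> D'" for x using z(2)[of x] that D by (metis UnCI insertCI order_le_less)
      have bz: "b < z" using z(2)[of b] b(1) False by (metis UnCI order_le_less)
      have bD: "b \<notin> D" using b disj by auto
      have bal: "ballot U' D'" using ballot_remove_lower[of b U' z D'] less.prems(1) U D ltU ltD bz by auto
      have cs1: "deletion_out P z = b" "col_state (insert z U') D' (deletion P z)"
        using col_state_lower[of b U' z D' P] less.prems(2) U D ltU bz False by auto
      have e: "entries (deletion P z) = insert z U' \<union> D'" using entries_col_state[OF cs1(2)] .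
      have fin': "finite (insert z U' \<union> D')" using fin by (simp add: U'_def D'_def)
      have max: "Max (entries (deletion P z)) = z"
        unfolding e using ltU ltD bz fin' by (intro Max_eqI) (auto intro: less_imp_le dest: less_trans)
      have "z \<notin> U'" using False U by auto
      have cs2: "deletion_out (deletion P z) z = z" "col_state U' D' (deletion (deletion P z) z)"
        using col_state_upper[of z U' D' "deletion P z"] cs1(2) D \<open>z \<notin> U'\<close> ballot_nonempty[OF bal] by auto
      have "card (U \<union> D) = Suc (Suc (card (U' \<union> D')))"
        using fin' bD bz \<open>z \<notin> U'\<close> U D by (simp add: insert_commute)
      then obtain m'' where m': "m' = Suc m''" "m'' = card (U' \<union> D')" using less.prems(3) m by simp
      have "two_column_word m P = b # z # two_column_word m'' (deletion (deletion P z) z)"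
        using word cs1 cs2 max by (simp add: m' Let_def)
      moreover have "canon U' D' (rev (two_column_word m'' (deletion (deletion P z) z)))"
        using less.IH[of m'' U' D'] m m' bal cs2 by simp
      ultimately show ?thesis using canon_lower[of U' D' _ b z] ltU ltD bz bD U D by simp
    qed
  qed
qed

lemma finite_tops_bots: "finite (tops T)" "finite (bots T)"
  by (induction T) (auto simp: tops_simps bots_simps)

lemma ballot_tab2: "tab2 T \<Longrightarrow> distinct (reading T) \<Longrightarrow> ballot (tops T) (bots T)"
proof (induction T)
  case (Cons C D)
  have D: "tab2 D" "short_col C" "distinct (reading D)" using Cons.prems by (auto simp: tab2_Cons reading_simps)
  have IH: "tops D \<inter> bots D = {}" "\<And>x. card (bots D \<inter> {..x}) \<le> card (tops D \<inter> {..x})"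
    using Cons.IH[OF D(1,3)] by (auto simp: ballot_def)
  have s: "set C \<inter> (tops D \<union> bots D) = {}"
    using Cons.prems(2) set_reading_tops_bots[OF D(1)] by (auto simp: reading_simps)
  from D(2) show ?case
  proof (cases rule: short_col_cases)
    case (1 c)
    have b: "bots D = {}" using Cons.prems(1) tab2_bots_empty 1 by blast
    then show ?thesis using 1 s finite_tops_bots[of D] by (auto simp: ballot_def tops_simps bots_simps)
  next
    case (2 c d)
    have "card (insert d (bots D) \<inter> {..x}) \<le> card (insert c (tops D) \<inter> {..x})" for x
      using IH(2)[of x] 2 s finite_tops_bots[of D]
      card_Int_insert_new[of "tops D" c "{..x}"] card_Int_insert_new[of "bots D" d "{..x}"] by auto
    then show ?thesis using 2 s IH finite_tops_bots[of D] by (auto simp: ballot_def tops_simps bots_simps)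
  qed
qed (simp add: ballot_def tops_simps bots_simps)

lemma tab2_eqI: "tab2 T \<Longrightarrow> tab2 T' \<Longrightarrow> tops T = tops T' \<Longrightarrow> bots T = bots T' \<Longrightarrow> T = T'"
proof (induction T arbitrary: T')
  case Nil
  then show ?case by (cases T') (auto simp: tops_simps)
next
  case (Cons C D)
  obtain C' D' where T': "T' = C' # D'" using Cons.prems(3) by (cases T') (auto simp: tops_simps)
  have C: "short_col C" "tab2 D" and C': "short_col C'" "tab2 D'"
    using Cons.prems T' by (auto simp: tab2_Cons)
  note gt = tab2_tops_gt[OF Cons.prems(1)] tab2_tops_gt[OF Cons.prems(2)[unfolded T']]
  note bgt = tab2_bots_gt[OF Cons.prems(1)] tab2_bots_gt[OF Cons.prems(2)[unfolded T']]
  have hd: "hd C = hd C'" using Cons.prems(3) gt unfolding T' tops_simps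
    by (metis insertCI insertE less_asym)
  have tD: "tops D = tops D'" using Cons.prems(3) gt hd unfolding T' tops_simps
    by (metis insert_ident less_irrefl)
  show ?case
  proof (cases "length C = 2")
    case True
    then have "bots T' \<noteq> {}" using Cons.prems(4) by (auto simp: bots_simps)
    then have l': "length C' = 2" using bgt(2) T' by (auto simp: bots_simps split: if_splits)
    have ins: "insert (C ! 1) (bots D) = insert (C' ! 1) (bots D')"
      using Cons.prems(4) True l' by (simp add: T' bots_simps)
    then have 1: "C ! 1 = C' ! 1" using bgt by (metis insertCI insertE less_asym)
    have "bots D = bots D'" using ins 1 bgt by (metis insert_ident less_irrefl)
    then have "D = D'" using Cons.IH C C' tD by blast
    moreover have "C = C'" using True l' 1 hd C(1) C'(1) by (auto simp: short_col_def)
    ultimately show ?thesis using T' by simp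
  next
    case False
    then have bD: "bots D = {}" using bgt(1) by blast
    then have b: "bots T' = {}" using Cons.prems(4) False by (simp add: bots_simps)
    then have l': "length C' \<noteq> 2" "bots D' = {}" by (auto simp: T' bots_simps split: if_splits)
    have "D = D'" using Cons.IH C C' tD bD l' by simp
    moreover have "C = C'" using False l' hd C(1) C'(1) by (auto simp: short_col_def)
    ultimately show ?thesis using T' by simp
  qed
qed

lemma col_state_transpose:
  assumes "tab2 T"
  shows "col_state (tops T) (bots T) (List.transpose T)"
proof (cases "T = []")
  case True
  then show ?thesis by (simp add: col_state_def tops_simps bots_simps)
next
  case False
  have short: "\<And>C. C \<in> set T \<Longrightarrow> short_col C" using assms by (auto simp: tab2_def)
  have len: "length C \<le> 2" "0 < length C" if "C \<in> set T" for C using short[OF that] by (auto simp: short_col_def)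
  have mx: "length (List.transpose T) \<le> 2"
  proof -
    have "foldr (\<lambda>xs. max (length xs)) T 0 \<le> 2" using len by (induction T) auto
    then show ?thesis by (simp add: length_transpose)
  qed
  have row: "List.transpose T ! i = map (\<lambda>C. C ! i) (filter (\<lambda>C. i < length C) T)" if "i < length (List.transpose T)" for i
    using nth_transpose[OF that] .
  have pos: "i < length (List.transpose T)" if "C \<in> set T" "i < length C" for i C
  proof -
    have "length C \<le> foldr (\<lambda>xs. max (length xs)) T 0" using that(1) by (induction T) auto
    then show ?thesis using that(2) by (simp add: length_transpose)
  qed
  have l0: "0 < length (List.transpose T)" using False pos[of "hd T" 0] len[of "hd T"] by simp
  have f: "filter (\<lambda>C. 0 < length C) T = T" using len by (auto simp: filter_id_conv)
  have hd0: "hd (List.transpose T) = map (\<lambda>C. C ! 0) T"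
    using row[OF l0] f l0 by (simp add: hd_conv_nth)
  have top: "set (map (\<lambda>C. C ! 0) T) = tops T" using short short_col_hd by (force simp: tops_def)
  have tl: "set (concat (tl (List.transpose T))) = bots T"
  proof (cases "length (List.transpose T) = 2")
    case True
    then obtain r0 r1 where r: "List.transpose T = [r0, r1]"
      by (auto simp: numeral_2_eq_2 length_Suc_conv)
    then have "r1 = map (\<lambda>C. C ! 1) (filter (\<lambda>C. 1 < length C) T)" using row[of 1] by simp
    then show ?thesis using r len by (fastforce simp: bots_def)
  next
    case nl: False
    then obtain r0 where r: "List.transpose T = [r0]"
      using mx l0 by (cases "List.transpose T") (auto simp: le_Suc_eq)
    have "bots T = {}" using pos[of _ 1] r by (force simp: bots_def)
    then show ?thesis using r by simp
  qed
  have "distinct (map (\<lambda>C. C ! 0) T)"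
  proof (rule card_distinct)
    show "card (set (map (\<lambda>C. C ! 0) T)) = length (map (\<lambda>C. C ! 0) T)"
      using top card_tops[OF assms] by simp
  qed
  then show ?thesis using l0 hd0 top tl False by (auto simp: col_state_def tops_def)
qed

lemma two_row_word_canon:
  assumes "T \<in> two_row_tableaux n"
  shows "canon (tops T) (bots T) (two_row_word n T)"
proof -
  note T = tab2_two_row[OF assms]
  have "card (tops T \<union> bots T) = n" using T(3) set_reading_tops_bots[OF T(1)] by simp
  then show ?thesis
    using canon_two_column_word[OF ballot_tab2[OF T(1,2)] col_state_transpose[OF T(1)]]
    unfolding two_row_word_def by simp
qed

lemma cellD:
  assumes "w \<in> cell n T"
  shows "distinct w" "set w = {1..n}" "insertion_tableau w = T"
  using assms unfolding cell_def permutations_of_set_def by auto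

text \<open>By Knuth invariance the insertion tableau and \<open>T\<close> have equally many top
  entries in every \<open>{..x}\<close>. The jumps of this count are the top entries, and the rows
  determine the tableau.\<close>

lemma two_row_word_in_cell:
  assumes "T \<in> two_row_tableaux n"
  shows "two_row_word n T \<in> cell n T"
proof -
  let ?w = "two_row_word n T"
  note T = tab2_two_row[OF assms] and can = two_row_word_canon[OF assms]
  have w: "set ?w = {1..n}" "distinct ?w" using canon_set[OF can] T(3) set_reading_tops_bots[OF T(1)] by auto
  let ?T = "insertion_tableau ?w"
  have T': "tab2 ?T" "knuth ?w (reading ?T)"
    using insertion_tableau_knuth[OF w(2)] insertion_tableau_short[OF w(2)] canon_avoids321[OF can] by auto
  have d: "distinct (reading ?T)" "set (reading ?T) = {1..n}"
    using knuth_distinct[OF T'(2)] knuth_set[OF T'(2)] w by auto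
  have c: "card (tops ?T \<inter> {..x}) = card (tops T \<inter> {..x})" for x
    using knuth_lis[OF T'(2) w(2), of 0 x] lis_reading[OF T'(1) d(1), of x] canon_lis[OF can, of x]
    by (simp add: atLeast0AtMost)
  have tt: "tops ?T = tops T"
  proof -
    have step: "x \<in> A \<longleftrightarrow> card (A \<inter> {..x}) = Suc (card (A \<inter> {..x - 1}))" if "0 < x" "finite A" for A :: "nat set" and x
    proof -
      have "{..x} = insert x {..x - 1}" using that by auto
      then show ?thesis using that by (cases "x \<in> A") auto
    qed
    have sub: "tops ?T \<subseteq> {1..n}" "tops T \<subseteq> {1..n}"
      using set_reading_tops_bots[OF T'(1)] set_reading_tops_bots[OF T(1)] d(2) T(3) by auto
    show ?thesis
    proof (rule Set.set_eqI)
      fix x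
      show "x \<in> tops ?T \<longleftrightarrow> x \<in> tops T"
      proof (cases "x = 0")
        case True
        then show ?thesis using sub by auto
      next
        case False
        then show ?thesis
          using step[of x "tops ?T"] step[of x "tops T"] c finite_tops_bots by simp
      qed
    qed
  qed
  have "bots ?T = {1..n} - tops ?T" "bots T = {1..n} - tops T"
    using set_reading_tops_bots[OF T'(1)] set_reading_tops_bots[OF T(1)] d(2) T(3)
      ballot_tab2[OF T'(1) d(1)] ballot_tab2[OF T(1,2)] by (auto simp: ballot_def)
  then have "?T = T" using tab2_eqI[OF T'(1) T(1) tt] tt by simp
  then show ?thesis using w by (simp add: cell_def permutations_of_set_def)
qed

lemma cell_tab2:
  assumes "w \<in> cell n T" "tab2 T"
  shows "knuth w (reading T)" "avoids321 w"
proof -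
  note w = cellD[OF assms(1)]
  have "\<forall>C\<in>set T. length C \<le> 2" using assms(2) by (auto simp: tab2_def short_col_def)
  then show k: "knuth w (reading T)" using insertion_tableau_knuth[OF w(1)] w(3) by simp
  have "distinct (reading T)" using knuth_distinct[OF k] w(1) by simp
  then show "avoids321 w" using knuth_avoids321[OF k w(1)] avoids321_reading[OF assms(2)] by simp
qed

lemma cell_lis:
  assumes "w \<in> cell n T" "tab2 T"
  shows "lis w {a..b} = lis (reading T) {a..b}"
  using knuth_lis[OF cell_tab2(1)[OF assms]] cellD[OF assms(1)] by blast


section \<open>Dyck intervals and the noncrossing matching\<close>

text \<open>The rows restricted to an interval form a Dyck word; the condition is stated for the suffixes.\<close>

definition dyck :: "nat set \<Rightarrow> nat set \<Rightarrow> nat \<Rightarrow> nat \<Rightarrow> bool" where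
  "dyck U D a b \<longleftrightarrow> card (U \<inter> {a..b}) = card (D \<inter> {a..b}) \<and>
     (\<forall>x\<ge>a. card (U \<inter> {x..b}) \<le> card (D \<inter> {x..b}))"

text \<open>Selects the element of rank \<open>m\<close> from the right end, in order to pair upper
  and lower entries of equal rank.\<close>

lemma card_suffix_ex:
  fixes U :: "nat set"
  assumes "1 \<le> m" "m \<le> card (U \<inter> {a..b})"
  shows "\<exists>u\<in>U \<inter> {a..b}. card (U \<inter> {u..b}) = m"
  using assms
proof (induction "Suc b - a" arbitrary: a)
  case 0
  then have "{a..b} = {}" by auto
  then show ?case using 0 by simp
next
  case (Suc k)
  show ?case
  proof (cases "m = card (U \<inter> {a..b}) \<and> a \<in> U")
    case True
    then show ?thesis using Suc by auto
  next
    case False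
    have k: "k = Suc b - Suc a" using Suc.hyps(2) by simp
    have "{a..b} = insert a {Suc a..b}" using Suc.hyps(2) by auto
    then have "card (U \<inter> {a..b}) = (if a \<in> U then 1 else 0) + card (U \<inter> {Suc a..b})" by auto
    then have "m \<le> card (U \<inter> {Suc a..b})" using False Suc.prems by (auto split: if_splits)
    then obtain u where "u \<in> U \<inter> {Suc a..b}" "card (U \<inter> {u..b}) = m"
      using Suc.hyps(1)[of "Suc a"] k Suc.prems(1) by blast
    then show ?thesis by auto
  qed
qed

lemma card_suffix_less:
  fixes U :: "nat set"
  assumes "x \<in> U" "x < y" "x \<le> b"
  shows "card (U \<inter> {y..b}) < card (U \<inter> {x..b})"
proof (rule psubset_card_mono)
  have "x \<in> U \<inter> {x..b}" "x \<notin> U \<inter> {y..b}" using assms by auto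
  moreover have "U \<inter> {y..b} \<subseteq> U \<inter> {x..b}" using assms by auto
  ultimately show "U \<inter> {y..b} \<subset> U \<inter> {x..b}" by blast
qed simp

text \<open>The \<open>k\<close>-th element of \<open>U\<close> and the \<open>k\<close>-th element of \<open>D\<close> in a Dyck interval form an inversion.\<close>

lemma lis_dyck_le:
  assumes can: "canon U D w" and dy: "dyck U D a b"
  shows "lis w {a..b} \<le> card (U \<inter> {a..b})"
proof (rule lis_le)
  fix K assume K: "chain w K" "K \<subseteq> {a..b}"
  have disj: "U \<inter> D = {}" and sw: "set w = U \<union> D" using canon_set[OF can] by auto
  have "\<exists>u. u \<in> U \<inter> {a..b} \<and> card (U \<inter> {u..b}) = card (D \<inter> {d..b})" if "d \<in> D \<inter> {a..b}" for d
  proof -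
    have "D \<inter> {d..b} \<noteq> {}" using that by auto
    then have "1 \<le> card (D \<inter> {d..b})" by (simp add: Suc_le_eq card_gt_0_iff)
    moreover have "card (D \<inter> {d..b}) \<le> card (D \<inter> {a..b})" using that by (intro card_mono) auto
    ultimately show ?thesis using card_suffix_ex[of "card (D \<inter> {d..b})" U a b] dy unfolding dyck_def by auto
  qed
  then obtain f where f: "\<And>d. d \<in> D \<inter> {a..b} \<Longrightarrow> f d \<in> U \<inter> {a..b} \<and> card (U \<inter> {f d..b}) = card (D \<inter> {d..b})"
    by metis
  \<comment> \<open>Otherwise the suffix that starts right after \<open>d\<close> would violate the
    Dyck condition.\<close>
  have less: "f d < d" if d: "d \<in> D \<inter> {a..b}" for d
  proof (rule ccontr)
    assume "\<not> f d < d"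
    then have "d < f d" using f[OF d] d disj by (metis IntD1 disjoint_iff linorder_neqE_nat)
    then have "card (U \<inter> {f d..b}) \<le> card (U \<inter> {Suc d..b})" by (intro card_mono) auto
    also have "\<dots> \<le> card (D \<inter> {Suc d..b})" using dy d unfolding dyck_def by auto
    also have "\<dots> < card (D \<inter> {d..b})" using d by (intro card_suffix_less) auto
    finally show False using f[OF d] by simp
  qed
  \<comment> \<open>The inversion criterion holds with equality at \<open>y = b\<close>.\<close>
  have inv: "before w d (f d)" if d: "d \<in> D \<inter> {a..b}" for d
    using canon_inversion[OF can, of "f d" d] f[OF d] less[OF d] d by auto
  \<comment> \<open>Replacing the lower entries of the chain by their partners is injective, because
    a chain contains no inverted pair.\<close>
  define g where "g k = (if k \<in> U then k else f k)" for k
  have KD: "k \<in> D \<inter> {a..b}" if "k \<in> K" "k \<notin> U" for k using K that sw unfolding chain_def by auto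
  have cross: "f d \<notin> K" if "d \<in> K" "d \<in> D \<inter> {a..b}" for d
  proof
    assume "f d \<in> K"
    then have "before w (f d) d" using K(1) that(1) less[OF that(2)] unfolding chain_def by blast
    then show False using inv[OF that(2)] before_asym by metis
  qed
  have "inj_on g K"
  proof (rule inj_onI)
    fix p q assume pq: "p \<in> K" "q \<in> K" "g p = g q"
    consider "p \<in> U" "q \<in> U" | "p \<in> U" "q \<notin> U" | "p \<notin> U" "q \<in> U" | "p \<notin> U" "q \<notin> U" by blast
    then show "p = q"
    proof cases
      case 2
      then show ?thesis using pq cross[of q] KD[of q] by (auto simp: g_def)
    next
      case 3
      then show ?thesis using pq cross[of p] KD[of p] by (auto simp: g_def)
    next
      case 4
      then have "card (D \<inter> {p..b}) = card (D \<inter> {q..b})" using pq f KD by (metis g_def)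
      then show ?thesis
        using card_suffix_less[of p D q b] card_suffix_less[of q D p b] KD pq 4
        by (metis Int_iff atLeastAtMost_iff less_irrefl linorder_neqE_nat)
    qed (use pq in \<open>simp add: g_def\<close>)
  qed
  moreover have "g ` K \<subseteq> U \<inter> {a..b}"
  proof
    fix y assume "y \<in> g ` K"
    then obtain k where "k \<in> K" "y = g k" by blast
    then show "y \<in> U \<inter> {a..b}" using K(2) f KD[of k] by (cases "k \<in> U") (auto simp: g_def)
  qed
  ultimately show "card K \<le> card (U \<inter> {a..b})" by (intro card_inj_on_le) auto
qed

text \<open>An inversion needs an upper entry followed in value by a lower one; lower entries before
  the cut \<open>c\<close> and upper entries from \<open>c\<close> on contain no such pair.\<close>

lemma lis_canon_ge:
  assumes can: "canon U D w"
  shows "card (D \<inter> {a..<c}) + card (U \<inter> {c..b}) \<le> lis w ({a..<c} \<union> {c..b})"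
proof -
  have disj: "U \<inter> D = {}" and sw: "set w = U \<union> D" using canon_set[OF can] by auto
  let ?K = "(D \<inter> {a..<c}) \<union> (U \<inter> {c..b})"
  have "chain w ?K"
    unfolding chain_def
  proof (intro conjI ballI impI)
    fix p q assume pq: "p \<in> ?K" "q \<in> ?K" "p < q"
    then have "\<not> (p \<in> U \<and> q \<in> D)" using disj by auto
    then show "before w p q"
      using canon_inversion[OF can, of p q] before_total[of p w q] pq sw by auto
  qed (use sw in auto)
  then have "card ?K \<le> lis w ({a..<c} \<union> {c..b})" by (rule card_le_lis) auto
  moreover have "card ?K = card (D \<inter> {a..<c}) + card (U \<inter> {c..b})"
    by (rule card_Un_disjoint) auto
  ultimately show ?thesis by simp
qed

text \<open>The extreme cuts \<open>a\<close> and \<open>Suc b\<close> bound each row by half of the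
  interval, so each row fills exactly half. The cut at \<open>c\<close> then gives the prefix
  condition of a Dyck path.\<close>

lemma lis_le_imp_dyck:
  assumes can: "canon U D w" and cov: "{a..b} \<subseteq> U \<union> D"
    and half: "2 * lis w {a..b} \<le> card {a..b}" and c: "a \<le> c" "c \<le> Suc b"
  shows "card (D \<inter> {a..<c}) \<le> card (U \<inter> {a..<c})" "2 * card (D \<inter> {a..b}) = card {a..b}"
proof -
  have disj: "U \<inter> D = {}" using canon_set[OF can] by auto
  have ge: "card (D \<inter> {a..<c}) + card (U \<inter> {c..b}) \<le> lis w {a..b}" if "a \<le> c" "c \<le> Suc b" for c
  proof -
    have "{a..<c} \<union> {c..b} = {a..b}" using that by auto
    then show ?thesis using lis_canon_ge[OF can, of a c b] by simp
  qed
  have sum: "card (U \<inter> A) + card (D \<inter> A) = card A" if "A \<subseteq> {a..b}" "finite A" for A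
  proof -
    have "card (U \<inter> A \<union> D \<inter> A) = card (U \<inter> A) + card (D \<inter> A)"
      using disj that by (intro card_Un_disjoint) auto
    moreover have "U \<inter> A \<union> D \<inter> A = A" using that cov by auto
    ultimately show ?thesis by simp
  qed
  have "{a..<Suc b} = {a..b}" by auto
  then have D: "card (D \<inter> {a..b}) \<le> lis w {a..b}" using ge[of "Suc b"] c by simp
  have U: "card (U \<inter> {a..b}) \<le> lis w {a..b}" using ge[of a] c by simp
  show "2 * card (D \<inter> {a..b}) = card {a..b}" using sum[of "{a..b}"] D U half by simp
  have "card (U \<inter> {a..b}) = card (U \<inter> {a..<c}) + card (U \<inter> {c..b})"
  proof -
    have "U \<inter> {a..b} = (U \<inter> {a..<c}) \<union> (U \<inter> {c..b})" using c by auto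
    then show ?thesis by (simp add: card_Un_disjoint disjoint_iff)
  qed
  then show "card (D \<inter> {a..<c}) \<le> card (U \<inter> {a..<c})"
    using ge[OF c] sum[of "{a..b}"] D U half by simp
qed

lemma card_Int_interval_first: "finite A \<Longrightarrow> card (A \<inter> {x::nat..y}) = card (A \<inter> {Suc x..y}) + (if x \<in> A \<and> x \<le> y then 1 else 0)"
proof -
  assume fin: "finite A"
  show ?thesis
  proof (cases "x \<le> y")
    case True
    then have "A \<inter> {x..y} = (if x \<in> A then insert x (A \<inter> {Suc x..y}) else A \<inter> {Suc x..y})" by (auto simp: Suc_le_eq order_le_less)
    then show ?thesis using fin True by simp
  qed simp
qed

lemma card_Int_interval_last: "finite A \<Longrightarrow> x \<le> Suc y \<Longrightarrow>
   card (A \<inter> {x::nat..Suc y}) = card (A \<inter> {x..y}) + (if Suc y \<in> A then 1 else 0)"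
  by (simp add: atLeastAtMostSuc_conv)

text \<open>Going left from \<open>d\<close>, the partner is the first position where the up steps
  catch up with the down steps; the ballot condition ensures that this happens. Being the first one,
  it makes both the interval and its interior Dyck.\<close>

lemma match_of_lower:
  assumes "ballot U D" "0 \<notin> U \<union> D" "d \<in> D"
  shows "\<exists>u\<in>U. 1 \<le> u \<and> u < d \<and> dyck U D u d \<and> dyck U D (Suc u) (d - 1)"
proof -
  have fin: "finite U" "finite D" and disj: "U \<inter> D = {}"
    and bal: "\<And>x. card (D \<inter> {..x}) \<le> card (U \<inter> {..x})" using assms(1) by (auto simp: ballot_def)
  define P where "P x \<longleftrightarrow> x \<le> d \<and> card (D \<inter> {x..d}) \<le> card (U \<inter> {x..d})" for x
  define u where "u = Greatest P"
  have P0: "P 0" using bal[of d] by (simp add: P_def atLeast0AtMost)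
  have bd: "\<And>x. P x \<Longrightarrow> x \<le> d" by (simp add: P_def)
  have Pu: "P u" unfolding u_def by (rule GreatestI_nat[of P 0 d, OF P0 bd])
  have neg: "card (U \<inter> {x..d}) < card (D \<inter> {x..d})" if "u < x" "x \<le> d" for x
  proof (rule ccontr)
    assume "\<not> card (U \<inter> {x..d}) < card (D \<inter> {x..d})"
    then have "P x" using that by (simp add: P_def)
    then have "x \<le> u" unfolding u_def by (rule Greatest_le_nat[of P x d, OF _ bd])
    then show False using that by simp
  qed
  have "d \<notin> U" using assms disj by auto
  then have "\<not> P d" using assms by (auto simp: P_def)
  then have ud: "u < d" using Pu bd by (metis order_le_less)
  have n1: "card (U \<inter> {Suc u..d}) < card (D \<inter> {Suc u..d})" using neg ud by simp
  have uU: "u \<in> U" using Pu n1 card_Int_interval_first[OF fin(1), of u d] card_Int_interval_first[OF fin(2), of u d] ud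
    unfolding P_def by (auto split: if_splits)
  then have uD: "u \<notin> D" using disj by auto
  have eq: "card (U \<inter> {u..d}) = card (D \<inter> {u..d})"
    using Pu n1 card_Int_interval_first[OF fin(1), of u d] card_Int_interval_first[OF fin(2), of u d] uU uD ud unfolding P_def by auto
  obtain d' where d': "d = Suc d'" using ud by (cases d) auto
  have shift: "card (U \<inter> {x..d}) = card (U \<inter> {x..d'})" "card (D \<inter> {x..d}) = Suc (card (D \<inter> {x..d'}))" if "x \<le> d" for x
    using card_Int_interval_last[OF fin(1), of x d'] card_Int_interval_last[OF fin(2), of x d'] that \<open>d \<notin> U\<close> assms(3) d' by auto
  have dy: "dyck U D u d"
    unfolding dyck_def
  proof (intro conjI allI impI)
    show "card (U \<inter> {x..d}) \<le> card (D \<inter> {x..d})" if "u \<le> x" for x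
      using neg[of x] eq that by (cases "x = u"; cases "x \<le> d") auto
  qed (rule eq)
  have "dyck U D (Suc u) (d - 1)"
    unfolding dyck_def d' diff_Suc_1
  proof (intro conjI allI impI)
    show "card (U \<inter> {x..d'}) \<le> card (D \<inter> {x..d'})" if "Suc u \<le> x" for x
      using neg[of x] that shift[of x] by (cases "x \<le> d") (auto simp: d')
    show "card (U \<inter> {Suc u..d'}) = card (D \<inter> {Suc u..d'})"
      using eq shift[of "Suc u"] ud card_Int_interval_first[OF fin(1), of u d] card_Int_interval_first[OF fin(2), of u d] uU uD
      by auto
  qed
  moreover have "1 \<le> u" using uU assms(2) by (metis UnI1 less_one not_le)
  ultimately show ?thesis using dy uU ud by blast
qed

text \<open>The partner is the first return of the path to the level before \<open>i\<close>. Up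
  steps may stay unmatched, so some \<open>y\<close> where the path has returned is assumed.\<close>

lemma match_of_upper:
  assumes "finite U" "finite D" "U \<inter> D = {}" "i \<in> U" "card (U \<inter> {i..y}) \<le> card (D \<inter> {i..y})" "i \<le> y"
  shows "\<exists>d\<in>D. i < d \<and> dyck U D i d \<and> dyck U D (Suc i) (d - 1)"
proof -
  note fin = assms(1,2)
  define P where "P y \<longleftrightarrow> i \<le> y \<and> card (U \<inter> {i..y}) \<le> card (D \<inter> {i..y})" for y
  define d where "d = (LEAST y. P y)"
  have Pd: "P d" unfolding d_def by (rule LeastI[of P y]) (use assms in \<open>simp add: P_def\<close>)
  have pos: "card (D \<inter> {i..x}) < card (U \<inter> {i..x})" if "i \<le> x" "x < d" for x
    using not_less_Least[of x P] that by (auto simp: P_def d_def)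
  have "U \<inter> {i..i} = {i}" "D \<inter> {i..i} = {}" using assms(3,4) by auto
  then have "\<not> P i" by (simp add: P_def)
  then have id: "i < d" using Pd by (metis P_def order_le_less)
  then obtain d' where d': "d = Suc d'" by (cases d) auto
  have id': "i \<le> d'" using id d' by simp
  have p': "card (D \<inter> {i..d'}) < card (U \<inter> {i..d'})" using pos id' d' by simp
  have dD: "d \<in> D" using Pd p' card_Int_interval_last[OF fin(1), of i d'] card_Int_interval_last[OF fin(2), of i d'] id' d'
    unfolding P_def by (auto split: if_splits)
  then have dU: "d \<notin> U" using assms by auto
  have eq: "card (U \<inter> {i..d}) = card (D \<inter> {i..d})"
    using Pd p' card_Int_interval_last[OF fin(1), of i d'] card_Int_interval_last[OF fin(2), of i d'] id' d' dD dU
    unfolding P_def by auto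
  have split: "card (A \<inter> {i..z}) = card (A \<inter> {i..x}) + card (A \<inter> {Suc x..z})" if "i \<le> x" "x \<le> z" for A :: "nat set" and x z
  proof -
    have "A \<inter> {i..z} = (A \<inter> {i..x}) \<union> (A \<inter> {Suc x..z})" using that by auto
    then show ?thesis by (simp add: card_Un_disjoint disjoint_iff)
  qed
  have eq': "card (U \<inter> {i..d'}) = Suc (card (D \<inter> {i..d'}))"
    using eq card_Int_interval_last[OF fin(1), of i d'] card_Int_interval_last[OF fin(2), of i d'] id' d' dD dU by auto
  have "dyck U D i d"
    unfolding dyck_def
  proof (intro conjI allI impI)
    fix x assume "i \<le> x"
    show "card (U \<inter> {x..d}) \<le> card (D \<inter> {x..d})"
    proof (cases "x = i \<or> d < x")
      case False
      then obtain x' where x': "x = Suc x'" "i \<le> x'" "x' < d" using \<open>i \<le> x\<close> by (cases x) auto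
      then show ?thesis using pos[of x'] split[of x' d U] split[of x' d D] eq by auto
    qed (use eq in auto)
  qed (rule eq)
  moreover have "dyck U D (Suc i) (d - 1)"
    unfolding dyck_def d' diff_Suc_1
  proof (intro conjI allI impI)
    show "card (U \<inter> {Suc i..d'}) = card (D \<inter> {Suc i..d'})"
      using eq' card_Int_interval_first[OF fin(1), of i d'] card_Int_interval_first[OF fin(2), of i d'] assms(3,4) id' by auto
    fix x assume "Suc i \<le> x"
    then obtain x' where x': "x = Suc x'" "i \<le> x'" by (cases x) auto
    show "card (U \<inter> {x..d'}) \<le> card (D \<inter> {x..d'})"
    proof (cases "x' \<le> d'")
      case True
      then show ?thesis using pos[of x'] x' d' split[of x' d' U] split[of x' d' D] eq' by auto
    qed (use x' in auto)
  qed
  ultimately show ?thesis using dD id by blast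
qed

text \<open>Increasing subsequences cover at most half of the interval and of its interior, first
  for the word \<open>w\<close> and hence for \<open>w'\<close>. So both are balanced for
  \<open>w'\<close>; the outer one starts with an up step, and comparing the counts of lower entries
  leaves one for \<open>d\<close>.\<close>

lemma match_preserved:
  assumes S: "canon U' D' w'" "U' \<union> D' = {1..n}" and T: "canon U D w" "U \<union> D = {1..n}"
    and le: "\<And>a b. 1 \<le> a \<Longrightarrow> a \<le> b \<Longrightarrow> b \<le> n \<Longrightarrow> lis w' {a..b} \<le> lis w {a..b}"
    and ud: "1 \<le> u" "u < d" "d \<le> n" "dyck U D u d" "dyck U D (Suc u) (d - 1)"
  shows "u \<in> U' \<and> d \<in> D'"
proof -
  have fin: "finite U'" "finite D'" using canon_finite[OF S(1)] by auto
  have disj: "U' \<inter> D' = {}" "U \<inter> D = {}" using canon_set S(1) T(1) by auto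
  have half: "2 * lis w' {a..b} \<le> card {a..b}" if "1 \<le> a" "a \<le> b" "b \<le> n" "dyck U D a b" for a b
  proof -
    have "card (U \<inter> {a..b} \<union> D \<inter> {a..b}) = card (U \<inter> {a..b}) + card (D \<inter> {a..b})"
      using disj by (intro card_Un_disjoint) auto
    moreover have "{a..b} \<subseteq> U \<union> D" unfolding T(2) using that by simp
    then have "U \<inter> {a..b} \<union> D \<inter> {a..b} = {a..b}" by blast
    ultimately have "2 * card (U \<inter> {a..b}) = card {a..b}" using that(4) unfolding dyck_def by simp
    then show ?thesis using le[OF that(1-3)] lis_dyck_le[OF T(1) that(4)] by simp
  qed
  have h: "2 * lis w' {u..d} \<le> card {u..d}" using half[of u d] ud by simp
  have cov: "{u..d} \<subseteq> U' \<union> D'" unfolding S(2) using ud by simp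
  \<comment> \<open>The prefix condition for the prefix that consists of \<open>u\<close>
    alone.\<close>
  have "card (D' \<inter> {u..<Suc u}) \<le> card (U' \<inter> {u..<Suc u})"
    using lis_le_imp_dyck(1)[OF S(1) cov h, of "Suc u"] ud by simp
  moreover have "u \<in> U' \<union> D'" unfolding S(2) using ud by simp
  ultimately have uU: "u \<in> U'" by (cases "u \<in> U'") (simp_all add: atLeastLessThanSuc)
  then have uD: "u \<notin> D'" using disj by auto
  have c1: "2 * card (D' \<inter> {u..d}) = card {u..d}"
    using lis_le_imp_dyck(2)[OF S(1) cov h, of "Suc u"] ud by simp
  have c2: "2 * card (D' \<inter> {Suc u..d - 1}) = card {Suc u..d - 1}"
  proof (cases "Suc u \<le> d - 1")
    case True
    have "{Suc u..d - 1} \<subseteq> U' \<union> D'" unfolding S(2) using ud by auto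
    then show ?thesis
      using lis_le_imp_dyck(2)[OF S(1) _ half[of "Suc u" "d - 1"], of "Suc u"] ud True by simp
  qed simp
  have "d \<in> D'"
  proof (rule ccontr)
    assume "d \<notin> D'"
    have "x \<in> {u..d} \<longleftrightarrow> x \<in> {Suc u..d - 1}" if "x \<in> D'" for x
    proof -
      have "x \<noteq> u" "x \<noteq> d" using that uD \<open>d \<notin> D'\<close> by auto
      then show ?thesis by auto
    qed
    then have "D' \<inter> {u..d} = D' \<inter> {Suc u..d - 1}" by blast
    then show False using c1 c2 ud(2) by simp
  qed
  then show ?thesis using uU by simp
qed

text \<open>Unmatched up steps may become down steps, so the rows are only known to satisfy
  \<open>D \<subseteq> D'\<close> and \<open>U' \<subseteq> U\<close>. Both inclusions point in the
  direction that preserves the counting condition for inversions.\<close>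

lemma lis_le_imp_weak_le:
  assumes S: "canon U' D' w'" "U' \<union> D' = {1..n}"
    and T: "canon U D w" "U \<union> D = {1..n}" "ballot U D"
    and le: "\<And>a b. 1 \<le> a \<Longrightarrow> a \<le> b \<Longrightarrow> b \<le> n \<Longrightarrow> lis w' {a..b} \<le> lis w {a..b}"
  shows "weak_le n w w'"
  unfolding weak_le_def
proof (intro allI impI)
  have fin: "finite U" "finite D" "finite U'" "finite D'" using canon_finite S(1) T(1) by auto
  have disj: "U' \<inter> D' = {}" "U \<inter> D = {}" using canon_set S(1) T(1) by auto
  have DD: "D \<subseteq> D'"
  proof
    fix d assume d: "d \<in> D"
    have "0 \<notin> U \<union> D" using T(2) by auto
    then obtain u where u: "u \<in> U" "1 \<le> u" "u < d" "dyck U D u d" "dyck U D (Suc u) (d - 1)"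
      using match_of_lower[OF T(3) _ d] by auto
    have "d \<le> n" using d T(2) by auto
    then show "d \<in> D'" using match_preserved[OF S T(1,2) le] u by blast
  qed
  then have UU: "U' \<subseteq> U" using disj S(2) T(2) by blast
  fix i j assume ij: "1 \<le> i \<and> i < j \<and> j \<le> n" and pos: "list_pos w j < list_pos w i"
  have iT: "i \<in> U \<union> D" "j \<in> U \<union> D" "i \<in> U' \<union> D'" "j \<in> U' \<union> D'" using T(2) S(2) ij by auto
  obtain y where i: "i \<in> U" and j: "j \<in> D" and y: "y \<ge> j" "card (U \<inter> {i..y}) \<le> card (D \<inter> {j..y})"
    using canon_inversion[OF T(1) iT(1,2)] pos ij by (auto simp: before_def)
  \<comment> \<open>Starting at \<open>i\<close> instead of \<open>j\<close> only adds lower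
    entries, so the witness of the inversion also shows that \<open>i\<close> is matched.\<close>
  have "card (D \<inter> {j..y}) \<le> card (D \<inter> {i..y})" using ij by (intro card_mono) auto
  then obtain d where d: "d \<in> D" "i < d" "dyck U D i d" "dyck U D (Suc i) (d - 1)"
    using match_of_upper[OF fin(1,2) disj(2) i, of y] y ij by auto
  have "d \<le> n" using d T(2) by auto
  then have iU': "i \<in> U'" using match_preserved[OF S T(1,2) le, of i d] d ij by blast
  have "card (U' \<inter> {i..y}) \<le> card (U \<inter> {i..y})" using UU by (intro card_mono) auto
  also have "\<dots> \<le> card (D' \<inter> {j..y})" using y(2) DD by (meson Int_mono card_mono finite_Int finite_atLeastAtMost order.trans order_refl)
  finally show "list_pos w' j < list_pos w' i"
    using canon_inversion[OF S(1) iT(3,4)] ij y(1) iU' DD j unfolding before_def by blast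
qed

section \<open>Chain order, Duflo order and weak order\<close>

lemma weak_le_before:
  "weak_le n w y \<longleftrightarrow> (\<forall>i j. 1 \<le> i \<and> i < j \<and> j \<le> n \<longrightarrow> before w j i \<longrightarrow> before y j i)"
  by (simp add: weak_le_def before_def)

text \<open>Additional inversions destroy increasing subsequences and create none.\<close>

lemma weak_le_lis:
  assumes "weak_le n w y" "set w = {1..n}" "set y = {1..n}"
  shows "lis y A \<le> lis w A"
proof (rule lis_mono)
  fix K assume K: "chain y K" "K \<subseteq> A"
  have "before w p q" if "p \<in> K" "q \<in> K" "p < q" for p q
  proof -
    have pq: "p \<in> {1..n}" "q \<in> {1..n}" "before y p q" using K that assms unfolding chain_def by auto
    then have "\<not> before w q p" using assms(1) before_asym that(3) unfolding weak_le_before by fastforce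
    then show ?thesis using before_total[of p w q] pq that(3) assms(2) by auto
  qed
  then have "chain w K" using K assms unfolding chain_def by blast
  then show "\<exists>K'. chain w K' \<and> K' \<subseteq> A \<and> card K' = card K" using K by blast
qed

lemma weak_le_avoids321:
  assumes "weak_le n w y" "set w = {1..n}" "set y = {1..n}" "avoids321 y"
  shows "avoids321 w"
  using assms unfolding avoids321_def weak_le_before
  by (metis atLeastAtMost_iff)

lemma chain_le_iff_weak_le:
  assumes T: "T \<in> two_row_tableaux n" and S: "S \<in> two_row_tableaux n"
  shows "chain_le n T S \<longleftrightarrow> weak_le n (two_row_word n T) (two_row_word n S)"
proof -
  note t = tab2_two_row[OF T] and s = tab2_two_row[OF S]
  note tc = two_row_word_in_cell[OF T] and sc = two_row_word_in_cell[OF S]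
  have lis: "chain_le n T S \<longleftrightarrow> (\<forall>i j. 1 \<le> i \<and> i < j \<and> j \<le> n \<longrightarrow>
      lis (two_row_word n S) {i..j} \<le> lis (two_row_word n T) {i..j})"
    unfolding chain_le_iff_lis[OF t s] cell_lis[OF tc t(1)] cell_lis[OF sc s(1)] ..
  show ?thesis
  proof
    assume "chain_le n T S"
    then have le: "lis (two_row_word n S) {a..b} \<le> lis (two_row_word n T) {a..b}"
      if "1 \<le> a" "a \<le> b" "b \<le> n" for a b
    \<comment> \<open>The chain order speaks only of intervals with at least two values; for a
      single value both sides are 1.\<close>
    proof (cases "a < b")
      case False
      then have ab: "{a..b} = {a}" using that by auto
      have "card K \<le> 1" if "K \<subseteq> {a}" for K :: "nat set" using card_mono[OF _ that] by simp
      then have "lis (two_row_word n S) {a..b} \<le> 1" unfolding ab by (intro lis_le) auto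
      moreover have "chain (two_row_word n T) {a}" using cellD(2)[OF tc] that by (simp add: chain_def)
      then have "1 \<le> lis (two_row_word n T) {a..b}" using card_le_lis[of "two_row_word n T" "{a}" "{a}"] unfolding ab by simp
      ultimately show ?thesis by simp
    qed (use lis that in blast)
    show "weak_le n (two_row_word n T) (two_row_word n S)"
      using lis_le_imp_weak_le[OF two_row_word_canon[OF S] _ two_row_word_canon[OF T] _ _ le]
        ballot_tab2[OF t(1,2)] set_reading_tops_bots[OF t(1)] set_reading_tops_bots[OF s(1)] t(3) s(3) by simp
  next
    assume "weak_le n (two_row_word n T) (two_row_word n S)"
    then show "chain_le n T S"
      unfolding lis using weak_le_lis cellD(2)[OF tc] cellD(2)[OF sc] by blast
  qed
qed

lemma two_row_tableauxI: "P \<in> std_tableaux n \<Longrightarrow> tab2 P \<Longrightarrow> P \<in> two_row_tableaux n"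
  by (auto simp: two_row_tableaux_def tab2_def short_col_def)

text \<open>Here \<open>P\<close> is only known to be standard. Avoidance of 321 passes from
  \<open>y\<close> down to \<open>w\<close>, and so having two rows passes from \<open>Q\<close> to
  \<open>P\<close>.\<close>

lemma duflo_step_two_row:
  assumes "(P, Q) \<in> duflo_step n" "Q \<in> two_row_tableaux n"
  shows "P \<in> two_row_tableaux n \<and> chain_le n P Q"
proof -
  obtain w y where P: "P \<in> std_tableaux n" and w: "w \<in> cell n P" and y: "y \<in> cell n Q" and wy: "weak_le n w y"
    using assms(1) unfolding duflo_step_def by auto
  note q = tab2_two_row[OF assms(2)]
  have "avoids321 w"
    using weak_le_avoids321[OF wy] cellD[OF w] cellD[OF y] cell_tab2(2)[OF y q(1)] by blast
  then have "tab2 P"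
    using insertion_tableau_knuth[of w] insertion_tableau_short[of w] cellD[OF w] by auto
  then have P2: "P \<in> two_row_tableaux n" using P two_row_tableauxI by blast
  note p = tab2_two_row[OF P2]
  have "chain_le n P Q"
    unfolding chain_le_iff_lis[OF p q] cell_lis[OF w p(1), symmetric] cell_lis[OF y q(1), symmetric]
    using weak_le_lis[OF wy] cellD(2)[OF w] cellD(2)[OF y] by blast
  then show ?thesis using P2 by simp
qed

text \<open>The induction starts at \<open>S\<close>, the end of the sequence where two rows are
  given.\<close>

lemma duflo_le_imp_weak_le:
  assumes "duflo_le n T S" "S \<in> two_row_tableaux n"
  shows "T \<in> two_row_tableaux n \<and> weak_le n (two_row_word n T) (two_row_word n S)"
  using assms(1) unfolding duflo_le_def
proof (induction rule: converse_rtrancl_induct)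
  case base
  then show ?case using assms(2) by (simp add: weak_le_def)
next
  case (step P Q)
  then have "P \<in> two_row_tableaux n" "weak_le n (two_row_word n P) (two_row_word n Q)"
    using duflo_step_two_row[of P Q n] chain_le_iff_weak_le[of P n Q] by auto
  then show ?case using step unfolding weak_le_def by blast
qed

text \<open>A single Duflo step suffices, since each word lies in the cell of its tableau.\<close>

lemma weak_le_imp_duflo_le:
  assumes "T \<in> two_row_tableaux n" "S \<in> two_row_tableaux n"
    and "weak_le n (two_row_word n T) (two_row_word n S)"
  shows "duflo_le n T S"
proof -
  have "(T, S) \<in> duflo_step n"
    unfolding duflo_step_def using assms two_row_word_in_cell[of T n] two_row_word_in_cell[of S n]
    by (auto simp: two_row_tableaux_def)
  then show ?thesis unfolding duflo_le_def by blast
qed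

text \<open>Insertion recovers the tableau from its word; this transfers strictness between the
  orders.\<close>

lemma two_row_word_inj:
  assumes "T \<in> two_row_tableaux n" "S \<in> two_row_tableaux n"
  shows "two_row_word n T = two_row_word n S \<longleftrightarrow> T = S"
  using cellD(3)[OF two_row_word_in_cell[OF assms(1)]] cellD(3)[OF two_row_word_in_cell[OF assms(2)]] by metis

section \<open>Polynomial functions and Zariski closures\<close>

lemma index_mult_mat_sum:
  assumes "A \<in> carrier_mat r m" "B \<in> carrier_mat m c" "i < r" "j < c"
  shows "(A * B) $$ (i, j) = (\<Sum>k<m. A $$ (i, k) * B $$ (k, j))"
  using assms by (simp add: scalar_prod_def atLeast0LessThan)

text \<open>Agreement with a polynomial function is demanded on \<open>n\<close> by \<open>n\<close>
  matrices only, since the index formulas for products, powers and determinants are available only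
  there.\<close>

definition poly_on :: "nat \<Rightarrow> (complex mat \<Rightarrow> complex) \<Rightarrow> bool" where
  "poly_on n f \<longleftrightarrow> (\<exists>g\<in>poly_funs n. \<forall>X\<in>carrier_mat n n. f X = g X)"

lemma poly_onI: "f \<in> poly_funs n \<Longrightarrow> poly_on n f"
  unfolding poly_on_def by blast

lemma poly_on_const: "poly_on n (\<lambda>X. c)"
  by (intro poly_onI poly_funs.const)

lemma poly_on_coord: "i < n \<Longrightarrow> j < n \<Longrightarrow> poly_on n (\<lambda>X. X $$ (i, j))"
  by (intro poly_onI poly_funs.coord)

lemma poly_on_add: "poly_on n f \<Longrightarrow> poly_on n g \<Longrightarrow> poly_on n (\<lambda>X. f X + g X)"
  unfolding poly_on_def by (metis (no_types, lifting) poly_funs.add)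

lemma poly_on_mult: "poly_on n f \<Longrightarrow> poly_on n g \<Longrightarrow> poly_on n (\<lambda>X. f X * g X)"
  unfolding poly_on_def by (metis (no_types, lifting) poly_funs.mult)

lemma poly_on_sum: "(\<And>a. a \<in> A \<Longrightarrow> poly_on n (f a)) \<Longrightarrow> poly_on n (\<lambda>X. \<Sum>a\<in>A. f a X)"
proof (induction A rule: infinite_finite_induct)
  case (insert a A)
  then show ?case using poly_on_add[of n "f a" "\<lambda>X. \<Sum>a\<in>A. f a X"] by simp
qed (simp_all add: poly_on_const)

lemma poly_on_prod: "(\<And>a. a \<in> A \<Longrightarrow> poly_on n (f a)) \<Longrightarrow> poly_on n (\<lambda>X. \<Prod>a\<in>A. f a X)"
proof (induction A rule: infinite_finite_induct)
  case (insert a A)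
  then show ?case using poly_on_mult[of n "f a" "\<lambda>X. \<Prod>a\<in>A. f a X"] by simp
qed (simp_all add: poly_on_const)

lemma poly_on_cong: "poly_on n f \<Longrightarrow> (\<And>X. X \<in> carrier_mat n n \<Longrightarrow> f X = g X) \<Longrightarrow> poly_on n g"
  unfolding poly_on_def by auto

definition poly_mat :: "nat \<Rightarrow> nat \<Rightarrow> nat \<Rightarrow> (complex mat \<Rightarrow> complex mat) \<Rightarrow> bool" where
  "poly_mat n r c F \<longleftrightarrow> (\<forall>X\<in>carrier_mat n n. F X \<in> carrier_mat r c) \<and>
     (\<forall>i<r. \<forall>j<c. poly_on n (\<lambda>X. F X $$ (i, j)))"

lemma poly_mat_const: "A \<in> carrier_mat r c \<Longrightarrow> poly_mat n r c (\<lambda>X. A)"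
  by (simp add: poly_mat_def poly_on_const)

lemma poly_mat_id: "poly_mat n n n (\<lambda>X. X)"
  by (simp add: poly_mat_def poly_on_coord)

lemma poly_mat_mult:
  assumes F: "poly_mat n r m F" and G: "poly_mat n m c G"
  shows "poly_mat n r c (\<lambda>X. F X * G X)"
  unfolding poly_mat_def
proof (intro conjI ballI allI impI)
  show "F X * G X \<in> carrier_mat r c" if "X \<in> carrier_mat n n" for X
    using F G that unfolding poly_mat_def by (meson mult_carrier_mat)
  fix i j assume ij: "i < r" "j < c"
  have "poly_on n (\<lambda>X. \<Sum>k<m. F X $$ (i, k) * G X $$ (k, j))"
    using F G ij unfolding poly_mat_def by (intro poly_on_sum poly_on_mult) auto
  then show "poly_on n (\<lambda>X. (F X * G X) $$ (i, j))"
  proof (rule poly_on_cong)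
    fix X :: "complex mat" assume "X \<in> carrier_mat n n"
    then have "F X \<in> carrier_mat r m" "G X \<in> carrier_mat m c" using F G unfolding poly_mat_def by auto
    then show "(\<Sum>k<m. F X $$ (i, k) * G X $$ (k, j)) = (F X * G X) $$ (i, j)"
      using ij by (simp add: scalar_prod_def atLeast0LessThan)
  qed
qed

lemma poly_mat_pow: "poly_mat n r r F \<Longrightarrow> poly_mat n r r (\<lambda>X. F X ^\<^sub>m k)"
proof (induction k)
  case 0
  have c: "1\<^sub>m r \<in> carrier_mat r r" by simp
  show ?case
    unfolding poly_mat_def
  proof (intro conjI ballI allI impI)
    show "F X ^\<^sub>m 0 \<in> carrier_mat r r" if "X \<in> carrier_mat n n" for X
      using 0 that unfolding poly_mat_def by auto
    fix i j assume "i < r" "j < r"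
    show "poly_on n (\<lambda>X. (F X ^\<^sub>m 0) $$ (i, j))"
      by (rule poly_on_cong[OF poly_on_const[of n "1\<^sub>m r $$ (i, j)"]])
         (use 0 in \<open>auto simp: poly_mat_def\<close>)
  qed
next
  case (Suc k)
  then show ?case using poly_mat_mult[of n r r "\<lambda>X. F X ^\<^sub>m k" r F] by simp
qed

lemma poly_on_det:
  assumes "poly_mat n r r F"
  shows "poly_on n (\<lambda>X. det (F X))"
proof -
  have "poly_on n (\<lambda>X. \<Sum>p\<in>{p. p permutes {0..<r}}. signof p * (\<Prod>i\<in>{0..<r}. F X $$ (i, p i)))"
  proof (intro poly_on_sum poly_on_mult poly_on_prod poly_on_const)
    fix p i assume "p \<in> {p. p permutes {0..<r}}" "i \<in> {0..<r}"
    then have "p i < r" "i < r" using permutes_in_image[of p "{0..<r}" i] by auto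
    then show "poly_on n (\<lambda>X. F X $$ (i, p i))" using assms unfolding poly_mat_def by auto
  qed
  then show ?thesis
  proof (rule poly_on_cong)
    fix X :: "complex mat" assume "X \<in> carrier_mat n n"
    then have "F X \<in> carrier_mat r r" using assms unfolding poly_mat_def by auto
    then show "(\<Sum>p\<in>{p. p permutes {0..<r}}. signof p * (\<Prod>i\<in>{0..<r}. F X $$ (i, p i))) = det (F X)"
      by (simp add: det_def)
  qed
qed

lemma poly_on_compose:
  assumes "poly_on n f" and F: "poly_mat n n n F"
  shows "poly_on n (\<lambda>X. f (F X))"
proof -
  obtain g where g: "g \<in> poly_funs n" "\<And>X. X \<in> carrier_mat n n \<Longrightarrow> f X = g X"
    using assms(1) unfolding poly_on_def by blast
  have "poly_on n (\<lambda>X. g (F X))"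
    using g(1)
  proof (induction rule: poly_funs.induct)
    case (coord i j)
    then show ?case using F unfolding poly_mat_def by auto
  qed (auto intro: poly_on_const poly_on_add poly_on_mult)
  then show ?thesis
    by (rule poly_on_cong) (use F g(2) in \<open>auto simp: poly_mat_def\<close>)
qed

lemma sl_mat_carrier: "X \<in> sl_mat n \<Longrightarrow> X \<in> carrier_mat n n"
  by (simp add: sl_mat_def)

lemma zariski_closureD:
  assumes "A \<in> zariski_closure n M" "M \<subseteq> carrier_mat n n" "poly_on n f" "\<And>X. X \<in> M \<Longrightarrow> f X = 0"
  shows "f A = 0"
proof -
  obtain g where g: "g \<in> poly_funs n" "\<And>X. X \<in> carrier_mat n n \<Longrightarrow> f X = g X"
    using assms(3) unfolding poly_on_def by blast
  have "A \<in> carrier_mat n n" using assms(1) by (simp add: zariski_closure_def sl_mat_carrier)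
  moreover have "g X = 0" if "X \<in> M" for X using assms(2,4) g(2) that by (metis subsetD)
  then have "g A = 0" using assms(1) g(1) unfolding zariski_closure_def by blast
  ultimately show ?thesis using g(2) by simp
qed

lemma zariski_closureI:
  assumes "A \<in> sl_mat n" "\<And>f. poly_on n f \<Longrightarrow> (\<And>X. X \<in> M \<Longrightarrow> f X = 0) \<Longrightarrow> f A = 0"
  shows "A \<in> zariski_closure n M"
  using assms poly_onI unfolding zariski_closure_def by blast

lemma zariski_closure_subset: "M \<subseteq> sl_mat n \<Longrightarrow> M \<subseteq> zariski_closure n M"
  unfolding zariski_closure_def by auto

lemma zariski_closure_mono: "M \<subseteq> N \<Longrightarrow> zariski_closure n M \<subseteq> zariski_closure n N"
  unfolding zariski_closure_def by auto

lemma zariski_closure_sl: "zariski_closure n M \<subseteq> sl_mat n"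
  unfolding zariski_closure_def by auto

lemma zariski_closure_minimal:
  "M \<subseteq> zariski_closure n N \<Longrightarrow> zariski_closure n M \<subseteq> zariski_closure n N"
  unfolding zariski_closure_def by blast

lemma poly_on_curve:
  assumes f: "poly_on n f" and c: "\<And>t. Y t \<in> carrier_mat n n"
    and Y: "\<And>i j. i < n \<Longrightarrow> j < n \<Longrightarrow> \<exists>p. \<forall>t. Y t $$ (i, j) = poly p t"
  shows "\<exists>p. \<forall>t. f (Y t) = poly p t"
proof -
  obtain g where g: "g \<in> poly_funs n" "\<And>X. X \<in> carrier_mat n n \<Longrightarrow> f X = g X"
    using f unfolding poly_on_def by blast
  have "\<exists>p. \<forall>t. g (Y t) = poly p t"
    using g(1)
  proof (induction rule: poly_funs.induct)
    case (const c)
    show ?case by (intro exI[of _ "[:c:]"]) simp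
  next
    case (coord i j)
    then show ?case using Y by blast
  next
    case (add f g)
    then obtain p q where "\<forall>t. f (Y t) = poly p t" "\<forall>t. g (Y t) = poly q t" by blast
    then show ?case by (intro exI[of _ "p + q"]) simp
  next
    case (mult f g)
    then obtain p q where "\<forall>t. f (Y t) = poly p t" "\<forall>t. g (Y t) = poly q t" by blast
    then show ?case by (intro exI[of _ "p * q"]) simp
  qed
  then show ?thesis using g(2) c by simp
qed

text \<open>The affine line through \<open>X\<close> (at 0) and \<open>Y\<close> (at 1); polynomial
  functions restrict to polynomials in one variable on it.\<close>

definition line_mat :: "complex mat \<Rightarrow> complex mat \<Rightarrow> complex \<Rightarrow> complex mat" where
  "line_mat X Y t = (1 - t) \<cdot>\<^sub>m X + t \<cdot>\<^sub>m Y"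

lemma poly_on_line:
  assumes f: "poly_on n f" and "X \<in> carrier_mat n n" "Y \<in> carrier_mat n n"
  shows "\<exists>p. \<forall>t. f (line_mat X Y t) = poly p t"
proof (rule poly_on_curve[OF f])
  show "line_mat X Y t \<in> carrier_mat n n" for t using assms by (simp add: line_mat_def)
  show "\<exists>p. \<forall>t. line_mat X Y t $$ (i, j) = poly p t" if "i < n" "j < n" for i j
    using assms that by (intro exI[of _ "[:X $$ (i, j), Y $$ (i, j) - X $$ (i, j):]"])
      (simp add: line_mat_def algebra_simps)
qed

lemma line_mat_ends:
  assumes "X \<in> carrier_mat n n" "Y \<in> carrier_mat n n"
  shows "line_mat X Y 0 = X" "line_mat X Y 1 = Y"
  using assms by (auto simp: line_mat_def intro!: eq_matI)

text \<open>A set of matrices closed under lines is irreducible.\<close>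

lemma poly_on_prod_vanish:
  assumes "finite A" "A \<noteq> {}" and f: "\<And>a. a \<in> A \<Longrightarrow> poly_on n (f a)"
    and L: "L \<subseteq> carrier_mat n n" "\<And>X Y t. X \<in> L \<Longrightarrow> Y \<in> L \<Longrightarrow> line_mat X Y t \<in> L"
    and vanish: "\<And>X. X \<in> L \<Longrightarrow> \<exists>a\<in>A. f a X = 0"
  shows "\<exists>a\<in>A. \<forall>X\<in>L. f a X = 0"
  using assms(1,2) f vanish
proof (induction A rule: finite_ne_induct)
  case (insert a A)
  show ?case
  proof (rule ccontr)
    assume neg: "\<not> ?case"
    define g where "g X = (\<Prod>b\<in>A. f b X)" for X
    have g0: "g X = 0 \<longleftrightarrow> (\<exists>b\<in>A. f b X = 0)" for X using insert.hyps by (simp add: g_def)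
    have pg: "poly_on n g" unfolding g_def using insert.prems by (intro poly_on_prod) auto
    have "\<exists>Y\<in>L. g Y \<noteq> 0"
    proof (rule ccontr)
      assume "\<not> (\<exists>Y\<in>L. g Y \<noteq> 0)"
      then have "\<And>X. X \<in> L \<Longrightarrow> \<exists>b\<in>A. f b X = 0" using g0 by auto
      then show False using insert.IH insert.prems(1) neg by blast
    qed
    then obtain X Y where X: "X \<in> L" "f a X \<noteq> 0" and Y: "Y \<in> L" "g Y \<noteq> 0" using neg by auto
    have c: "X \<in> carrier_mat n n" "Y \<in> carrier_mat n n" using X Y L by auto
    obtain p where p: "\<And>t. f a (line_mat X Y t) = poly p t"
      using poly_on_line[OF _ c, of "f a"] insert.prems(1) by blast
    obtain q where q: "\<And>t. g (line_mat X Y t) = poly q t"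
      using poly_on_line[OF pg c] by blast
    \<comment> \<open>The product vanishes along the whole line through \<open>X\<close> and
      \<open>Y\<close>, although \<open>p\<close> is nonzero at 0 and \<open>q\<close> is nonzero at
      1.\<close>
    have "poly (p * q) t = 0" for t
    proof -
      obtain b where "b \<in> insert a A" "f b (line_mat X Y t) = 0"
        using insert.prems(2) L(2)[OF X(1) Y(1)] by blast
      then show ?thesis using p[of t] q[of t] g0[of "line_mat X Y t"] by auto
    qed
    then have "p * q = 0" using poly_all_0_iff_0 by blast
    then have "p = 0 \<or> q = 0" by simp
    then show False using p[of 0] q[of 1] line_mat_ends[OF c] X Y by auto
  qed
qed auto

text \<open>Extends an identity from generic points to all points: the end \<open>t = 0\<close> may
  itself be one of the finitely many exceptions.\<close>

lemma poly_on_dense_line: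
  assumes f: "poly_on n f" and c: "X \<in> carrier_mat n n" "Y \<in> carrier_mat n n"
    and z: "\<And>t. t \<notin> S \<Longrightarrow> f (line_mat X Y t) = 0" "finite S"
  shows "f X = 0"
proof -
  obtain p where p: "\<And>t. f (line_mat X Y t) = poly p t" using poly_on_line[OF f c] by blast
  have "p = 0"
  proof (rule ccontr)
    assume "p \<noteq> 0"
    then have "finite {t. poly p t = 0}" by (rule poly_roots_finite)
    moreover have "- S \<subseteq> {t. poly p t = 0}" using z(1) p by auto
    ultimately have "finite (- S)" using finite_subset by blast
    then show False using z(2) infinite_UNIV_char_0[where 'a = complex] by (metis finite_compl)
  qed
  then show ?thesis using p[of 0] line_mat_ends(1)[OF c] by simp
qed

section \<open>Ranks and Jordan types\<close>

text \<open>Both factors are padded with zeros to square matrices; the left one then kills a unit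
  vector.\<close>

lemma det_mult_low_rank:
  fixes A B :: "'a :: field mat"
  assumes A: "A \<in> carrier_mat r s" and B: "B \<in> carrier_mat s r" and "s < r"
  shows "det (A * B) = 0"
proof -
  define A' where "A' = mat r r (\<lambda>(i, j). if j < s then A $$ (i, j) else 0)"
  define B' where "B' = mat r r (\<lambda>(i, j). if i < s then B $$ (i, j) else 0)"
  have c: "A' \<in> carrier_mat r r" "B' \<in> carrier_mat r r" by (simp_all add: A'_def B'_def)
  have "A * B = A' * B'"
  proof (rule eq_matI)
    fix i j assume "i < dim_row (A' * B')" "j < dim_col (A' * B')"
    then have ij: "i < r" "j < r" by (simp_all add: A'_def B'_def)
    have "(A' * B') $$ (i, j) = (\<Sum>k<r. A' $$ (i, k) * B' $$ (k, j))"
      using ij c by (simp add: scalar_prod_def atLeast0LessThan)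
    also have "\<dots> = (\<Sum>k<s. A' $$ (i, k) * B' $$ (k, j))"
      using \<open>s < r\<close> ij by (intro sum.mono_neutral_right) (auto simp: A'_def)
    also have "\<dots> = (\<Sum>k<s. A $$ (i, k) * B $$ (k, j))"
      using \<open>s < r\<close> ij by (intro sum.cong) (auto simp: A'_def B'_def)
    also have "\<dots> = (A * B) $$ (i, j)" using ij A B by (simp add: scalar_prod_def atLeast0LessThan)
    finally show "(A * B) $$ (i, j) = (A' * B') $$ (i, j)" by simp
  qed (use A B c in auto)
  moreover have "A' *\<^sub>v unit_vec r s = 0\<^sub>v r"
    using \<open>s < r\<close> by (intro eq_vecI) (auto simp: A'_def)
  then have "det A' = 0"
    using det_0_iff_vec_prod_zero_field[OF c(1)] \<open>s < r\<close> by (metis unit_vec_carrier unit_vec_nonzero)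
  ultimately show ?thesis using det_mult[OF c] by simp
qed

text \<open>Row reduction gives \<open>C = P * A\<close> with \<open>r\<close> nonzero rows. These
  rows and the corresponding columns of the inverse \<open>Q\<close> give \<open>M * N\<close>; the
  same rows restricted to the pivot columns form an identity matrix.\<close>

lemma rank_factorization:
  fixes A :: "'a :: field mat"
  assumes A: "A \<in> carrier_mat n n" and r: "r = n - kernel.dim n A"
  shows "\<exists>M N. M \<in> carrier_mat n r \<and> N \<in> carrier_mat r n \<and> A = M * N"
    "\<exists>P V. P \<in> carrier_mat r n \<and> V \<in> carrier_mat n r \<and> P * A * V = 1\<^sub>m r"
proof -
  define C where "C = gauss_jordan_single A"
  obtain P Q where C: "C = P * A" "C \<in> carrier_mat n n" "row_echelon_form C"
    and PQ: "P \<in> carrier_mat n n" "Q \<in> carrier_mat n n" "P * Q = 1\<^sub>m n" "Q * P = 1\<^sub>m n"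
    using gauss_jordan_single[OF A C_def[symmetric]] by blast
  obtain f where f: "pivot_fun C f n" using C unfolding row_echelon_form_def by auto
  note piv = pivot_funD[OF carrier_matD(1)[OF C(2)] f]
  define I where "I = {i. i < n \<and> row C i \<noteq> 0\<^sub>v n}"
  have finI: "finite I" by (simp add: I_def)
  have "kernel.dim n C = kernel.dim n A"
  proof -
    interpret KC: kernel n n C by unfold_locales (rule C)
    interpret KA: kernel n n A by unfold_locales (rule A)
    have "mat_kernel C = mat_kernel A" unfolding C(1) by (rule mat_kernel_mult_eq[OF A PQ(1,2,4)])
    then show ?thesis by simp
  qed
  then have "kernel.dim n A = n - card I" using find_base_vectors(6)[OF C(3,2)] by (simp add: I_def)
  moreover have "card I \<le> n" unfolding I_def by (rule order.trans[OF card_mono[of "{..<n}"]]) auto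
  ultimately have cI: "card I = r" using r by simp
  obtain h where h: "bij_betw h {..<r} I" using ex_bij_betw_nat_finite[OF finI] cI by (auto simp: atLeast0LessThan)
  have hn: "h s < n" if "s < r" for s using h that by (auto simp: bij_betw_def I_def)
  have hI: "f (h s) < n" if "s < r" for s
  proof -
    have "h s \<in> I" using h that by (auto simp: bij_betw_def)
    then have "row C (h s) \<noteq> 0\<^sub>v n" "h s < n" by (auto simp: I_def)
    then have "f (h s) \<noteq> n" using pivot_fun_zero_row_iff[OF f C(2), of "h s"] by auto
    then show ?thesis using piv(1)[OF \<open>h s < n\<close>] by simp
  qed
  have inj: "h s = h t \<longleftrightarrow> s = t" if "s < r" "t < r" for s t
    using h that by (auto simp: bij_betw_def inj_on_def)
  have AQ: "A = Q * C"
  proof -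
    have "Q * C = (Q * P) * A" unfolding C(1) by (rule assoc_mult_mat[OF PQ(2,1) A, symmetric])
    then show ?thesis using PQ A by simp
  qed
  define M where "M = mat n r (\<lambda>(i, s). Q $$ (i, h s))"
  define N where "N = mat r n (\<lambda>(s, j). C $$ (h s, j))"
  have "A = M * N"
    unfolding AQ
  proof (rule eq_matI)
    fix i j assume "i < dim_row (M * N)" "j < dim_col (M * N)"
    then have ij: "i < n" "j < n" by (simp_all add: M_def N_def)
    have "(Q * C) $$ (i, j) = (\<Sum>k<n. Q $$ (i, k) * C $$ (k, j))"
      using ij PQ C(2) by (simp add: scalar_prod_def atLeast0LessThan)
    also have "\<dots> = (\<Sum>k\<in>I. Q $$ (i, k) * C $$ (k, j))"
    proof (rule sum.mono_neutral_right)
      show "\<forall>k\<in>{..<n} - I. Q $$ (i, k) * C $$ (k, j) = 0"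
      proof
        fix k assume k: "k \<in> {..<n} - I"
        then have "row C k = 0\<^sub>v n" by (auto simp: I_def)
        then have "row C k $ j = 0" using ij by simp
        then show "Q $$ (i, k) * C $$ (k, j) = 0" using k ij C(2) by simp
      qed
    qed (auto simp: I_def)
    also have "\<dots> = (\<Sum>s<r. Q $$ (i, h s) * C $$ (h s, j))"
      by (rule sum.reindex_bij_betw[OF h, symmetric])
    also have "\<dots> = (M * N) $$ (i, j)"
      using ij by (simp add: M_def N_def scalar_prod_def atLeast0LessThan)
    finally show "(Q * C) $$ (i, j) = (M * N) $$ (i, j)" .
  qed (use PQ C in \<open>auto simp: M_def N_def\<close>)
  moreover have "M \<in> carrier_mat n r" "N \<in> carrier_mat r n" by (simp_all add: M_def N_def)
  ultimately show "\<exists>M N. M \<in> carrier_mat n r \<and> N \<in> carrier_mat r n \<and> A = M * N" by blast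
  define P' where "P' = mat r n (\<lambda>(s, j). P $$ (h s, j))"
  define V where "V = mat n r (\<lambda>(j, s). if j = f (h s) then 1 else 0 :: 'a)"
  have P': "P' \<in> carrier_mat r n" and V: "V \<in> carrier_mat n r" by (simp_all add: P'_def V_def)
  have "P' * A * V = 1\<^sub>m r"
  proof (rule eq_matI)
    fix s t assume "s < dim_row (1\<^sub>m r)" "t < dim_col (1\<^sub>m r)"
    then have st: "s < r" "t < r" by simp_all
    have PA: "(P' * A) $$ (s, j) = C $$ (h s, j)" if "j < n" for j
      using that st hn A PQ unfolding C(1) by (simp add: P'_def scalar_prod_def)
    have "P' * A \<in> carrier_mat r n" using P' A by simp
    then have "(P' * A * V) $$ (s, t) = (\<Sum>j<n. (P' * A) $$ (s, j) * V $$ (j, t))"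
      using index_mult_mat_sum[of "P' * A" r n V r s t] st V by blast
    also have "\<dots> = (\<Sum>j<n. if j = f (h t) then C $$ (h s, j) else 0)"
      using st PA by (intro sum.cong) (auto simp: V_def)
    also have "\<dots> = C $$ (h s, f (h t))" using hI[OF st(2)] by simp
    also have "\<dots> = (if s = t then 1 else 0)"
      using piv(4)[OF hn[OF st(2)] hI[OF st(2)]] piv(5)[OF hn[OF st(2)] hI[OF st(2)] hn[OF st(1)]] inj[OF st]
      by auto
    finally show "(P' * A * V) $$ (s, t) = 1\<^sub>m r $$ (s, t)" using st by simp
  qed (use P' V in auto)
  then show "\<exists>P V. P \<in> carrier_mat r n \<and> V \<in> carrier_mat n r \<and> P * A * V = 1\<^sub>m r"
    using P' V by blast
qed

lemma similar_four_block_swap: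
  fixes A B :: "'a :: comm_ring_1 mat"
  assumes A: "A \<in> carrier_mat n n" and B: "B \<in> carrier_mat m m"
  shows "similar_mat (four_block_mat A (0\<^sub>m n m) (0\<^sub>m m n) B) (four_block_mat B (0\<^sub>m m n) (0\<^sub>m n m) A)"
proof (rule similar_matI[where n = "n + m"])
  define P :: "'a mat" where "P = four_block_mat (0\<^sub>m n m) (1\<^sub>m n) (1\<^sub>m m) (0\<^sub>m m n)"
  define Q :: "'a mat" where "Q = four_block_mat (0\<^sub>m m n) (1\<^sub>m m) (1\<^sub>m n) (0\<^sub>m n m)"
  let ?A = "four_block_mat A (0\<^sub>m n m) (0\<^sub>m m n) B" and ?B = "four_block_mat B (0\<^sub>m m n) (0\<^sub>m n m) A"
  have one: "four_block_mat (1\<^sub>m a) (0\<^sub>m a b) (0\<^sub>m b a) (1\<^sub>m b) = (1\<^sub>m (a + b) :: 'a mat)" for a b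
    by (rule four_block_one_mat)
  have PQ: "P * Q = 1\<^sub>m (n + m)"
    unfolding P_def Q_def by (subst mult_four_block_mat[of _ n m _ n _ m _ _ n _ m]) (auto simp: one)
  have QP: "Q * P = 1\<^sub>m (n + m)"
    unfolding P_def Q_def by (subst mult_four_block_mat[of _ m n _ m _ n _ _ m _ n]) (auto simp: one add.commute)
  have PB: "P * ?B = four_block_mat (0\<^sub>m n m) A B (0\<^sub>m m n)"
    unfolding P_def using A B by (subst mult_four_block_mat[of _ n m _ n _ m _ _ m _ n]) auto
  have "P * ?B * Q = ?A"
    unfolding PB Q_def using A B by (subst mult_four_block_mat[of _ n m _ n _ m _ _ n _ m]) auto
  then show "?A = P * ?B * Q" by simp
  show "P * Q = 1\<^sub>m (n + m)" "Q * P = 1\<^sub>m (n + m)" by fact+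
  have "P \<in> carrier_mat (n + m) (m + n)" "Q \<in> carrier_mat (m + n) (n + m)" "?B \<in> carrier_mat (m + n) (m + n)"
    unfolding P_def Q_def using A B by auto
  moreover have "?A \<in> carrier_mat (n + m) (n + m)" using A B by auto
  ultimately show "{?A, ?B, P, Q} \<subseteq> carrier_mat (n + m) (n + m)" by (simp add: add.commute)
qed

lemma jordan_matrix_append:
  "jordan_matrix (xs @ ys) = four_block_mat (jordan_matrix xs)
    (0\<^sub>m (sum_list (map fst xs)) (sum_list (map fst ys))) (0\<^sub>m (sum_list (map fst ys)) (sum_list (map fst xs)))
    (jordan_matrix (ys :: (nat \<times> 'a :: comm_ring_1) list))"
proof -
  have "jordan_matrix (concat [xs, ys]) = diag_block_mat (map jordan_matrix [xs, ys])"
    by (rule jordan_matrix_concat_diag_block_mat)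
  moreover have "diag_block_mat [B] = B" for B :: "'a mat"
    by (auto simp: Let_def intro!: eq_matI)
  ultimately show ?thesis by (simp add: Let_def del: diag_block_mat.simps(2) add: diag_block_mat.simps(2)[of "jordan_matrix xs"])
qed

lemma similar_jordan_append_cong:
  fixes xs :: "(nat \<times> 'a :: comm_ring_1) list"
  assumes "similar_mat (jordan_matrix xs) (jordan_matrix xs')" "similar_mat (jordan_matrix ys) (jordan_matrix ys')"
    "sum_list (map fst xs) = sum_list (map fst xs')" "sum_list (map fst ys) = sum_list (map fst ys')"
  shows "similar_mat (jordan_matrix (xs @ ys)) (jordan_matrix (xs' @ ys'))"
  using similar_mat_four_block_0_0[OF assms(1,2) jordan_matrix_carrier jordan_matrix_carrier] assms(3,4)
  by (simp add: jordan_matrix_append)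

lemma similar_jordan_swap:
  fixes xs :: "(nat \<times> 'a :: comm_ring_1) list"
  shows "similar_mat (jordan_matrix (xs @ ys)) (jordan_matrix (ys @ xs))"
  using similar_four_block_swap[OF jordan_matrix_carrier[of xs] jordan_matrix_carrier[of ys]]
  by (simp add: jordan_matrix_append)

text \<open>Up to similarity a Jordan matrix depends only on the multiset of its blocks: the
  required block is brought to the front by a swap of two groups.\<close>

lemma similar_jordan_perm:
  fixes xs :: "(nat \<times> 'a :: comm_ring_1) list"
  shows "mset xs = mset ys \<Longrightarrow> similar_mat (jordan_matrix xs) (jordan_matrix ys)"
proof (induction xs arbitrary: ys)
  case Nil
  then show ?case by (auto intro: similar_mat_refl jordan_matrix_carrier)
next
  case (Cons x xs)
  have "x \<in> set ys" using Cons.prems by (metis list.set_intros(1) set_mset_mset)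
  then obtain ys1 ys2 where ys: "ys = ys1 @ x # ys2" by (meson split_list)
  then have eq: "mset xs = mset (ys2 @ ys1)" using Cons.prems by simp
  have r: "similar_mat (jordan_matrix zs) (jordan_matrix zs)" for zs :: "(nat \<times> 'a) list"
    by (rule similar_mat_refl[OF jordan_matrix_carrier])
  have "sum_list (map fst xs) = sum_list (map fst (ys2 @ ys1))"
    using eq by (metis mset_map sum_mset_sum_list)
  then have "similar_mat (jordan_matrix ([x] @ xs)) (jordan_matrix ([x] @ (ys2 @ ys1)))"
    using similar_jordan_append_cong[OF r Cons.IH[OF eq], of "[x]"] by simp
  moreover have "similar_mat (jordan_matrix ((x # ys2) @ ys1)) (jordan_matrix (ys1 @ (x # ys2)))"
    by (rule similar_jordan_swap)
  ultimately show ?case using similar_mat_trans ys by simp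
qed

lemma char_matrix_0: "A \<in> carrier_mat n n \<Longrightarrow> char_matrix A 0 = (A :: 'a :: field mat)"
  by (auto simp: char_matrix_def intro!: eq_matI)

lemma dim_gen_eigenspace_0:
  "A \<in> carrier_mat n n \<Longrightarrow> dim_gen_eigenspace A 0 k = kernel.dim n (A ^\<^sub>m k)"
  by (simp add: dim_gen_eigenspace_def char_matrix_0 kernel_dim_def)

lemma nilpotent_jordan_nf:
  fixes A :: "complex mat"
  assumes A: "A \<in> carrier_mat n n" and nil: "A ^\<^sub>m k = 0\<^sub>m n n"
  obtains as where "jordan_nf A as" "snd ` set as \<subseteq> {0}"
proof -
  obtain as where as: "jordan_nf A as"
    using char_poly_factorized[OF A] jordan_nf_exists[OF A] by blast
  have "e = 0" if me: "(m, e) \<in> set as" for m e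
  proof -
    have "m \<noteq> 0" using as me unfolding jordan_nf_def by force
    then have "poly (char_poly A) e = 0"
      unfolding jordan_nf_char_poly[OF as] using me by (force simp: poly_prod_list prod_list_zero_iff)
    then have "eigenvalue A e" using eigenvalue_root_char_poly[OF A] by simp
    then obtain v where v: "eigenvector A v e" by (auto simp: eigenvalue_def)
    then have "v \<in> carrier_vec n" "v \<noteq> 0\<^sub>v n" using A by (auto simp: eigenvector_def)
    have "0\<^sub>m n n *\<^sub>v v = 0\<^sub>v n" using \<open>v \<in> carrier_vec n\<close> by (intro eq_vecI) auto
    then have "e ^ k \<cdot>\<^sub>v v = 0\<^sub>v n" using eigenvector_pow[OF A v, of k] nil \<open>v \<in> carrier_vec n\<close> by simp
    then have "\<forall>i<n. e ^ k * v $ i = 0" using \<open>v \<in> carrier_vec n\<close>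
      by (metis carrier_vecD index_smult_vec(1) index_zero_vec(1))
    moreover obtain i where "i < n" "v $ i \<noteq> 0"
      using \<open>v \<in> carrier_vec n\<close> \<open>v \<noteq> 0\<^sub>v n\<close> by (metis carrier_vecD eq_vecI index_zero_vec)
    ultimately show "e = 0" by auto
  qed
  then show ?thesis using that[OF as] by force
qed

text \<open>The only eigenvalue is 0, and the kernel dimensions of the powers count the Jordan
  blocks of each size.\<close>

lemma nilpotent_similar:
  fixes A B :: "complex mat"
  assumes A: "A \<in> carrier_mat n n" "A ^\<^sub>m k = 0\<^sub>m n n" and B: "B \<in> carrier_mat n n" "B ^\<^sub>m l = 0\<^sub>m n n"
    and dim: "\<And>k. kernel.dim n (A ^\<^sub>m k) = kernel.dim n (B ^\<^sub>m k)"
  shows "similar_mat A B"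
proof -
  obtain as where as: "jordan_nf A as" "snd ` set as \<subseteq> {0}" using nilpotent_jordan_nf[OF A] .
  obtain bs where bs: "jordan_nf B bs" "snd ` set bs \<subseteq> {0}" using nilpotent_jordan_nf[OF B] .
  have "compute_nr_of_jordan_blocks A 0 k = compute_nr_of_jordan_blocks B 0 k" for k
    unfolding compute_nr_of_jordan_blocks_def dim_gen_eigenspace_0[OF A(1)] dim_gen_eigenspace_0[OF B(1)] dim ..
  then have nr: "length (filter ((=) (k, 0)) as) = length (filter ((=) (k, 0)) bs)" if "k \<noteq> 0" for k
    using compute_nr_of_jordan_blocks[OF as(1) that, of 0] compute_nr_of_jordan_blocks[OF bs(1) that, of 0] by simp
  have "mset as = mset bs"
  proof (rule multiset_eqI)
    fix x :: "nat \<times> complex"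
    obtain k e where x: "x = (k, e)" by force
    show "count (mset as) x = count (mset bs) x"
    proof (cases "k \<noteq> 0 \<and> e = 0")
      case True
      then show ?thesis using nr x by (simp add: count_mset count_list_eq_length_filter)
    next
      case False
      then have "x \<notin> set as" "x \<notin> set bs"
        using as bs x unfolding jordan_nf_def by force+
      then show ?thesis by (metis not_in_iff set_mset_mset)
    qed
  qed
  then have "similar_mat (jordan_matrix as) (jordan_matrix bs)" by (rule similar_jordan_perm)
  then show ?thesis using as(1) bs(1) unfolding jordan_nf_def
    by (meson similar_mat_sym similar_mat_trans)
qed

section \<open>Orbits\<close>

lemma SL_matD: "g \<in> SL_mat n \<Longrightarrow> g \<in> carrier_mat n n" "g \<in> SL_mat n \<Longrightarrow> det g = 1"
  by (simp_all add: SL_mat_def)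

lemma conj_setI:
  assumes "g \<in> H" "X \<in> M" "X \<in> carrier_mat n n" "g \<in> carrier_mat n n" "h \<in> carrier_mat n n"
    "g * h = 1\<^sub>m n" "h * g = 1\<^sub>m n"
  shows "g * X * h \<in> conj_set H M"
proof -
  have "similar_mat_wit (g * X * h) X g h"
    using assms by (intro similar_mat_witI[of _ _ n]) auto
  then show ?thesis using assms(1,2) unfolding conj_set_def by blast
qed

lemma conj_setE:
  assumes "Y \<in> conj_set H M" "M \<subseteq> carrier_mat n n"
  obtains g X h where "g \<in> H" "X \<in> M" "X \<in> carrier_mat n n" "g \<in> carrier_mat n n" "h \<in> carrier_mat n n"
    "g * h = 1\<^sub>m n" "h * g = 1\<^sub>m n" "Y = g * X * h" "Y \<in> carrier_mat n n"
proof -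
  obtain g X h where w: "g \<in> H" "X \<in> M" "similar_mat_wit Y X g h" using assms(1) unfolding conj_set_def by blast
  have X: "X \<in> carrier_mat n n" using w assms(2) by blast
  note sw0 = similar_mat_witD[OF refl w(3)]
  have "X \<in> carrier_mat (dim_row Y) (dim_row Y)" by (fact sw0)
  then have "dim_row Y = n" using X by auto
  note sw = similar_mat_witD[OF this[symmetric] w(3)]
  show ?thesis by (rule that[OF w(1,2) X]) (fact sw)+
qed

lemma conj_set_mono: "M \<subseteq> N \<Longrightarrow> conj_set H M \<subseteq> conj_set H N" "H \<subseteq> K \<Longrightarrow> conj_set H M \<subseteq> conj_set K M"
  unfolding conj_set_def by blast+

lemma borel_subset_SL: "borel_mat n \<subseteq> SL_mat n"
  by (auto simp: borel_mat_def)

lemma trace_mult_commute: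
  fixes A B :: "'a :: comm_ring_1 mat"
  assumes "A \<in> carrier_mat n n" "B \<in> carrier_mat n n"
  shows "(\<Sum>i<n. (A * B) $$ (i, i)) = (\<Sum>i<n. (B * A) $$ (i, i))"
proof -
  have "(\<Sum>i<n. (A * B) $$ (i, i)) = (\<Sum>i<n. \<Sum>j<n. A $$ (i, j) * B $$ (j, i))"
    using assms by (intro sum.cong) (auto simp: scalar_prod_def atLeast0LessThan)
  also have "\<dots> = (\<Sum>j<n. \<Sum>i<n. B $$ (j, i) * A $$ (i, j))"
    by (subst sum.swap) (simp add: mult.commute)
  also have "\<dots> = (\<Sum>i<n. (B * A) $$ (i, i))"
    using assms by (intro sum.cong) (auto simp: scalar_prod_def atLeast0LessThan)
  finally show ?thesis .
qed

lemma sl_mat_conj: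
  assumes X: "X \<in> sl_mat n" and c: "g \<in> carrier_mat n n" "h \<in> carrier_mat n n" "h * g = 1\<^sub>m n"
  shows "g * X * h \<in> sl_mat n"
proof -
  have Xc: "X \<in> carrier_mat n n" using X by (rule sl_mat_carrier)
  have "h * (g * X) = X" using c Xc by (simp flip: assoc_mult_mat[of h n n g n X n])
  moreover have "(\<Sum>i<n. (g * X * h) $$ (i, i)) = (\<Sum>i<n. (h * (g * X)) $$ (i, i))"
    using c Xc by (intro trace_mult_commute) auto
  ultimately show ?thesis using X c Xc by (simp add: sl_mat_def)
qed

lemma conj_set_sl: "M \<subseteq> sl_mat n \<Longrightarrow> conj_set H M \<subseteq> sl_mat n"
proof
  fix Y assume M: "M \<subseteq> sl_mat n" and Y: "Y \<in> conj_set H M"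
  have "M \<subseteq> carrier_mat n n" using M sl_mat_carrier by blast
  from Y this obtain g X h where "X \<in> M" "g \<in> carrier_mat n n" "h \<in> carrier_mat n n" "h * g = 1\<^sub>m n" "Y = g * X * h"
    by (rule conj_setE)
  then show "Y \<in> sl_mat n" using sl_mat_conj M by blast
qed

lemma poly_mat_conj:
  "g \<in> carrier_mat n n \<Longrightarrow> h \<in> carrier_mat n n \<Longrightarrow> poly_mat n n n (\<lambda>X. g * X * h)"
  by (intro poly_mat_mult[of n n n] poly_mat_const poly_mat_id)

text \<open>Conjugation by a fixed matrix is polynomial, hence continuous in the Zariski
  topology.\<close>

lemma conj_set_closure:
  assumes M: "M \<subseteq> zariski_closure n N" and N: "N \<subseteq> carrier_mat n n"
  shows "conj_set H M \<subseteq> zariski_closure n (conj_set H N)"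
proof
  have Mc: "M \<subseteq> carrier_mat n n" using M zariski_closure_sl sl_mat_carrier by blast
  fix Y assume Y: "Y \<in> conj_set H M"
  from Y Mc obtain g X h where gh: "g \<in> H" "X \<in> M" "g \<in> carrier_mat n n" "h \<in> carrier_mat n n" "g * h = 1\<^sub>m n"
    "h * g = 1\<^sub>m n" "Y = g * X * h" by (rule conj_setE)
  show "Y \<in> zariski_closure n (conj_set H N)"
  proof (rule zariski_closureI)
    show "Y \<in> sl_mat n" using gh sl_mat_conj M zariski_closure_sl by blast
    fix f assume f: "poly_on n f" "\<And>Z. Z \<in> conj_set H N \<Longrightarrow> f Z = 0"
    have "poly_on n (\<lambda>X. f (g * X * h))" by (rule poly_on_compose[OF f(1) poly_mat_conj[OF gh(3,4)]])
    moreover have "f (g * Z * h) = 0" if "Z \<in> N" for Z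
      using f(2) conj_setI[OF gh(1) that _ gh(3-6)] N that by blast
    ultimately show "f Y = 0" using zariski_closureD[of X n N "\<lambda>X. f (g * X * h)"] M N gh(2,7) by blast
  qed
qed

lemma conj_set_idem:
  assumes "M \<subseteq> carrier_mat n n" and H: "\<And>g g'. g \<in> H \<Longrightarrow> g' \<in> H \<Longrightarrow> g * g' \<in> H"
  shows "conj_set H (conj_set H M) \<subseteq> conj_set H M"
proof
  fix Y assume "Y \<in> conj_set H (conj_set H M)"
  then obtain g g' X Z h h' where "g \<in> H" "similar_mat_wit Y Z g h" "g' \<in> H" "X \<in> M" "similar_mat_wit Z X g' h'"
    unfolding conj_set_def by blast
  then have "similar_mat_wit Y X (g * g') (h' * h)" using similar_mat_wit_trans by blast
  then show "Y \<in> conj_set H M" using \<open>g \<in> H\<close> \<open>g' \<in> H\<close> \<open>X \<in> M\<close> H unfolding conj_set_def by blast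
qed

lemma SL_mat_mult: "g \<in> SL_mat n \<Longrightarrow> g' \<in> SL_mat n \<Longrightarrow> g * g' \<in> SL_mat n"
  by (auto simp: SL_mat_def det_mult)

lemma upper_triangular_mult:
  assumes "g \<in> carrier_mat n n" "g' \<in> carrier_mat n n" "upper_triangular g" "upper_triangular (g' :: 'a :: comm_ring_1 mat)"
  shows "upper_triangular (g * g')"
proof (rule upper_triangularI)
  fix i j assume ij: "j < i" "i < dim_row (g * g')"
  then have "(g * g') $$ (i, j) = (\<Sum>k<n. g $$ (i, k) * g' $$ (k, j))"
    using assms by (simp add: scalar_prod_def atLeast0LessThan)
  also have "\<dots> = 0"
  proof (intro sum.neutral ballI)
    fix k assume "k \<in> {..<n}"
    then show "g $$ (i, k) * g' $$ (k, j) = 0"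
      using assms ij upper_triangularD[of g k i] upper_triangularD[of g' j k] by (cases "k < i") auto
  qed
  finally show "(g * g') $$ (i, j) = 0" .
qed

lemma borel_mat_mult: "g \<in> borel_mat n \<Longrightarrow> g' \<in> borel_mat n \<Longrightarrow> g * g' \<in> borel_mat n"
  using SL_mat_mult[of g n g'] upper_triangular_mult[of g n g'] SL_matD(1) unfolding borel_mat_def by blast

text \<open>A conjugating matrix can be rescaled to determinant \<open>1\<close>.\<close>

lemma conj_set_SL_single:
  assumes n: "n \<ge> 1" and X: "X \<in> carrier_mat n n"
  shows "conj_set (SL_mat n) {X} = {A. similar_mat A X}"
proof (intro equalityI subsetI)
  fix A assume "A \<in> conj_set (SL_mat n) {X}"
  then show "A \<in> {A. similar_mat A X}" unfolding conj_set_def similar_mat_def by blast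
next
  fix A assume "A \<in> {A. similar_mat A X}"
  then obtain g h where w: "similar_mat_wit A X g h" unfolding similar_mat_def by blast
  note sw0 = similar_mat_witD[OF refl w]
  have "X \<in> carrier_mat (dim_row A) (dim_row A)" by (fact sw0)
  then have "dim_row A = n" using X by auto
  note sw = similar_mat_witD[OF this[symmetric] w]
  have gh: "g \<in> carrier_mat n n" "h \<in> carrier_mat n n" "g * h = 1\<^sub>m n" "h * g = 1\<^sub>m n"
    "A = g * X * h" by (fact sw)+
  have "det g * det h = 1" using det_mult[OF gh(1,2)] gh(3) by simp
  then have d: "det g \<noteq> 0" by auto
  define z where "z = inverse (det g)"
  \<comment> \<open>An \<open>n\<close>-th root of the inverse determinant, in polar form.\<close>
  define c where "c = rcis (root n (cmod z)) (Arg z / of_nat n)"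
  have "c ^ n = rcis (root n (cmod z) ^ n) (of_nat n * (Arg z / of_nat n))" unfolding c_def by (rule DeMoivre2)
  also have "\<dots> = rcis (cmod z) (Arg z)" using n by simp
  also have "\<dots> = z" by (rule rcis_cmod_Arg)
  finally have cn: "c ^ n = inverse (det g)" by (simp add: z_def)
  have c0: "c \<noteq> 0" using cn d n by (auto simp: power_0_left)
  have g': "c \<cdot>\<^sub>m g \<in> SL_mat n" using gh(1) cn d by (simp add: SL_mat_def)
  have scale: "(a \<cdot>\<^sub>m M) * (inverse a \<cdot>\<^sub>m N) = M * N"
    if "M \<in> carrier_mat n n" "N \<in> carrier_mat n n" "a \<noteq> 0" for M N :: "complex mat" and a
  proof -
    have iN: "inverse a \<cdot>\<^sub>m N \<in> carrier_mat n n" using that by simp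
    have "(a \<cdot>\<^sub>m M) * (inverse a \<cdot>\<^sub>m N) = a \<cdot>\<^sub>m (inverse a \<cdot>\<^sub>m (M * N))"
      unfolding mult_smult_assoc_mat[OF that(1) iN] mult_smult_distrib[OF that(1,2)] ..
    also have "\<dots> = M * N" using that by (intro eq_matI) auto
    finally show ?thesis .
  qed
  have "inverse c \<noteq> 0" using c0 by simp
  have gh': "(c \<cdot>\<^sub>m g) * (inverse c \<cdot>\<^sub>m h) = 1\<^sub>m n" "(inverse c \<cdot>\<^sub>m h) * (c \<cdot>\<^sub>m g) = 1\<^sub>m n"
    using scale[OF gh(1,2) c0] scale[OF gh(2,1) \<open>inverse c \<noteq> 0\<close>] gh(3,4) by simp_all
  have "(c \<cdot>\<^sub>m g) * X = c \<cdot>\<^sub>m (g * X)" by (rule mult_smult_assoc_mat[OF gh(1) X])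
  then have gXh: "(c \<cdot>\<^sub>m g) * X * (inverse c \<cdot>\<^sub>m h) = g * X * h"
    using scale[OF mult_carrier_mat[OF gh(1) X] gh(2) c0] by simp
  show "A \<in> conj_set (SL_mat n) {X}"
    using conj_setI[OF g' _ X _ _ gh'(1,2), of "{X}"] gh gXh by simp
qed

lemma kernel_dim_le:
  fixes A :: "'a :: field mat"
  assumes "A \<in> carrier_mat n n"
  shows "kernel.dim n A \<le> n"
proof -
  have "kernel_dim A = kernel.dim n A" using assms by (simp add: kernel_dim_def)
  then show ?thesis using kernel_dim_code[of A] assms by simp
qed

text \<open>Semicontinuity of the rank: if \<open>X ^\<^sub>m k\<close> had larger rank than
  \<open>Y ^\<^sub>m k\<close>, the polynomial \<open>det (P * A ^\<^sub>m k * V)\<close> in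
  \<open>A\<close> would vanish on all conjugates of \<open>Y\<close> by \<open>H\<close> but equal
  1 at \<open>X\<close>.\<close>

lemma closure_orbit_kernel_dim:
  assumes X: "X \<in> zariski_closure n (conj_set H {Y})" and Y: "Y \<in> carrier_mat n n"
  shows "kernel.dim n (Y ^\<^sub>m k) \<le> kernel.dim n (X ^\<^sub>m k)"
proof (rule ccontr)
  assume neg: "\<not> ?thesis"
  have Xc: "X \<in> carrier_mat n n" using X zariski_closure_sl sl_mat_carrier by blast
  have Xk: "X ^\<^sub>m k \<in> carrier_mat n n" and Yk: "Y ^\<^sub>m k \<in> carrier_mat n n" using Xc Y by auto
  define r where "r = n - kernel.dim n (X ^\<^sub>m k)"
  define s where "s = n - kernel.dim n (Y ^\<^sub>m k)"
  have "s < r" using neg kernel_dim_le[OF Xk] kernel_dim_le[OF Yk] by (simp add: r_def s_def)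
  obtain P V where P: "P \<in> carrier_mat r n" and V: "V \<in> carrier_mat n r" and PV: "P * X ^\<^sub>m k * V = 1\<^sub>m r"
    using rank_factorization(2)[OF Xk r_def] by blast
  obtain M N where M: "M \<in> carrier_mat n s" and N: "N \<in> carrier_mat s n" and MN: "Y ^\<^sub>m k = M * N"
    using rank_factorization(1)[OF Yk s_def] by blast
  define f where "f A = det (P * A ^\<^sub>m k * V)" for A
  have "poly_on n f"
    unfolding f_def
    by (rule poly_on_det[OF poly_mat_mult[OF poly_mat_mult[OF poly_mat_const[OF P] poly_mat_pow[OF poly_mat_id]]
        poly_mat_const[OF V]]])
  moreover have "f Z = 0" if "Z \<in> conj_set H {Y}" for Z
  proof -
    have "{Y} \<subseteq> carrier_mat n n" using Y by simp
    with that obtain g Y' h where Y': "Y' \<in> {Y}" and gh: "g \<in> carrier_mat n n" "h \<in> carrier_mat n n" "g * h = 1\<^sub>m n" "h * g = 1\<^sub>m n"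
      "Z = g * Y' * h" by (rule conj_setE)
    have "similar_mat_wit Z Y g h" using Y' gh Y by (intro similar_mat_witI[of _ _ n]) auto
    then have "Z ^\<^sub>m k = g * (M * N) * h" using similar_mat_wit_pow_id MN by metis
    moreover have gM: "g * M \<in> carrier_mat n s" and Nh: "N * h \<in> carrier_mat s n" using gh M N by auto
    have "g * (M * N) * h = (g * M) * (N * h)"
      using assoc_mult_mat[OF gh(1) M N] assoc_mult_mat[OF gM N gh(2)] by simp
    ultimately have "P * Z ^\<^sub>m k * V = P * ((g * M) * (N * h)) * V" by simp
    also have "\<dots> = (P * (g * M)) * (N * h) * V" using assoc_mult_mat[OF P gM Nh] by simp
    also have "\<dots> = (P * (g * M)) * ((N * h) * V)"
      using mult_carrier_mat[OF P gM] by (rule assoc_mult_mat[OF _ Nh V])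
    finally show ?thesis unfolding f_def
      using det_mult_low_rank[of "P * (g * M)" r s "(N * h) * V"] P V gM Nh \<open>s < r\<close> mult_carrier_mat by metis
  qed
  moreover have "conj_set H {Y} \<subseteq> carrier_mat n n"
  proof
    fix Z assume "Z \<in> conj_set H {Y}"
    moreover have "{Y} \<subseteq> carrier_mat n n" using Y by simp
    ultimately show "Z \<in> carrier_mat n n" by (rule conj_setE)
  qed
  ultimately have "f X = 0" using zariski_closureD[OF X, of f] by blast
  then show False unfolding f_def PV by simp
qed

text \<open>Each representative lies in the closure of the other orbit, so all kernel dimensions of
  powers agree. This yields the uniqueness needed for the description in
  \<open>dense_orbit\<close>.\<close>

lemma nilpotent_orbit_closure_eq:
  assumes n: "n \<ge> 1" and o: "nilpotent_orbit n O1" "nilpotent_orbit n O2"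
    and eq: "zariski_closure n O1 = zariski_closure n O2"
  shows "O1 = O2"
proof -
  obtain X k where X: "X \<in> sl_mat n" "X ^\<^sub>m k = 0\<^sub>m n n" "O1 = conj_set (SL_mat n) {X}"
    using o(1) unfolding nilpotent_orbit_def by blast
  obtain Y l where Y: "Y \<in> sl_mat n" "Y ^\<^sub>m l = 0\<^sub>m n n" "O2 = conj_set (SL_mat n) {Y}"
    using o(2) unfolding nilpotent_orbit_def by blast
  have c: "X \<in> carrier_mat n n" "Y \<in> carrier_mat n n" using X Y sl_mat_carrier by auto
  have O: "O1 = {A. similar_mat A X}" "O2 = {A. similar_mat A Y}"
    unfolding X(3) Y(3) using conj_set_SL_single[OF n] c by auto
  have sub: "O1 \<subseteq> zariski_closure n O1" "O2 \<subseteq> zariski_closure n O2"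
    unfolding X(3) Y(3) using X(1) Y(1) by (auto intro!: zariski_closure_subset conj_set_sl)
  have "X \<in> O1" "Y \<in> O2" using O c similar_mat_refl by auto
  then have "X \<in> zariski_closure n O2" "Y \<in> zariski_closure n O1" using sub eq by auto
  then have "kernel.dim n (X ^\<^sub>m k) = kernel.dim n (Y ^\<^sub>m k)" for k
    using closure_orbit_kernel_dim[of X n _ Y k] closure_orbit_kernel_dim[of Y n _ X k] c X(3) Y(3)
    by (metis order_antisym)
  then have "similar_mat X Y" using nilpotent_similar[OF c(1) X(2) c(2) Y(2)] by blast
  then show ?thesis unfolding O using similar_mat_trans similar_mat_sym by blast
qed

section \<open>The spaces spanned by the non-inverted matrix units\<close>

text \<open>Letters are counted from 1 and matrix indices from 0, hence the occurrences of
  \<open>Suc\<close>.\<close>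

lemma n_cap_eq:
  "n_cap n w = {X \<in> carrier_mat n n. \<forall>i<n. \<forall>j<n. X $$ (i, j) \<noteq> 0 \<longrightarrow> i < j \<and> before w (Suc i) (Suc j)}"
  (is "_ = ?L")
proof -
  interpret V: matrix_vs n n "TYPE(complex)" .
  let ?S = "{matrix_unit n i j | i j. 1 \<le> i \<and> i < j \<and> j \<le> n \<and> list_pos w i < list_pos w j}"
  have S: "?S \<subseteq> carrier_mat n n" by (auto simp: matrix_unit_def)
  have span: "n_cap n w = V.span ?S" unfolding n_cap_def ..
  have "?S \<subseteq> ?L"
    by (auto simp: matrix_unit_def before_def split: if_splits)
  moreover have "submodule class_ring ?L (module_mat TYPE(complex) n n)"
  proof (rule submodule.intro)
    show "module class_ring (module_mat TYPE(complex) n n)" by (rule V.module_axioms)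
    show "?L \<subseteq> carrier (module_mat TYPE(complex) n n)" by (auto simp: module_mat_simps)
    show "\<zero>\<^bsub>module_mat TYPE(complex) n n\<^esub> \<in> ?L" by (simp add: module_mat_simps)
    show "A \<oplus>\<^bsub>module_mat TYPE(complex) n n\<^esub> B \<in> ?L" if "A \<in> ?L" "B \<in> ?L" for A B
    proof -
      have cAB: "A \<in> carrier_mat n n" "B \<in> carrier_mat n n" using that by blast+
      have "A $$ (i, j) \<noteq> 0 \<or> B $$ (i, j) \<noteq> 0" if "i < n" "j < n" "(A + B) $$ (i, j) \<noteq> 0" for i j
        using that cAB by auto
      then show ?thesis using that unfolding module_mat_simps by blast
    qed
    show "a \<odot>\<^bsub>module_mat TYPE(complex) n n\<^esub> A \<in> ?L" if "A \<in> ?L" for a A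
    proof -
      have cA: "A \<in> carrier_mat n n" using that by blast
      have "A $$ (i, j) \<noteq> 0" if "i < n" "j < n" "(a \<cdot>\<^sub>m A) $$ (i, j) \<noteq> 0" for i j
        using that cA by auto
      then show ?thesis using that smult_carrier_mat unfolding module_mat_simps by blast
    qed
  qed
  ultimately have "V.span ?S \<subseteq> ?L" by (rule V.span_is_subset)
  moreover have "?L \<subseteq> V.span ?S"
  proof
    fix X assume X: "X \<in> ?L"
    \<comment> \<open>\<open>X\<close> with all entries outside \<open>A\<close> cleared; the span
      is reached by restoring one position at a time.\<close>
    define P where "P A = mat n n (\<lambda>p. if p \<in> A then X $$ p else 0)" for A
    have sub: "submodule class_ring (V.span ?S) (module_mat TYPE(complex) n n)"
      by (rule V.span_is_submodule) (rule S)
    have add: "\<And>A B. A \<in> V.span ?S \<Longrightarrow> B \<in> V.span ?S \<Longrightarrow> A + B \<in> V.span ?S"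
      and smult: "\<And>a A. A \<in> V.span ?S \<Longrightarrow> a \<cdot>\<^sub>m A \<in> V.span ?S" and zero: "0\<^sub>m n n \<in> V.span ?S"
      using submodule.m_closed[OF sub] submodule.smult_closed[OF sub] submodule.zero_closed[OF sub]
      by (auto simp: module_mat_simps class_ring_simps)
    have "A \<subseteq> {..<n} \<times> {..<n} \<Longrightarrow> P A \<in> V.span ?S" if "finite A" for A
      using that
    proof (induction A)
      case empty
      have "P {} = 0\<^sub>m n n" by (auto simp: P_def intro!: eq_matI)
      then show ?case using zero by simp
    next
      case (insert p A)
      obtain i j where p: "p = (i, j)" "i < n" "j < n" using insert.prems by auto
      have IH: "P A \<in> V.span ?S" using insert by auto
      show ?case
      proof (cases "X $$ p = 0")
        case True
        then have "P (insert p A) = P A" by (auto simp: P_def intro!: eq_matI)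
        then show ?thesis using IH by simp
      next
        case False
        then have "i < j" "before w (Suc i) (Suc j)" using X p by auto
        then have "matrix_unit n (Suc i) (Suc j) \<in> ?S"
          by (intro CollectI exI[of _ "Suc i"] exI[of _ "Suc j"]) (use p in \<open>auto simp: before_def\<close>)
        then have "matrix_unit n (Suc i) (Suc j) \<in> V.span ?S" using V.in_own_span[OF S] by blast
        moreover have "P (insert p A) = X $$ p \<cdot>\<^sub>m matrix_unit n (Suc i) (Suc j) + P A"
          using insert.hyps p by (auto simp: P_def matrix_unit_def intro!: eq_matI)
        ultimately show ?thesis using add[OF smult IH] by simp
      qed
    qed
    then have "P ({..<n} \<times> {..<n}) \<in> V.span ?S" by simp
    moreover have "P ({..<n} \<times> {..<n}) = X" using X by (auto simp: P_def intro!: eq_matI)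
    ultimately show "X \<in> V.span ?S" by simp
  qed
  ultimately show ?thesis using span by simp
qed

lemma n_capD:
  assumes "X \<in> n_cap n w"
  shows "X \<in> carrier_mat n n"
    "i < n \<Longrightarrow> j < n \<Longrightarrow> X $$ (i, j) \<noteq> 0 \<Longrightarrow> i < j \<and> before w (Suc i) (Suc j)"
  using assms unfolding n_cap_eq by auto

lemma n_cap_sl: "n_cap n w \<subseteq> sl_mat n"
  unfolding n_cap_eq sl_mat_def by (auto intro!: sum.neutral)

lemma n_cap_carrier: "n_cap n w \<subseteq> carrier_mat n n"
  using n_capD(1) by blast

lemma n_cap_line: "X \<in> n_cap n w \<Longrightarrow> Y \<in> n_cap n w \<Longrightarrow> line_mat X Y t \<in> n_cap n w"
proof -
  assume XY: "X \<in> n_cap n w" "Y \<in> n_cap n w"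
  note c = n_capD(1)[OF XY(1)] n_capD(1)[OF XY(2)]
  have "X $$ (i, j) \<noteq> 0 \<or> Y $$ (i, j) \<noteq> 0" if "i < n" "j < n" "line_mat X Y t $$ (i, j) \<noteq> 0" for i j
    using that c by (auto simp: line_mat_def)
  then have "i < j \<and> before w (Suc i) (Suc j)" if "i < n" "j < n" "line_mat X Y t $$ (i, j) \<noteq> 0" for i j
    using that n_capD(2)[OF XY(1)] n_capD(2)[OF XY(2)] by blast
  moreover have "line_mat X Y t \<in> carrier_mat n n" using c by (simp add: line_mat_def)
  ultimately show ?thesis unfolding n_cap_eq by blast
qed

text \<open>The order is reversed, since each inversion removes one matrix unit.\<close>

lemma n_cap_mono_iff:
  assumes "set w = {1..n}" "set y = {1..n}"
  shows "n_cap n y \<subseteq> n_cap n w \<longleftrightarrow> weak_le n w y"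
proof
  assume wy: "weak_le n w y"
  have "before w (Suc i) (Suc j)" if "i < j" "j < n" "before y (Suc i) (Suc j)" for i j
    using wy that before_total[of "Suc i" w "Suc j"] before_asym[of y] assms unfolding weak_le_before
    by fastforce
  then show "n_cap n y \<subseteq> n_cap n w" unfolding n_cap_eq by blast
next
  assume sub: "n_cap n y \<subseteq> n_cap n w"
  show "weak_le n w y"
    unfolding weak_le_before
  proof (intro allI impI)
    fix i j assume ij: "1 \<le> i \<and> i < j \<and> j \<le> n" and b: "before w j i"
    show "before y j i"
    proof (rule ccontr)
      assume "\<not> before y j i"
      then have yij: "before y i j" using before_total[of i y j] ij assms by auto
      obtain i' j' where s: "i = Suc i'" "j = Suc j'" using ij by (metis Suc_le_D One_nat_def le_trans less_imp_le)
      have "matrix_unit n i j \<in> n_cap n y" unfolding n_cap_eq matrix_unit_def using yij ij s by auto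
      then have "matrix_unit n i j \<in> n_cap n w" using sub by blast
      moreover have "matrix_unit n i j $$ (i', j') = 1" using ij s by (simp add: matrix_unit_def)
      ultimately have "before w i j" using n_capD(2)[of "matrix_unit n i j" n w i' j'] ij s by simp
      then show False using b before_asym by metis
    qed
  qed
qed

text \<open>A nonzero entry of the \<open>m\<close>-th power comes from a path of \<open>m\<close>
  nonzero entries of \<open>X\<close>, whose \<open>m + 1\<close> indices increase both in value and
  in position.\<close>

lemma pow_entry_chain:
  assumes X: "X \<in> n_cap n w" and w: "set w = {1..n}"
  shows "p < n \<Longrightarrow> q < n \<Longrightarrow> (X ^\<^sub>m m) $$ (p, q) \<noteq> 0 \<Longrightarrow>
    \<exists>K. chain w K \<and> card K = Suc m \<and> K \<subseteq> {Suc p..Suc q} \<and> Suc q \<in> K"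
proof (induction m arbitrary: q)
  case 0
  then have "p = q" using n_capD(1)[OF X] by (auto split: if_splits)
  then show ?case using 0 w by (intro exI[of _ "{Suc p}"]) (auto simp: chain_def)
next
  case (Suc m)
  have Xc: "X \<in> carrier_mat n n" using n_capD(1)[OF X] .
  then have Xm: "X ^\<^sub>m m \<in> carrier_mat n n" by simp
  have "(X ^\<^sub>m Suc m) $$ (p, q) = (\<Sum>s<n. (X ^\<^sub>m m) $$ (p, s) * X $$ (s, q))"
    using index_mult_mat_sum[OF Xm Xc Suc.prems(1,2)] by simp
  then obtain s where s: "s < n" "(X ^\<^sub>m m) $$ (p, s) * X $$ (s, q) \<noteq> 0"
    using Suc.prems(3) by (metis (no_types, lifting) lessThan_iff sum.neutral)
  then have "(X ^\<^sub>m m) $$ (p, s) \<noteq> 0" "X $$ (s, q) \<noteq> 0" by auto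
  then obtain K where K: "chain w K" "card K = Suc m" "K \<subseteq> {Suc p..Suc s}" "Suc s \<in> K"
    using Suc.IH[OF Suc.prems(1) s(1)] by blast
  have sq: "s < q" "before w (Suc s) (Suc q)"
    using n_capD(2)[OF X s(1) Suc.prems(2) \<open>X $$ (s, q) \<noteq> 0\<close>] by auto
  have kq: "before w k (Suc q)" if "k \<in> K" for k
  proof (cases "k = Suc s")
    case False
    then have "k < Suc s" using K(3) that by fastforce
    then have "before w k (Suc s)" using K(1,4) that unfolding chain_def by blast
    then show ?thesis using sq before_trans by metis
  qed (use sq in simp)
  have lt: "k < Suc q" if "k \<in> K" for k using K(3) that sq by fastforce
  have "chain w (insert (Suc q) K)"
    unfolding chain_def
  proof (intro conjI ballI impI)
    show "insert (Suc q) K \<subseteq> set w" using K(1) w Suc.prems unfolding chain_def by auto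
    fix a b assume ab: "a \<in> insert (Suc q) K" "b \<in> insert (Suc q) K" "a < b"
    then show "before w a b" using K(1) kq lt unfolding chain_def by (metis insertE less_asym less_irrefl)
  qed
  moreover have "card (insert (Suc q) K) = Suc (Suc m)"
    using K(2) lt chain_finite[OF K(1)] by (metis card_insert_disjoint less_irrefl)
  moreover have "insert (Suc q) K \<subseteq> {Suc p..Suc q}" using K(3,4) sq by fastforce
  ultimately show ?case by blast
qed

lemma n_cap_pow_zero:
  assumes X: "X \<in> n_cap n w" and w: "set w = {1..n}" and "n \<le> m"
  shows "X ^\<^sub>m m = 0\<^sub>m n n"
proof (rule eq_matI)
  have Xc: "X \<in> carrier_mat n n" using n_capD(1)[OF X] .
  then show "dim_row (X ^\<^sub>m m) = dim_row (0\<^sub>m n n)" "dim_col (X ^\<^sub>m m) = dim_col (0\<^sub>m n n)" by auto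
  fix p q assume "p < dim_row (0\<^sub>m n n)" "q < dim_col (0\<^sub>m n n)"
  then have pq: "p < n" "q < n" by simp_all
  show "(X ^\<^sub>m m) $$ (p, q) = 0\<^sub>m n n $$ (p, q)"
  proof (rule ccontr)
    assume "\<not> ?thesis"
    then have "(X ^\<^sub>m m) $$ (p, q) \<noteq> 0" using pq by simp
    then obtain K where K: "chain w K" "card K = Suc m" using pow_entry_chain[OF X w pq] by blast
    then have "card K \<le> card {1..n}" using w unfolding chain_def by (intro card_mono) auto
    then show False using K assms(3) by simp
  qed
qed

lemma upper_triangular_inverse:
  fixes g h :: "'a :: field mat"
  assumes g: "g \<in> carrier_mat n n" "upper_triangular g" "det g \<noteq> 0" and h: "h \<in> carrier_mat n n" "h * g = 1\<^sub>m n"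
  shows "upper_triangular h"
proof -
  have diag: "g $$ (j, j) \<noteq> 0" if "j < n" for j
  proof
    assume "g $$ (j, j) = 0"
    then have "0 \<in> set (diag_mat g)" using that g(1) by (force simp: diag_mat_def)
    then have "det g = 0" using det_upper_triangular[OF g(2,1)] by (simp add: prod_list_zero_iff)
    then show False using g(3) by simp
  qed
  have "h $$ (i, j) = 0" if "j < i" "i < n" for i j
    using that
  proof (induction j rule: less_induct)
    case (less j)
    have "0 = (h * g) $$ (i, j)" using h(2) less.prems by simp
    also have "\<dots> = (\<Sum>k<n. h $$ (i, k) * g $$ (k, j))"
      using less.prems by (intro index_mult_mat_sum[OF h(1) g(1)]) auto
    also have "\<dots> = (\<Sum>k\<in>{j}. h $$ (i, k) * g $$ (k, j))"
    proof (rule sum.mono_neutral_right)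
      show "\<forall>k\<in>{..<n} - {j}. h $$ (i, k) * g $$ (k, j) = 0"
      proof
        fix k assume k: "k \<in> {..<n} - {j}"
        show "h $$ (i, k) * g $$ (k, j) = 0"
        proof (cases "k < j")
          case True
          then show ?thesis using less by simp
        next
          case False
          then show ?thesis using k upper_triangularD[OF g(2), of j k] g(1) by auto
        qed
      qed
    qed (use less.prems in auto)
    finally show ?case using diag[of j] less.prems by simp
  qed
  then show ?thesis using h(1) by (intro upper_triangularI) auto
qed

section \<open>Closures of Borel saturations\<close>

definition borel_closure :: "nat \<Rightarrow> nat list \<Rightarrow> complex mat set" where
  "borel_closure n w = zariski_closure n (conj_set (borel_mat n) (n_cap n w))"

lemma borel_conj_sl: "conj_set (borel_mat n) (n_cap n w) \<subseteq> sl_mat n"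
  by (rule conj_set_sl[OF n_cap_sl])

lemma one_in_borel: "1\<^sub>m n \<in> borel_mat n"
  by (simp add: borel_mat_def SL_mat_def)

lemma subset_conj_set: "1\<^sub>m n \<in> H \<Longrightarrow> M \<subseteq> carrier_mat n n \<Longrightarrow> M \<subseteq> conj_set H M"
proof
  fix X assume H: "1\<^sub>m n \<in> H" and M: "M \<subseteq> carrier_mat n n" "X \<in> M"
  then have X: "X \<in> carrier_mat n n" by blast
  have "1\<^sub>m n * X * 1\<^sub>m n \<in> conj_set H M" by (rule conj_setI[OF H M(2) X]) auto
  then show "X \<in> conj_set H M" using X by simp
qed

lemma n_cap_subset_borel_closure: "n_cap n w \<subseteq> borel_closure n w"
  using subset_conj_set[OF one_in_borel n_cap_carrier] zariski_closure_subset[OF borel_conj_sl]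
  unfolding borel_closure_def by blast

text \<open>For upper triangular \<open>g\<close>, the entry \<open>(p, q)\<close> of \<open>g X\<^sup>m g\<^sup>-\<^sup>1\<close> only involves entries \<open>(r, s)\<close> of \<open>X\<^sup>m\<close>
  with \<open>p \<le> r\<close> and \<open>s \<le> q\<close>.\<close>

lemma borel_closure_pow_zero:
  assumes Y: "Y \<in> borel_closure n w" and w: "set w = {1..n}"
    and pq: "a \<le> p" "p < n" "q \<le> b" "q < n" and m: "lis w {Suc a..Suc b} \<le> m"
  shows "(Y ^\<^sub>m m) $$ (p, q) = 0"
proof -
  have poly: "poly_on n (\<lambda>Y. (Y ^\<^sub>m m) $$ (p, q))"
    using poly_mat_pow[OF poly_mat_id, of n m] pq unfolding poly_mat_def by blast
  show ?thesis
  proof (rule zariski_closureD[OF Y[unfolded borel_closure_def] _ poly])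
    show "conj_set (borel_mat n) (n_cap n w) \<subseteq> carrier_mat n n"
      using borel_conj_sl sl_mat_carrier by blast
    fix Z assume "Z \<in> conj_set (borel_mat n) (n_cap n w)"
    then obtain g X h where gX: "g \<in> borel_mat n" "X \<in> n_cap n w"
      and c: "X \<in> carrier_mat n n" "g \<in> carrier_mat n n" "h \<in> carrier_mat n n"
      and gh: "g * h = 1\<^sub>m n" "h * g = 1\<^sub>m n" "Z = g * X * h"
      by (rule conj_setE[OF _ n_cap_carrier])
    have g: "upper_triangular g" "det g = 1" using gX by (auto simp: borel_mat_def SL_mat_def)
    have h: "upper_triangular h" using upper_triangular_inverse[OF c(2) g(1) _ c(3) gh(2)] g(2) by simp
    have "similar_mat_wit Z X g h" using gh c by (intro similar_mat_witI[of _ _ n]) auto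
    then have Zm: "Z ^\<^sub>m m = g * X ^\<^sub>m m * h" by (rule similar_mat_wit_pow_id)
    have Xm: "X ^\<^sub>m m \<in> carrier_mat n n" using c by simp
    then have gXm: "g * X ^\<^sub>m m \<in> carrier_mat n n" using c by simp
    have "(g * X ^\<^sub>m m * h) $$ (p, q) = (\<Sum>s<n. (g * X ^\<^sub>m m) $$ (p, s) * h $$ (s, q))"
      by (rule index_mult_mat_sum[OF gXm c(3) pq(2,4)])
    also have "\<dots> = (\<Sum>s<n. (\<Sum>r<n. g $$ (p, r) * (X ^\<^sub>m m) $$ (r, s)) * h $$ (s, q))"
      using index_mult_mat_sum[OF c(2) Xm pq(2)] by (intro sum.cong) auto
    also have "\<dots> = 0"
    proof (rule sum.neutral, rule ballI)
      fix s assume s: "s \<in> {..<n}"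
      have "g $$ (p, r) * (X ^\<^sub>m m) $$ (r, s) * h $$ (s, q) = 0" if r: "r < n" for r
      proof (rule ccontr)
        assume nz: "\<not> ?thesis"
        then have ne: "g $$ (p, r) \<noteq> 0" "(X ^\<^sub>m m) $$ (r, s) \<noteq> 0" "h $$ (s, q) \<noteq> 0" by auto
        have "p \<le> r" using ne(1) upper_triangularD[OF g(1), of r p] c(2) pq by (auto simp: not_less[symmetric])
        moreover have "s \<le> q" using ne(3) upper_triangularD[OF h, of q s] c(3) s by (auto simp: not_less[symmetric])
        moreover obtain K where K: "chain w K" "card K = Suc m" "K \<subseteq> {Suc r..Suc s}"
          using pow_entry_chain[OF gX(2) w r _ ne(2)] s by auto
        ultimately have "K \<subseteq> {Suc a..Suc b}" using pq by fastforce
        then have "Suc m \<le> lis w {Suc a..Suc b}" using card_le_lis[OF K(1)] K(2) by metis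
        then show False using m by simp
      qed
      then show "(\<Sum>r<n. g $$ (p, r) * (X ^\<^sub>m m) $$ (r, s)) * h $$ (s, q) = 0"
        unfolding sum_distrib_right by (intro sum.neutral) blast
    qed
    finally show "(Z ^\<^sub>m m) $$ (p, q) = 0" using Zm by simp
  qed
qed

text \<open>The matrix units between consecutive elements of the chain add up to a matrix whose
  \<open>m\<close>-th power leads from the first element to the last.\<close>

lemma n_cap_chain_pow:
  assumes K: "chain w K" "card K = Suc m" "K \<subseteq> {Suc a..Suc b}" and w: "set w = {1..n}"
  shows "\<exists>X\<in>n_cap n w. \<exists>p q. a \<le> p \<and> p < n \<and> q \<le> b \<and> q < n \<and> (X ^\<^sub>m m) $$ (p, q) \<noteq> 0"
proof -
  define ks where "ks = map (\<lambda>k. k - 1) (sorted_list_of_set K)"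
  have fin: "finite K" by (rule chain_finite[OF K(1)])
  have Kn: "K \<subseteq> {1..n}" using K(1) w by (simp add: chain_def)
  have len: "length ks = Suc m" using K(2) by (simp add: ks_def)
  have ks: "Suc (ks ! t) \<in> K" if "t \<le> m" for t
  proof -
    have "sorted_list_of_set K ! t \<in> K" using that K(2) fin by (metis le_imp_less_Suc length_sorted_list_of_set nth_mem set_sorted_list_of_set)
    then show ?thesis using Kn that len by (auto simp: ks_def)
  qed
  have mono: "ks ! s < ks ! t" if "s < t" "t \<le> m" for s t
  proof -
    have "sorted_list_of_set K ! s < sorted_list_of_set K ! t"
      using that K(2) sorted_wrt_nth_less[OF strict_sorted_list_of_set[of K], of s t] by simp
    moreover have "Suc (ks ! s) = sorted_list_of_set K ! s" "Suc (ks ! t) = sorted_list_of_set K ! t"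
    proof -
      have "sorted_list_of_set K ! u \<in> K" if "u \<le> m" for u
        using that K(2) fin by (metis le_imp_less_Suc length_sorted_list_of_set nth_mem set_sorted_list_of_set)
      then show "Suc (ks ! s) = sorted_list_of_set K ! s" "Suc (ks ! t) = sorted_list_of_set K ! t"
        using Kn that K(2) by (auto simp: ks_def) (metis Suc_pred' atLeastAtMost_iff less_imp_le_nat less_le_trans subset_iff zero_less_one One_nat_def Suc_le_lessD)+
    qed
    ultimately show ?thesis by simp
  qed
  have ksn: "ks ! t < n" "a \<le> ks ! t" "ks ! t \<le> b" if "t \<le> m" for t
    using ks[OF that] K(3) Kn by auto
  define X where "X = mat n n (\<lambda>(i, j). if \<exists>t<m. i = ks ! t \<and> j = ks ! Suc t then 1 else 0 :: complex)"
  have Xc: "X \<in> carrier_mat n n" by (simp add: X_def)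
  have "X \<in> n_cap n w"
    unfolding n_cap_eq
  proof (intro CollectI conjI allI impI Xc)
    fix i j assume ij: "i < n" "j < n" "X $$ (i, j) \<noteq> 0"
    then obtain t where t: "t < m" "i = ks ! t" "j = ks ! Suc t" by (auto simp: X_def split: if_splits)
    then show "i < j" using mono by simp
    then show "before w (Suc i) (Suc j)" using K(1) ks[of t] ks[of "Suc t"] t unfolding chain_def by simp
  qed
  moreover have "(X ^\<^sub>m t) $$ (ks ! 0, j) = (if j = ks ! t then 1 else 0)" if "t \<le> m" "j < n" for t j
    using that
  proof (induction t arbitrary: j)
    case 0
    then show ?case using Xc ksn[of 0] by auto
  next
    case (Suc t)
    have Xt: "X ^\<^sub>m t \<in> carrier_mat n n" using Xc by simp
    have "(X ^\<^sub>m Suc t) $$ (ks ! 0, j) = (\<Sum>s<n. (X ^\<^sub>m t) $$ (ks ! 0, s) * X $$ (s, j))"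
      using index_mult_mat_sum[OF Xt Xc ksn(1)[of 0] Suc.prems(2)] by simp
    also have "\<dots> = (\<Sum>s<n. if s = ks ! t then X $$ (s, j) else 0)"
      using Suc by (intro sum.cong) auto
    also have "\<dots> = X $$ (ks ! t, j)" using ksn(1)[of t] Suc.prems by simp
    also have "\<dots> = (if j = ks ! Suc t then 1 else 0)"
    proof -
      have "s = t" if "s < m" "ks ! t = ks ! s" for s
        using that mono[of s t] mono[of t s] Suc.prems by (metis Suc_le_lessD less_imp_le less_irrefl linorder_neqE_nat)
      then show ?thesis using Suc.prems ksn(1)[of t] by (auto simp: X_def)
    qed
    finally show ?case .
  qed
  then have "(X ^\<^sub>m m) $$ (ks ! 0, ks ! m) \<noteq> 0" using ksn by simp
  ultimately show ?thesis using ksn[of 0] ksn[of m] by blast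
qed

text \<open>With \<open>m\<close> one less than \<open>lis u {a..b}\<close>, some matrix of
  \<open>n_cap n u\<close> has an \<open>m\<close>-th power that is nonzero in the block. If
  \<open>lis v {a..b}\<close> were smaller, this block would vanish on the whole closure for
  \<open>v\<close>.\<close>

lemma borel_closure_subset_lis:
  assumes sub: "borel_closure n u \<subseteq> borel_closure n v" and s: "set u = {1..n}" "set v = {1..n}"
    and ab: "1 \<le> a" "a \<le> b"
  shows "lis u {a..b} \<le> lis v {a..b}"
proof (rule ccontr)
  assume neg: "\<not> ?thesis"
  obtain a' b' where ab': "a = Suc a'" "b = Suc b'" using ab by (metis One_nat_def Suc_le_D le_trans)
  define m where "m = lis u {a..b} - 1"
  obtain K where K: "chain u K" "K \<subseteq> {Suc a'..Suc b'}" "card K = Suc m"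
    using lis_obtain[of u "{a..b}"] neg by (auto simp: m_def ab')
  obtain X p q where X: "X \<in> n_cap n u" "a' \<le> p" "p < n" "q \<le> b'" "q < n" "(X ^\<^sub>m m) $$ (p, q) \<noteq> 0"
    using n_cap_chain_pow[OF K(1,3,2) s(1)] by blast
  have "X \<in> borel_closure n v" using X(1) n_cap_subset_borel_closure sub by blast
  moreover have "lis v {Suc a'..Suc b'} \<le> m" using neg by (simp add: m_def ab')
  ultimately show False using borel_closure_pow_zero[OF _ s(2) X(2-5)] X(6) by blast
qed

text \<open>Kernel dimensions of powers take finitely many values on the space and separate its
  similarity classes. As the space is irreducible, one of the finitely many classes is dense in
  it.\<close>

lemma dense_orbit_n_cap:
  assumes n: "n \<ge> 1" and w: "set w = {1..n}"
  obtains X0 where "X0 \<in> n_cap n w" "dense_orbit n w = {A. similar_mat A X0}"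
    "dense_orbit n w = conj_set (SL_mat n) {X0}"
    "n_cap n w \<subseteq> zariski_closure n (n_cap n w \<inter> dense_orbit n w)"
proof -
  let ?L = "n_cap n w"
  \<comment> \<open>From exponent \<open>n\<close> on the powers vanish, so the exponents below
    \<open>n\<close> determine all kernel dimensions.\<close>
  define sig where "sig X = map (\<lambda>k. kernel.dim n (X ^\<^sub>m k)) [0..<n]" for X :: "complex mat"
  have Lc: "X \<in> carrier_mat n n" if "X \<in> ?L" for X using n_capD(1)[OF that] .
  have sim: "similar_mat X Y" if X: "X \<in> ?L" and Y: "Y \<in> ?L" and eq: "sig X = sig Y" for X Y
  proof (rule nilpotent_similar[OF Lc[OF X] n_cap_pow_zero[OF X w order_refl] Lc[OF Y] n_cap_pow_zero[OF Y w order_refl]])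
    fix k
    show "kernel.dim n (X ^\<^sub>m k) = kernel.dim n (Y ^\<^sub>m k)"
    proof (cases "k < n")
      case True
      then have "sig X ! k = sig Y ! k" using eq by simp
      then show ?thesis using True by (simp add: sig_def)
    next
      case False
      then show ?thesis using n_cap_pow_zero[OF X w] n_cap_pow_zero[OF Y w] by simp
    qed
  qed
  have "sig ` ?L \<subseteq> {xs. set xs \<subseteq> {..n} \<and> length xs = n}"
  proof
    fix xs assume "xs \<in> sig ` ?L"
    then obtain X where X: "X \<in> ?L" "xs = sig X" by blast
    have "kernel.dim n (X ^\<^sub>m k) \<le> n" for k using Lc[OF X(1)] by (intro kernel_dim_le) simp
    then show "xs \<in> {xs. set xs \<subseteq> {..n} \<and> length xs = n}" using X(2) by (auto simp: sig_def)
  qed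
  then have fin: "finite (sig ` ?L)" by (rule finite_subset) (rule finite_lists_length_eq, simp)
  have "0\<^sub>m n n \<in> ?L" unfolding n_cap_eq by auto
  then have ne: "sig ` ?L \<noteq> {}" by blast
  have "\<exists>a\<in>sig ` ?L. ?L \<subseteq> zariski_closure n {X \<in> ?L. sig X = a}"
  proof (rule ccontr)
    assume neg: "\<not> ?thesis"
    \<comment> \<open>If no class were dense, each would lie in the zeros of a polynomial that is
      nonzero somewhere on the space, against irreducibility.\<close>
    have "\<forall>a\<in>sig ` ?L. \<exists>f. poly_on n f \<and> (\<forall>X\<in>?L. sig X = a \<longrightarrow> f X = 0) \<and> \<not> (\<forall>X\<in>?L. f X = 0)"
    proof
      fix a assume a: "a \<in> sig ` ?L"
      obtain A where A: "A \<in> ?L" "A \<notin> zariski_closure n {X \<in> ?L. sig X = a}" using neg a by blast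
      then have "A \<in> sl_mat n" using n_cap_sl by blast
      then show "\<exists>f. poly_on n f \<and> (\<forall>X\<in>?L. sig X = a \<longrightarrow> f X = 0) \<and> \<not> (\<forall>X\<in>?L. f X = 0)"
        using A zariski_closureI[of A n "{X \<in> ?L. sig X = a}"] by blast
    qed
    from bchoice[OF this] obtain f where f: "\<forall>a\<in>sig ` ?L. poly_on n (f a) \<and>
      (\<forall>X\<in>?L. sig X = a \<longrightarrow> f a X = 0) \<and> \<not> (\<forall>X\<in>?L. f a X = 0)" ..
    have "\<exists>a\<in>sig ` ?L. \<forall>X\<in>?L. f a X = 0"
      by (rule poly_on_prod_vanish[OF fin ne _ n_cap_carrier n_cap_line]) (use f in blast)+
    then show False using f by blast
  qed
  then obtain X0 where X0: "X0 \<in> ?L" and dense: "?L \<subseteq> zariski_closure n {X \<in> ?L. sig X = sig X0}" by blast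
  define Orb where "Orb = conj_set (SL_mat n) {X0}"
  have Orb_eq: "Orb = {A. similar_mat A X0}" unfolding Orb_def by (rule conj_set_SL_single[OF n Lc[OF X0]])
  have "{X \<in> ?L. sig X = sig X0} \<subseteq> ?L \<inter> Orb" unfolding Orb_eq using sim X0 by auto
  then have LO: "?L \<subseteq> zariski_closure n (?L \<inter> Orb)" using dense zariski_closure_mono by blast
  have orb: "nilpotent_orbit n Orb"
    unfolding nilpotent_orbit_def Orb_def using X0 n_cap_sl n_cap_pow_zero[OF X0 w order_refl] by blast
  have cl: "zariski_closure n (conj_set (SL_mat n) ?L) = zariski_closure n Orb"
  proof
    have "conj_set (SL_mat n) (?L \<inter> Orb) \<subseteq> conj_set (SL_mat n) (conj_set (SL_mat n) {X0})"
      unfolding Orb_def by (rule conj_set_mono) blast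
    also have "\<dots> \<subseteq> Orb" unfolding Orb_def using Lc[OF X0] by (intro conj_set_idem[of _ n] SL_mat_mult) auto
    finally have "conj_set (SL_mat n) (?L \<inter> Orb) \<subseteq> Orb" .
    moreover have "conj_set (SL_mat n) ?L \<subseteq> zariski_closure n (conj_set (SL_mat n) (?L \<inter> Orb))"
      using n_cap_carrier by (intro conj_set_closure[OF LO]) auto
    ultimately have "conj_set (SL_mat n) ?L \<subseteq> zariski_closure n Orb" using zariski_closure_mono by blast
    then show "zariski_closure n (conj_set (SL_mat n) ?L) \<subseteq> zariski_closure n Orb" by (rule zariski_closure_minimal)
    show "zariski_closure n Orb \<subseteq> zariski_closure n (conj_set (SL_mat n) ?L)"
      unfolding Orb_def using X0 by (intro zariski_closure_mono conj_set_mono) auto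
  qed
  have "dense_orbit n w = Orb"
    unfolding dense_orbit_def
  proof (rule the_equality)
    fix Orb' assume "nilpotent_orbit n Orb' \<and> zariski_closure n (conj_set (SL_mat n) ?L) = zariski_closure n Orb'"
    then show "Orb' = Orb" using nilpotent_orbit_closure_eq[OF n _ orb, of Orb'] cl by metis
  qed (use orb cl in simp)
  then show ?thesis using that[OF X0] Orb_eq Orb_def LO by simp
qed

text \<open>Intersecting with the dense orbit loses nothing: the part of \<open>n_cap n w\<close>
  inside the orbit is dense in it, and Borel conjugation does not leave the orbit.\<close>

lemma zariski_closure_orbital_variety:
  assumes n: "n \<ge> 1" and w: "set w = {1..n}"
  shows "zariski_closure n (orbital_variety n w) = borel_closure n w"
proof
  let ?B = "borel_mat n"
  have V: "orbital_variety n w = borel_closure n w \<inter> dense_orbit n w"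
    by (simp add: orbital_variety_def borel_closure_def)
  show "zariski_closure n (orbital_variety n w) \<subseteq> borel_closure n w"
    unfolding V borel_closure_def by (rule zariski_closure_minimal) blast
  obtain X0 where X0: "X0 \<in> n_cap n w" "dense_orbit n w = conj_set (SL_mat n) {X0}"
    and dense: "n_cap n w \<subseteq> zariski_closure n (n_cap n w \<inter> dense_orbit n w)"
    using dense_orbit_n_cap[OF n w] by metis
  let ?M = "n_cap n w \<inter> dense_orbit n w"
  have "conj_set ?B ?M \<subseteq> conj_set (SL_mat n) (conj_set (SL_mat n) {X0})"
    using conj_set_mono(1)[of ?M "dense_orbit n w" ?B] conj_set_mono(2)[OF borel_subset_SL, of n "dense_orbit n w"] X0(2) by auto
  also have "\<dots> \<subseteq> dense_orbit n w"
    unfolding X0(2) using n_capD(1)[OF X0(1)] by (intro conj_set_idem[of _ n] SL_mat_mult) auto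
  finally have 1: "conj_set ?B ?M \<subseteq> dense_orbit n w" .
  have "conj_set ?B ?M \<subseteq> conj_set ?B (n_cap n w)" by (rule conj_set_mono) blast
  also have "\<dots> \<subseteq> borel_closure n w" unfolding borel_closure_def by (rule zariski_closure_subset[OF borel_conj_sl])
  finally have "conj_set ?B ?M \<subseteq> orbital_variety n w" using 1 unfolding V by blast
  moreover have "conj_set ?B (n_cap n w) \<subseteq> zariski_closure n (conj_set ?B ?M)"
    using n_cap_carrier by (intro conj_set_closure[OF dense]) auto
  ultimately have "conj_set ?B (n_cap n w) \<subseteq> zariski_closure n (orbital_variety n w)"
    using zariski_closure_mono by blast
  then show "borel_closure n w \<subseteq> zariski_closure n (orbital_variety n w)"
    unfolding borel_closure_def by (rule zariski_closure_minimal)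
qed

section \<open>Invariance of the closures under Knuth moves\<close>

lemma index_addrow_conj:
  fixes X :: "'a :: comm_ring_1 mat"
  assumes X: "X \<in> carrier_mat n n" and bc: "b < n" "c < n" "b \<noteq> c" and ij: "i < n" "j < n"
  shows "(addrow_mat n s b c * X * addrow_mat n (- s) b c) $$ (i, j) =
    X $$ (i, j) + (if i = b then s * X $$ (c, j) else 0)
      - (if j = c then s * (X $$ (i, b) + (if i = b then s * X $$ (c, b) else 0)) else 0)"
proof -
  define W where "W = addrow_mat n s b c * X"
  have Wc: "W \<in> carrier_mat n n" unfolding W_def by (rule mult_carrier_mat[OF addrow_mat_carrier X])
  have We: "W $$ (i, k) = X $$ (i, k) + (if i = b then s * X $$ (c, k) else 0)" if "k < n" for k
    using X that ij bc unfolding W_def addrow_mat[OF X bc(2), symmetric] by auto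
  have "(W * addrow_mat n (- s) b c) $$ (i, j) = (\<Sum>k<n. W $$ (i, k) * addrow_mat n (- s) b c $$ (k, j))"
    by (rule index_mult_mat_sum[OF Wc _ ij]) simp
  also have "\<dots> = (\<Sum>k<n. (if k = j then W $$ (i, k) else 0) - (if k = b then (if j = c then s * W $$ (i, k) else 0) else 0))"
    using ij bc by (intro sum.cong) auto
  also have "\<dots> = W $$ (i, j) - (if j = c then s * W $$ (i, b) else 0)"
    using ij bc by (simp add: sum_subtractf)
  finally show ?thesis using We ij bc unfolding W_def by simp
qed

lemma addrow_mat_borel:
  assumes "b < c" "c < n"
  shows "addrow_mat n s b c \<in> borel_mat n"
  using assms det_addrow_mat[of b c n s]
  by (auto simp: borel_mat_def SL_mat_def intro!: upper_triangularI)

text \<open>A Knuth move removes the matrix unit \<open>E\<^sub>x\<^sub>z\<close>; generically the corresponding entry is killed by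
  conjugation with \<open>1 + s E\<^sub>y\<^sub>z\<close> or \<open>1 + s E\<^sub>x\<^sub>y\<close>.\<close>

lemma knuth_swap_conj:
  assumes sw: "knuth_swap w w' x y z" and w: "set w = {1..n}" and X: "X \<in> n_cap n w"
    and gen: "(before w x y \<and> before w z y \<and> X $$ (x - 1, y - 1) \<noteq> 0) \<or>
      (before w y x \<and> before w y z \<and> X $$ (y - 1, z - 1) \<noteq> 0)"
  shows "X \<in> conj_set (borel_mat n) (n_cap n w')"
proof -
  have xyz: "x < y" "y < z" "x \<in> {1..n}" "y \<in> {1..n}" "z \<in> {1..n}"
    and same: "\<And>p q. {p, q} \<noteq> {x, z} \<Longrightarrow> before w' p q = before w p q"
    and adj: "\<And>s. s \<noteq> x \<Longrightarrow> s \<noteq> y \<Longrightarrow> s \<noteq> z \<Longrightarrow>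
      before w s x = before w s y \<and> before w s z = before w s y \<and>
      before w x s = before w y s \<and> before w z s = before w y s"
    using sw w unfolding knuth_swap_def by blast+
  obtain x0 y0 z0 where s0: "x = Suc x0" "y = Suc y0" "z = Suc z0"
    using xyz by (metis Suc_le_D One_nat_def atLeastAtMost_iff)
  have lt: "x0 < y0" "y0 < z0" "z0 < n" using xyz s0 by auto
  have Xc: "X \<in> carrier_mat n n" using n_capD(1)[OF X] .
  note Xw = n_capD(2)[OF X]
  have ok: "before w' (Suc i) (Suc j)" if "before w (Suc i) (Suc j)" "i < j" "\<not> (i = x0 \<and> j = z0)" for i j
    using same[of "Suc i" "Suc j"] that lt s0 by (auto simp: doubleton_eq_iff)
  \<comment> \<open>One elementary conjugation is enough: \<open>ent\<close> places the conjugate in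
    the smaller space, and the inverse elementary matrix leads back to \<open>X\<close>.\<close>
  have main: "X \<in> conj_set (borel_mat n) (n_cap n w')"
    if bc: "b < c" "c < n" and ent: "\<And>i j. i < n \<Longrightarrow> j < n \<Longrightarrow>
      X $$ (i, j) + (if i = b then s * X $$ (c, j) else 0)
        - (if j = c then s * (X $$ (i, b) + (if i = b then s * X $$ (c, b) else 0)) else 0) \<noteq> 0 \<Longrightarrow>
      i < j \<and> before w' (Suc i) (Suc j)" for b c s
  proof -
    let ?g = "addrow_mat n s b c" and ?h = "addrow_mat n (- s) b c"
    have gh: "?g * ?h = 1\<^sub>m n" "?h * ?g = 1\<^sub>m n"
      using addrow_mat_inv[of b n c s] addrow_mat_inv[of b n c "- s"] bc by auto
    define Y where "Y = ?g * X * ?h"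
    have Yc: "Y \<in> carrier_mat n n" unfolding Y_def
      by (rule mult_carrier_mat[OF mult_carrier_mat[OF addrow_mat_carrier Xc] addrow_mat_carrier])
    have b: "b < n" "b \<noteq> c" using bc by auto
    have "Y \<in> n_cap n w'"
      unfolding n_cap_eq Y_def using Yc ent index_addrow_conj[OF Xc b(1) bc(2) b(2)] unfolding Y_def by auto
    moreover have "?h * Y * ?g = X"
    proof -
      have "similar_mat_wit Y X ?g ?h" using gh Xc Yc by (intro similar_mat_witI[of _ _ n]) (auto simp: Y_def)
      then have "similar_mat_wit X Y ?h ?g" by (rule similar_mat_wit_sym)
      then show ?thesis using similar_mat_witD2(3)[OF Xc] by metis
    qed
    ultimately show ?thesis
      using conj_setI[OF addrow_mat_borel[OF bc, of "- s"] _ Yc _ _ gh(2,1), of "n_cap n w'"] by simp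
  qed
  from gen show ?thesis
  proof
    assume g: "before w x y \<and> before w z y \<and> X $$ (x - 1, y - 1) \<noteq> 0"
    \<comment> \<open>Chosen to cancel the entry at \<open>(x0, z0)\<close> of the
      conjugate.\<close>
    define s where "s = X $$ (x0, z0) / X $$ (x0, y0)"
    have ne: "X $$ (x0, y0) \<noteq> 0" using g s0 by simp
    show ?thesis
    proof (rule main[OF lt(2,3)])
      fix i j assume ij: "i < n" "j < n"
        and nz: "X $$ (i, j) + (if i = y0 then s * X $$ (z0, j) else 0)
          - (if j = z0 then s * (X $$ (i, y0) + (if i = y0 then s * X $$ (z0, y0) else 0)) else 0) \<noteq> 0"
      have z1: "X $$ (z0, y0) = 0" using Xw[of z0 y0] lt by auto
      have z2: "X $$ (y0, y0) = 0" using Xw[of y0 y0] lt by auto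
      have e0: "\<not> (i = x0 \<and> j = z0)" using nz ne lt by (auto simp: s_def)
      \<comment> \<open>New entries arise only in row \<open>y0\<close> from row \<open>z0\<close>
        and in column \<open>z0\<close> from column \<open>y0\<close>. As \<open>y\<close> is next
        to the pair in the word, their order conditions carry over.\<close>
      have "X $$ (i, j) \<noteq> 0 \<or> (i = y0 \<and> X $$ (z0, j) \<noteq> 0) \<or> (j = z0 \<and> i \<noteq> y0 \<and> X $$ (i, y0) \<noteq> 0)"
      proof (rule ccontr)
        assume "\<not> ?thesis"
        then show False using nz z1 z2 by (auto split: if_splits)
      qed
      then consider "X $$ (i, j) \<noteq> 0" | "i = y0" "X $$ (z0, j) \<noteq> 0" | "j = z0" "i \<noteq> y0" "X $$ (i, y0) \<noteq> 0"
        by blast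
      then show "i < j \<and> before w' (Suc i) (Suc j)"
      proof cases
        case 1
        then show ?thesis using Xw[OF ij] ok e0 by blast
      next
        case 2
        then have j: "z0 < j" "before w z (Suc j)" using Xw[of z0 j] ij lt s0 by auto
        then have "before w y (Suc j)" using adj[of "Suc j"] lt s0 by auto
        then show ?thesis using ok[of i j] 2 j lt s0 by auto
      next
        case 3
        then have i: "i < y0" "before w (Suc i) y" using Xw[of i y0] ij lt s0 by auto
        then have "before w (Suc i) z" using adj[of "Suc i"] lt s0 e0 3 by auto
        then show ?thesis using ok[of i j] 3 i lt s0 e0 by auto
      qed
    qed
  next
    assume g: "before w y x \<and> before w y z \<and> X $$ (y - 1, z - 1) \<noteq> 0"
    \<comment> \<open>The same cancellation, now by adding a multiple of row \<open>y0\<close> to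
      row \<open>x0\<close>.\<close>
    define s where "s = - X $$ (x0, z0) / X $$ (y0, z0)"
    have ne: "X $$ (y0, z0) \<noteq> 0" using g s0 by simp
    have "y0 < n" using lt by simp
    show ?thesis
    proof (rule main[OF lt(1) \<open>y0 < n\<close>])
      fix i j assume ij: "i < n" "j < n"
        and nz: "X $$ (i, j) + (if i = x0 then s * X $$ (y0, j) else 0)
          - (if j = y0 then s * (X $$ (i, x0) + (if i = x0 then s * X $$ (y0, x0) else 0)) else 0) \<noteq> 0"
      have z1: "X $$ (y0, x0) = 0" using Xw[of y0 x0] lt by auto
      have e0: "\<not> (i = x0 \<and> j = z0)" using nz ne lt by (auto simp: s_def)
      have "X $$ (i, j) \<noteq> 0 \<or> (i = x0 \<and> X $$ (y0, j) \<noteq> 0) \<or> (j = y0 \<and> X $$ (i, x0) \<noteq> 0)"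
      proof (rule ccontr)
        assume "\<not> ?thesis"
        then show False using nz z1 by (auto split: if_splits)
      qed
      then consider "X $$ (i, j) \<noteq> 0" | "i = x0" "X $$ (y0, j) \<noteq> 0" | "j = y0" "X $$ (i, x0) \<noteq> 0"
        by blast
      then show "i < j \<and> before w' (Suc i) (Suc j)"
      proof cases
        case 1
        then show ?thesis using Xw[OF ij] ok e0 by blast
      next
        case 2
        then have j: "y0 < j" "before w y (Suc j)" using Xw[of y0 j] ij lt s0 by auto
        then have "before w x (Suc j)" using adj[of "Suc j"] lt s0 e0 2 by auto
        then show ?thesis using ok[of i j] 2 j lt s0 e0 by auto
      next
        case 3
        then have i: "i < x0" "before w (Suc i) x" using Xw[of i x0] ij lt s0 by auto
        then have "before w (Suc i) y" using adj[of "Suc i"] lt s0 by auto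
        then show ?thesis using ok[of i j] 3 i lt s0 by auto
      qed
    qed
  qed
qed

text \<open>The move adds an inversion, which gives one inclusion. Conversely, matrices with nonzero
  entry at \<open>(p, q)\<close> are conjugate into the smaller space, and every matrix is a limit
  of such matrices on its line towards the matrix unit \<open>E\<close>.\<close>

lemma knuth_swap_borel_closure:
  assumes sw: "knuth_swap w w' x y z" and w: "set w = {1..n}"
  shows "borel_closure n w = borel_closure n w'"
proof
  have xyz: "x < y" "y < z" "x \<in> {1..n}" "y \<in> {1..n}" "z \<in> {1..n}" "before w' z x" "before w x z"
    and same: "\<And>p q. {p, q} \<noteq> {x, z} \<Longrightarrow> before w' p q = before w p q"
    and side: "before w y x \<and> before w y z \<or> before w x y \<and> before w z y"
    using sw w unfolding knuth_swap_def by blast+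
  have "before w (Suc i) (Suc j)" if "i < j" "before w' (Suc i) (Suc j)" for i j
    using same[of "Suc i" "Suc j"] that xyz before_asym[of w'] by (auto simp: doubleton_eq_iff)
  then have "n_cap n w' \<subseteq> n_cap n w" unfolding n_cap_eq by blast
  then show "borel_closure n w' \<subseteq> borel_closure n w"
    unfolding borel_closure_def by (intro zariski_closure_mono conj_set_mono)
  \<comment> \<open>The position of the entry required to be nonzero: \<open>(x, y)\<close> if
    \<open>y\<close> follows the pair in the word, \<open>(y, z)\<close> if it precedes it.\<close>
  define p q where "p = (if before w x y then x else y)" and "q = (if before w x y then y else z)"
  have pq: "p < q" "p \<in> {1..n}" "q \<in> {1..n}" "before w p q" "before w x y \<Longrightarrow> before w z y"
    using xyz side before_asym[of w] by (auto simp: p_def q_def)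
  have gen: "(before w x y \<and> before w z y \<and> X $$ (x - 1, y - 1) \<noteq> 0) \<or>
      (before w y x \<and> before w y z \<and> X $$ (y - 1, z - 1) \<noteq> 0)"
    if "X $$ (p - 1, q - 1) \<noteq> 0" for X :: "complex mat"
    using that side before_asym[of w] by (auto simp: p_def q_def)
  define E where "E = matrix_unit n p q"
  have E: "E \<in> n_cap n w"
    unfolding n_cap_eq E_def matrix_unit_def using pq by auto
  have Ec: "E \<in> carrier_mat n n" using n_capD(1)[OF E] .
  have E1: "E $$ (p - 1, q - 1) = 1" using pq by (simp add: E_def matrix_unit_def)
  have "n_cap n w \<subseteq> zariski_closure n (conj_set (borel_mat n) (n_cap n w'))"
  proof
    fix X assume X: "X \<in> n_cap n w"
    have Xc: "X \<in> carrier_mat n n" using n_capD(1)[OF X] .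
    have pq': "p - 1 < n" "q - 1 < n" using pq by auto
    show "X \<in> zariski_closure n (conj_set (borel_mat n) (n_cap n w'))"
    proof (rule zariski_closureI)
      show "X \<in> sl_mat n" using X n_cap_sl by blast
      fix f assume f: "poly_on n f" "\<And>Z. Z \<in> conj_set (borel_mat n) (n_cap n w') \<Longrightarrow> f Z = 0"
      let ?c = "X $$ (p - 1, q - 1)"
      \<comment> \<open>The entry at \<open>(p, q)\<close> along the line from \<open>X\<close> to
        \<open>E\<close>. Its value at 1 is 1, so it has finitely many zeros.\<close>
      let ?P = "[:?c, 1 - ?c:]"
      have P: "?P \<noteq> 0" by auto
      show "f X = 0"
      proof (rule poly_on_dense_line[OF f(1) Xc Ec])
        show "finite {t. poly ?P t = 0}" by (rule poly_roots_finite[OF P])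
        fix t assume t: "t \<notin> {t. poly ?P t = 0}"
        have "line_mat X E t $$ (p - 1, q - 1) = poly ?P t"
          using Xc Ec E1 pq' by (simp add: line_mat_def algebra_simps)
        then have "line_mat X E t $$ (p - 1, q - 1) \<noteq> 0" using t by simp
        then have "line_mat X E t \<in> conj_set (borel_mat n) (n_cap n w')"
          using knuth_swap_conj[OF sw w n_cap_line[OF X E] gen] by blast
        then show "f (line_mat X E t) = 0" by (rule f(2))
      qed
    qed
  qed
  then have "conj_set (borel_mat n) (n_cap n w) \<subseteq>
      zariski_closure n (conj_set (borel_mat n) (conj_set (borel_mat n) (n_cap n w')))"
    using borel_conj_sl sl_mat_carrier by (intro conj_set_closure) blast+
  also have "\<dots> \<subseteq> borel_closure n w'"
    unfolding borel_closure_def by (intro zariski_closure_mono conj_set_idem[OF n_cap_carrier] borel_mat_mult)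
  finally show "borel_closure n w \<subseteq> borel_closure n w'"
    unfolding borel_closure_def by (rule zariski_closure_minimal)
qed

lemma knuth_borel_closure:
  assumes "knuth w w'" "distinct w" "set w = {1..n}"
  shows "borel_closure n w = borel_closure n w'"
proof -
  \<comment> \<open>\<open>knuth_invariant\<close> asks for invariance on all words with distinct
    letters, but that of the closure is known for words on \<open>{1..n}\<close>; hence the
    guard.\<close>
  let ?f = "\<lambda>w. if set w = {1..n} then borel_closure n w else {}"
  have "?f w = ?f w'"
  proof (rule knuth_invariant[OF assms(1,2)])
    fix w w' x y z assume sw: "knuth_swap w w' x y z"
    then have "set w' = set w" by (simp add: knuth_swap_def)
    then show "?f w = ?f w'" using knuth_swap_borel_closure[OF sw] by simp
  qed
  then show ?thesis using assms(3) knuth_set[OF assms(1)] by simp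
qed

text \<open>The word chosen inside \<open>tableau_variety\<close> does not affect the closure,
  because all words of a cell are Knuth equivalent to the reading word.\<close>

lemma tableau_variety_closure:
  assumes n: "n \<ge> 1" and T: "T \<in> two_row_tableaux n"
  shows "zariski_closure n (tableau_variety n T) = borel_closure n (two_row_word n T)"
    "tableau_variety n T \<subseteq> borel_closure n (two_row_word n T)"
proof -
  let ?w = "SOME w. w \<in> cell n T"
  note t = tab2_two_row[OF T]
  have c: "?w \<in> cell n T" "two_row_word n T \<in> cell n T"
    using two_row_word_in_cell[OF T] by (auto intro: someI)
  have "borel_closure n w = borel_closure n (reading T)" if "w \<in> cell n T" for w
    using knuth_borel_closure cell_tab2(1)[OF that t(1)] cellD[OF that] by blast
  then have eq: "borel_closure n ?w = borel_closure n (two_row_word n T)" using c by simp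
  show "zariski_closure n (tableau_variety n T) = borel_closure n (two_row_word n T)"
    unfolding tableau_variety_def eq[symmetric]
    by (rule zariski_closure_orbital_variety[OF n cellD(2)[OF c(1)]])
  have "orbital_variety n ?w \<subseteq> borel_closure n ?w" unfolding orbital_variety_def borel_closure_def by blast
  then show "tableau_variety n T \<subseteq> borel_closure n (two_row_word n T)"
    unfolding tableau_variety_def eq .
qed

text \<open>The passage from geometry to linear spaces goes through combinatorics: inclusion of
  closures gives the inequalities of \<open>lis\<close>, these give the weak order, and the weak
  order gives the inclusion of the spaces.\<close>

lemma tableau_variety_subset_iff:
  assumes n: "n \<ge> 1" and T: "T \<in> two_row_tableaux n" and S: "S \<in> two_row_tableaux n"
  shows "tableau_variety n S \<subseteq> zariski_closure n (tableau_variety n T) \<longleftrightarrow>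
    n_cap n (two_row_word n S) \<subseteq> n_cap n (two_row_word n T)"
proof
  note t = two_row_word_in_cell[OF T] and s = two_row_word_in_cell[OF S]
  assume "tableau_variety n S \<subseteq> zariski_closure n (tableau_variety n T)"
  then have "zariski_closure n (tableau_variety n S) \<subseteq> zariski_closure n (tableau_variety n T)"
    by (rule zariski_closure_minimal)
  then have sub: "borel_closure n (two_row_word n S) \<subseteq> borel_closure n (two_row_word n T)"
    using tableau_variety_closure(1)[OF n] T S by simp
  have "lis (two_row_word n S) {i..j} \<le> lis (two_row_word n T) {i..j}" if "1 \<le> i \<and> i < j \<and> j \<le> n" for i j
    using borel_closure_subset_lis[OF sub] cellD(2)[OF s] cellD(2)[OF t] that by simp
  then have "chain_le n T S"
    using chain_le_iff_lis[OF tab2_two_row[OF T] tab2_two_row[OF S]]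
      cell_lis[OF t tab2_two_row(1)[OF T]] cell_lis[OF s tab2_two_row(1)[OF S]] by simp
  then show "n_cap n (two_row_word n S) \<subseteq> n_cap n (two_row_word n T)"
    using chain_le_iff_weak_le[OF T S] n_cap_mono_iff[OF cellD(2)[OF t] cellD(2)[OF s]] by simp
next
  assume "n_cap n (two_row_word n S) \<subseteq> n_cap n (two_row_word n T)"
  then have "borel_closure n (two_row_word n S) \<subseteq> borel_closure n (two_row_word n T)"
    unfolding borel_closure_def by (intro zariski_closure_mono conj_set_mono)
  then show "tableau_variety n S \<subseteq> zariski_closure n (tableau_variety n T)"
    using tableau_variety_closure(1)[OF n T] tableau_variety_closure(2)[OF n S] by simp
qed

theorem theorem3p17:
  fixes n :: nat and T S :: tableau
  assumes "n \<ge> 1"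
    and "T \<in> two_row_tableaux n" and "S \<in> two_row_tableaux n"
  shows "(chain_less n T S \<longleftrightarrow> weak_less n (two_row_word n T) (two_row_word n S)) \<and>
    (duflo_less n T S \<longleftrightarrow> weak_less n (two_row_word n T) (two_row_word n S)) \<and>
    (tableau_variety n S \<subseteq> zariski_closure n (tableau_variety n T) \<longleftrightarrow>
       n_cap n (two_row_word n S) \<subseteq> n_cap n (two_row_word n T)) \<and>
    (\<forall>P\<in>two_row_tableaux n. \<forall>Q\<in>two_row_tableaux n. duflo_le n P Q \<longleftrightarrow> chain_le n P Q)"
proof -
  have duflo: "duflo_le n P Q \<longleftrightarrow> weak_le n (two_row_word n P) (two_row_word n Q)"
    if "P \<in> two_row_tableaux n" "Q \<in> two_row_tableaux n" for P Q
    using that duflo_le_imp_weak_le weak_le_imp_duflo_le by blast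
  show ?thesis
    using assms duflo chain_le_iff_weak_le tableau_variety_subset_iff two_row_word_inj
    unfolding chain_less_def duflo_less_def weak_less_def by simp
qed

end
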